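(* Let $\mathcal{A}\subset\mathbb{N}^n$ be a finite set all of whose elements have the same coordinate sum, and assume that the polytope $P=\mathrm{conv}(\mathcal{A})$ has dimension $n-1$. The boundary of the copositive cone $\mathcal{C}_{\mathcal{A}}$ is contained in the hypersurface defined by the principal $\mathcal{A}$-determinant $E_{\mathcal{A}}$, which is the product of the discriminants $\Delta_{\mathcal{A}\cap Q}$ over all faces $Q$ of $P$.
   Context: $\mathbb{R}[\mathcal{A}]$ is the real vector space of polynomials $f(x)=\sum_{\mathbf{a}\in\mathcal{A}}c_{\mathbf{a}}x^{\mathbf{a}}$ with $c_{\mathbf{a}}\in\mathbb{R}$, where $x=(x_1,\dots,x_n)$. The copositive cone is $\mathcal{C}_{\mathcal{A}}=\{f\in\mathbb{R}[\mathcal{A}]: f(u)\ge0\text{ for all }u\in\mathbb{R}^n_{\ge0}\}$, and its boundary is taken in $\mathbb{R}[\mathcal{A}]$. Faces of $P$ are nonempty and include $P$ itself and the vertices. For a face $Q$, $f|_Q$ denotes the sum of all terms $c_{\mathbf{a}}x^{\mathbf{a}}$ of $f$ with $\mathbf{a}\in Q$. The discriminant $\Delta_{\mathcal{A}\cap Q}$ (in the sense of Gel'fand, Kapranov and Zelevinsky) is the irreducible polynomial in the coefficients $c_{\mathbf{a}}$, $\mathbf{a}\in\mathcal{A}\cap Q$, that defines the Zariski closure of the set of polynomials $g\in\mathbb{C}[\mathcal{A}\cap Q]$ for which there exists $x\in(\mathbb{C}^* )^n$ at which $g$ and all its partial derivatives vanish, if this closure is a hypersurface; otherwise $\Delta_{\mathcal{A}\cap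 Q}=1$. The principal $\mathcal{A}$-determinant $E_{\mathcal{A}}$ is the product of all these discriminants over all faces $Q$ of $P$ (in Gel'fand–Kapranov–Zelevinsky the factors may carry positive multiplicities, which do not affect the zero set). *)

theory Defs
  imports
    "HOL-Analysis.Analysis"
    "HOL-Library.Poly_Mapping"
    "HOL-Computational_Algebra.Factorial_Ring"
begin

text \<open>
  Polynomials with variables indexed by \<open>'v\<close>: finitely supported maps from monomials to
  coefficients.  The same type is used for the polynomials \<open>f\<close> in the variables \<open>x\<^sub>i\<close>
  (\<open>'v = 'n\<close>) and for polynomials in the coefficients \<open>c\<^sub>a\<close> of such \<open>f\<close>
  (\<open>'v = 'n expo\<close>, one variable for each exponent vector).
\<close>

type_synonym ('v, 'r) mpoly = "('v \<Rightarrow>\<^sub>0 nat) \<Rightarrow>\<^sub>0 'r"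

type_synonym 'n expo = "'n \<Rightarrow>\<^sub>0 nat"

definition mpoly_eval :: "('v, 'r::comm_semiring_1) mpoly \<Rightarrow> ('v \<Rightarrow> 'r) \<Rightarrow> 'r" where
  "mpoly_eval p x =
     (\<Sum>m\<in>Poly_Mapping.keys p. Poly_Mapping.lookup p m *
        (\<Prod>v\<in>Poly_Mapping.keys m. x v ^ Poly_Mapping.lookup m v))"

definition polys_on :: "'n expo set \<Rightarrow> ('n, 'r::zero) mpoly set" where
  "polys_on A = {f. Poly_Mapping.keys f \<subseteq> A}"

definition coeff_space_topology :: "'n expo set \<Rightarrow> ('n, real) mpoly topology" where
  \<comment> \<open>Convergence of all coefficients; for finite \<open>A\<close> this is the standard topology of the
      finite-dimensional real vector space of polynomials supported on \<open>A\<close>.\<close>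
  "coeff_space_topology A = pullback_topology (polys_on A) Poly_Mapping.lookup euclidean"

definition copositive_cone :: "'n expo set \<Rightarrow> ('n, real) mpoly set" where
  "copositive_cone A =
     {f \<in> polys_on A. \<forall>u. (\<forall>i. 0 \<le> u i) \<longrightarrow> 0 \<le> mpoly_eval f u}"

definition expo_vec :: "'n::finite expo \<Rightarrow> real ^ 'n" where
  "expo_vec a = (\<chi> i. real (Poly_Mapping.lookup a i))"

definition newton_polytope :: "'n::finite expo set \<Rightarrow> (real ^ 'n) set" where
  "newton_polytope A = convex hull (expo_vec ` A)"

definition poly_faces :: "'n::finite expo set \<Rightarrow> (real ^ 'n) set set" where
  "poly_faces A = {Q. Q face_of newton_polytope A \<and> Q \<noteq> {}}"

definition coeff_polys :: "'n expo set \<Rightarrow> ('n expo, complex) mpoly set" where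
  \<comment> \<open>The polynomials in the coefficients \<open>c\<^sub>a\<close> with \<open>a \<in> B\<close>.\<close>
  "coeff_polys B = {p. \<forall>m\<in>Poly_Mapping.keys p. Poly_Mapping.keys m \<subseteq> B}"

definition zero_locus :: "'n expo set \<Rightarrow> ('n expo, complex) mpoly \<Rightarrow> ('n, complex) mpoly set" where
  "zero_locus B p = {g \<in> polys_on B. mpoly_eval p (Poly_Mapping.lookup g) = 0}"

definition zariski_closure ::
    "'n expo set \<Rightarrow> ('n, complex) mpoly set \<Rightarrow> ('n, complex) mpoly set" where
  "zariski_closure B S =
     {g \<in> polys_on B. \<forall>p\<in>coeff_polys B. S \<subseteq> zero_locus B p \<longrightarrow> g \<in> zero_locus B p}"

definition is_hypersurface :: "'n expo set \<Rightarrow> ('n, complex) mpoly set \<Rightarrow> bool" where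
  \<comment> \<open>The condition on \<open>keys\<close> says that \<open>p\<close> is not constant.\<close>
  "is_hypersurface B Z \<longleftrightarrow>
     (\<exists>p\<in>coeff_polys B. \<not> Poly_Mapping.keys p \<subseteq> {0} \<and> Z = zero_locus B p)"

definition singular_polys :: "'n expo set \<Rightarrow> ('n, complex) mpoly set" where
  "singular_polys B =
     {g \<in> polys_on B. \<exists>x. (\<forall>i. x i \<noteq> 0) \<and> mpoly_eval g x = 0 \<and>
        (\<forall>i. deriv (\<lambda>t. mpoly_eval g (x(i := t))) (x i) = 0)}"

definition discriminant :: "'n expo set \<Rightarrow> ('n expo, complex) mpoly" where
  \<comment> \<open>The irreducible polynomial is determined up to a nonzero constant factor only; the choice
      does not affect its zero set.\<close>
  "discriminant B =
     (let Z = zariski_closure B (singular_polys B)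
      in if is_hypersurface B Z
         then (SOME D. D \<in> coeff_polys B \<and> irreducible D \<and> zero_locus B D = Z)
         else 1)"

definition principal_determinant :: "'n::finite expo set \<Rightarrow> ('n expo, complex) mpoly" where
  "principal_determinant A = (\<Prod>Q\<in>poly_faces A. discriminant {a \<in> A. expo_vec a \<in> Q})"

end

theory Submission
  imports Defs
begin

text \<open>
  Let \<open>f\<close> lie on the boundary of the copositive cone.  Nearby polynomials take negative values at
  points \<open>u\<^sub>k\<close> of the open orthant.  After passing to a subsequence the vectors of normalised
  monomials \<open>u\<^sub>k\<^sup>a / (\<Sum>\<^sub>b u\<^sub>k\<^sup>b)\<close> converge, and their limit is supported on the exponents of one
  face \<open>Q\<close>, where it is proportional to \<open>w\<^sup>a\<close> for some \<open>w > 0\<close> (\<open>toric_limit\<close>).  Hence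
  \<open>f|\<^sub>Q\<close> is nonnegative on the positive orthant and vanishes at \<open>w\<close>, so \<open>w\<close> is a minimum and
  \<open>f|\<^sub>Q\<close> is singular at \<open>w\<close> (\<open>boundary_singular_on_face\<close>).  If the closure of the singular
  polynomials supported on \<open>Q\<close> is a hypersurface, the discriminant of \<open>Q\<close> vanishes at \<open>f\<close>.

  The difficulty is a face whose discriminant is \<open>1\<close> because that closure has larger codimension.
  Such faces account only for a nowhere dense part of the boundary, for the following reason.
  Adding a positive multiple of \<open>\<Sum>\<^sub>a x\<^sup>a\<close> moves a copositive polynomial into the interior of the
  cone, so near \<open>f\<close> every line in the direction \<open>(1, \<dots>, 1)\<close> of the coefficient space crosses the
  boundary (\<open>boundary_crossed_diagonally\<close>): the boundary projects onto a neighbourhood.  On the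
  other hand, unless the discriminant of a face vanishes on the singular locus of that face, some nonzero
  polynomial \<open>R\<close>, invariant under translation by \<open>(1, \<dots>, 1)\<close>, vanishes on this locus
  (\<open>discriminant_or_projection\<close>), and the projection of the locus lies in the proper algebraic set \<open>R = 0\<close>.
  Choosing lines that avoid these sets gives boundary points arbitrarily close to \<open>f\<close> at which the
  principal determinant vanishes, and \<open>f\<close> itself follows by continuity.

  The dichotomy is commutative algebra.  The polynomials that vanish on the singular locus of a
  support set \<open>B\<close> form an ideal, which is prime because the locus is the image of an irreducible
  parameter space (\<open>sing_ideal_prime\<close>) and nonzero by a dimension count
  (\<open>vanishing_polynomial_exists\<close>).  In a polynomial ring, a nonzero prime ideal that contains no
  nonzero polynomial invariant along a direction is principal (\<open>prime_ideal_generator\<close>); this rests on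
  unique factorisation (\<open>polys_in_prime_product\<close>).  The generator is irreducible and cuts out exactly
  the Zariski closure, so the closure is a hypersurface and the discriminant is the expected one.
\<close>

section \<open>Polynomial functions as an integral domain\<close>

inductive_set poly_maps :: "(('v \<Rightarrow> complex) \<Rightarrow> complex) set" where
  const: "(\<lambda>_. k) \<in> poly_maps"
| coord: "(\<lambda>c. c v) \<in> poly_maps"
| add: "F \<in> poly_maps \<Longrightarrow> G \<in> poly_maps \<Longrightarrow> (\<lambda>c. F c + G c) \<in> poly_maps"
| mult: "F \<in> poly_maps \<Longrightarrow> G \<in> poly_maps \<Longrightarrow> (\<lambda>c. F c * G c) \<in> poly_maps"

lemma poly_maps_along_curve:
  assumes "F \<in> poly_maps"
  shows "\<exists>P. \<forall>t. F (\<lambda>v. poly (X v) t) = poly P t"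
  using assms
proof induction
  case (const k) then show ?case by (intro exI[of _ "[:k:]"]) simp
next
  case (coord v) then show ?case by (intro exI[of _ "X v"]) simp
next
  case (add F G) then show ?case by (metis poly_add)
next
  case (mult F G) then show ?case by (metis poly_mult)
qed

text \<open>
  Polynomials over \<open>\<complex>\<close> are identified with the functions that they define.  Domain arguments,
  translations and restrictions to curves are then statements about functions, and the type can be
  made an integral domain for an arbitrary index type of variables, which monomial orders would
  only give for ordered index types.
\<close>

typedef 'v polyfun = "poly_maps :: (('v \<Rightarrow> complex) \<Rightarrow> complex) set"
  morphisms peval Polyfun
  using poly_maps.const by blast

setup_lifting type_definition_polyfun

lemma peval_along_curve:
  "\<exists>P. \<forall>t. peval F (\<lambda>v. poly (X v) t) = poly P t"
  using poly_maps_along_curve[OF peval[of F], of X] by blast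

lemma polyfun_eqI: "(\<And>c. peval F c = peval G c) \<Longrightarrow> F = G"
  by (simp add: peval_inject[symmetric] fun_eq_iff)

lift_definition pconst :: "complex \<Rightarrow> 'v polyfun" is "\<lambda>k _. k" by (rule poly_maps.const)
lift_definition pvar :: "'v \<Rightarrow> 'v polyfun" is "\<lambda>v c. c v" by (rule poly_maps.coord)

instantiation polyfun :: (type) comm_ring_1
begin

lift_definition zero_polyfun :: "'a polyfun" is "\<lambda>_. 0" by (rule poly_maps.const)
lift_definition one_polyfun :: "'a polyfun" is "\<lambda>_. 1" by (rule poly_maps.const)
lift_definition plus_polyfun :: "'a polyfun \<Rightarrow> 'a polyfun \<Rightarrow> 'a polyfun"
  is "\<lambda>F G c. F c + G c" by (rule poly_maps.add)
lift_definition times_polyfun :: "'a polyfun \<Rightarrow> 'a polyfun \<Rightarrow> 'a polyfun"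
  is "\<lambda>F G c. F c * G c" by (rule poly_maps.mult)
lift_definition uminus_polyfun :: "'a polyfun \<Rightarrow> 'a polyfun" is "\<lambda>F c. - F c"
proof -
  fix F :: "('a \<Rightarrow> complex) \<Rightarrow> complex" assume "F \<in> poly_maps"
  from poly_maps.mult[OF poly_maps.const[of "-1"] this] show "(\<lambda>c. - F c) \<in> poly_maps" by simp
qed
lift_definition minus_polyfun :: "'a polyfun \<Rightarrow> 'a polyfun \<Rightarrow> 'a polyfun" is "\<lambda>F G c. F c - G c"
proof -
  fix F G :: "('a \<Rightarrow> complex) \<Rightarrow> complex" assume "F \<in> poly_maps" "G \<in> poly_maps"
  from poly_maps.add[OF this(1) poly_maps.mult[OF poly_maps.const[of "-1"] this(2)]]
  show "(\<lambda>c. F c - G c) \<in> poly_maps" by simp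
qed

instance
proof
  fix a b c :: "'a polyfun"
  show "a * b * c = a * (b * c)" "a * b = b * a" "1 * a = a" "(a + b) * c = a * c + b * c"
    "a + b + c = a + (b + c)" "a + b = b + a" "0 + a = a" "- a + a = 0"
    by (transfer; simp add: algebra_simps)+
  show "a - b = a + - b" by transfer simp
  show "(0 :: 'a polyfun) \<noteq> 1" by transfer (simp add: fun_eq_iff)
qed

end

lemma peval_simps [simp]:
  "peval 0 c = 0" "peval 1 c = 1" "peval (F + G) c = peval F c + peval G c"
  "peval (F * G) c = peval F c * peval G c" "peval (- F) c = - peval F c"
  "peval (pconst k) c = k" "peval (pvar v) c = c v" "peval (F - G) c = peval F c - peval G c"
  by (transfer; simp)+

lemma peval_sum [simp]: "peval (\<Sum>i\<in>S. F i) c = (\<Sum>i\<in>S. peval (F i) c)"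
  by (induction S rule: infinite_finite_induct) auto

lemma peval_prod [simp]: "peval (\<Prod>i\<in>S. F i) c = (\<Prod>i\<in>S. peval (F i) c)"
  by (induction S rule: infinite_finite_induct) auto

lemma peval_power [simp]: "peval (F ^ n) c = peval F c ^ n"
  by (induction n) auto

text \<open>
  Two nonzero polynomial functions are nonzero at points \<open>x\<close> and \<open>y\<close>; on the line through these
  points both become nonzero polynomials in one variable.
\<close>

instance polyfun :: (type) idom
proof
  fix F G :: "'a polyfun"
  assume "F \<noteq> 0" "G \<noteq> 0"
  then obtain x y where x: "peval F x \<noteq> 0" and y: "peval G y \<noteq> 0"
    by (metis polyfun_eqI peval_simps(1))
  let ?X = "\<lambda>v. [:x v, y v - x v:]"
  obtain P where P: "\<And>t. peval F (\<lambda>v. poly (?X v) t) = poly P t" using peval_along_curve[of F ?X] by blast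
  obtain Q where Q: "\<And>t. peval G (\<lambda>v. poly (?X v) t) = poly Q t" using peval_along_curve[of G ?X] by blast
  have "poly P 0 \<noteq> 0" "poly Q 1 \<noteq> 0" using x y by (simp_all flip: P Q)
  then have "P * Q \<noteq> 0" by auto
  then obtain t where "poly (P * Q) t \<noteq> 0" using poly_all_0_iff_0 by blast
  then have "peval (F * G) (\<lambda>v. poly (?X v) t) \<noteq> 0"
    unfolding peval_simps P Q poly_mult .
  then show "F * G \<noteq> 0" by fastforce
qed

lemma polyfun_induct [case_names const var add mult]:
  assumes "\<And>k. Q (pconst k)" "\<And>v. Q (pvar v)"
    "\<And>F G. Q F \<Longrightarrow> Q G \<Longrightarrow> Q (F + G)" "\<And>F G. Q F \<Longrightarrow> Q G \<Longrightarrow> Q (F * G)"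
  shows "Q F"
proof -
  have "\<And>F. f = peval F \<Longrightarrow> Q F" if "f \<in> poly_maps" for f
    using that
  proof (induction f rule: poly_maps.induct)
    case (const k) then show ?case using assms(1)[of k] by (metis polyfun_eqI peval_simps(6))
  next
    case (coord v) then show ?case using assms(2)[of v] by (metis polyfun_eqI peval_simps(7))
  next
    case (add f g)
    obtain F' G' where fg: "f = peval F'" "g = peval G'" using add.hyps by (metis Polyfun_inverse)
    then have "F = F' + G'" using add.prems by (intro polyfun_eqI) (metis peval_simps(3))
    then show ?case using add.IH fg assms(3) by blast
  next
    case (mult f g)
    obtain F' G' where fg: "f = peval F'" "g = peval G'" using mult.hyps by (metis Polyfun_inverse)
    then have "F = F' * G'" using mult.prems by (intro polyfun_eqI) (metis peval_simps(4))
    then show ?case using mult.IH fg assms(4) by blast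
  qed
  from this[OF peval[of F]] show ?thesis by blast
qed

section \<open>Subrings and pseudo-division\<close>

definition subring :: "'a::idom set \<Rightarrow> bool" where
  "subring R \<longleftrightarrow> 0 \<in> R \<and> 1 \<in> R \<and> (\<forall>a\<in>R. \<forall>b\<in>R. a + b \<in> R \<and> a * b \<in> R) \<and> (\<forall>a\<in>R. - a \<in> R)"

lemma subringD:
  assumes "subring R"
  shows "0 \<in> R" "1 \<in> R" "a \<in> R \<Longrightarrow> b \<in> R \<Longrightarrow> a + b \<in> R" "a \<in> R \<Longrightarrow> b \<in> R \<Longrightarrow> a * b \<in> R"
    "a \<in> R \<Longrightarrow> - a \<in> R" "a \<in> R \<Longrightarrow> b \<in> R \<Longrightarrow> a - b \<in> R" "a \<in> R \<Longrightarrow> a ^ n \<in> R"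
proof -
  show r: "0 \<in> R" "1 \<in> R" "a \<in> R \<Longrightarrow> b \<in> R \<Longrightarrow> a + b \<in> R" "a \<in> R \<Longrightarrow> b \<in> R \<Longrightarrow> a * b \<in> R"
    "a \<in> R \<Longrightarrow> - a \<in> R" for a b
    using assms by (auto simp: subring_def)
  show "a \<in> R \<Longrightarrow> b \<in> R \<Longrightarrow> a - b \<in> R" using r by (metis add_uminus_conv_diff)
  show "a \<in> R \<Longrightarrow> a ^ n \<in> R" by (induction n) (auto intro: r)
qed

lemma subring_sum: "subring R \<Longrightarrow> (\<And>i. i \<in> S \<Longrightarrow> f i \<in> R) \<Longrightarrow> (\<Sum>i\<in>S. f i) \<in> R"
  by (induction S rule: infinite_finite_induct) (auto intro: subringD)

definition polys_over :: "'a::idom set \<Rightarrow> 'a poly set" where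
  "polys_over R = {P. \<forall>i. coeff P i \<in> R}"

lemma subring_polys_over:
  assumes "subring R" shows "subring (polys_over R)"
  unfolding subring_def polys_over_def
  using subringD[OF assms]
  by (auto simp: coeff_mult coeff_1 intro!: subring_sum[OF assms] split: if_splits)

lemma const_in_polys_over [simp]: "subring R \<Longrightarrow> [:a:] \<in> polys_over R \<longleftrightarrow> a \<in> R"
  by (auto simp: polys_over_def coeff_pCons subringD split: nat.splits dest: spec[of _ 0])

lemma monom_in_polys_over: "subring R \<Longrightarrow> a \<in> R \<Longrightarrow> monom a n \<in> polys_over R"
  by (auto simp: polys_over_def subringD)

lemma smult_in_polys_over: "subring R \<Longrightarrow> a \<in> R \<Longrightarrow> P \<in> polys_over R \<Longrightarrow> smult a P \<in> polys_over R"
  by (auto simp: polys_over_def subringD)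

lemma lead_coeff_in: "P \<in> polys_over R \<Longrightarrow> lead_coeff P \<in> R"
  by (auto simp: polys_over_def)

text \<open>
  Division with remainder after multiplying by a constant, with all coefficients kept inside the
  subring \<open>R\<close>: the factor \<open>c\<close> has to lie in the smaller ring, whose elements are already known to
  factor into primes.
\<close>

lemma pseudo_division:
  fixes f g :: "'a::idom poly"
  assumes R: "subring R" and g: "g \<in> polys_over R" "g \<noteq> 0" and f: "f \<in> polys_over R"
  shows "\<exists>c q r. c \<in> R \<and> c \<noteq> 0 \<and> q \<in> polys_over R \<and> r \<in> polys_over R \<and>
    smult c f = g * q + r \<and> (r = 0 \<or> degree r < degree g)"
  using f
proof (induction "degree f" arbitrary: f rule: less_induct)
  case less
  note S = subringD[OF subring_polys_over[OF R]]
  show ?case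
  proof (cases "f = 0 \<or> degree f < degree g")
    case True
    then show ?thesis using less.prems S(1) subringD(2)[OF R]
      by (intro exI[of _ 1] exI[of _ 0] exI[of _ f]) auto
  next
    case False
    define m where "m = monom (lead_coeff f) (degree f - degree g)"
    define f1 where "f1 = smult (lead_coeff g) f - g * m"
    have m: "m \<in> polys_over R" unfolding m_def
      by (intro monom_in_polys_over lead_coeff_in R less.prems)
    have lg: "lead_coeff g \<in> R" "lead_coeff g \<noteq> 0" using g by (auto intro: lead_coeff_in)
    have f1: "f1 \<in> polys_over R" unfolding f1_def
      by (intro S smult_in_polys_over R lg less.prems g m)
    have nz: "f \<noteq> 0" "m \<noteq> 0" using False by (auto simp: m_def)
    have dm: "degree (g * m) = degree f"
      using False g nz by (simp add: degree_mult_eq m_def degree_monom_eq)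
    have lc: "coeff (g * m) (degree f) = lead_coeff g * lead_coeff f"
    proof -
      have "lead_coeff m = lead_coeff f" using nz by (simp add: m_def degree_monom_eq)
      then show ?thesis using lead_coeff_mult[of g m] dm by simp
    qed
    have d1: "f1 = 0 \<or> degree f1 < degree f"
    proof -
      have "degree f1 \<le> degree f" unfolding f1_def
        by (intro degree_diff_le) (auto simp: dm degree_smult_le)
      moreover have "coeff f1 (degree f) = 0" using lc by (simp add: f1_def)
      ultimately show ?thesis by (metis leading_coeff_0_iff le_neq_implies_less)
    qed
    have "\<exists>c q r. c \<in> R \<and> c \<noteq> 0 \<and> q \<in> polys_over R \<and> r \<in> polys_over R \<and>
      smult c f1 = g * q + r \<and> (r = 0 \<or> degree r < degree g)"
    proof (cases "f1 = 0")
      case True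
      then show ?thesis using S(1) subringD(2)[OF R]
        by (intro exI[of _ 1] exI[of _ 0]) auto
    next
      case False
      then show ?thesis using less.hyps[OF _ f1] d1 by blast
    qed
    then obtain c q r where *: "c \<in> R" "c \<noteq> 0" "q \<in> polys_over R" "r \<in> polys_over R"
      "smult c f1 = g * q + r" "r = 0 \<or> degree r < degree g" by blast
    have "smult (c * lead_coeff g) f = g * (q + smult c m) + r"
      using *(5) by (simp add: f1_def smult_diff_right algebra_simps)
    moreover have "c * lead_coeff g \<in> R" "c * lead_coeff g \<noteq> 0" "q + smult c m \<in> polys_over R"
      using * lg m R S by (auto intro: subringD smult_in_polys_over)
    ultimately show ?thesis using * by blast
  qed
qed

section \<open>Expansion along a direction\<close>

definition inv_along :: "('v \<Rightarrow> complex) \<Rightarrow> 'v polyfun set" where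
  "inv_along v = {F. \<forall>c s. peval F (\<lambda>x. c x + s * v x) = peval F c}"

lemma inv_alongD: "F \<in> inv_along v \<Longrightarrow> peval F (\<lambda>x. c x + s * v x) = peval F c"
  by (simp add: inv_along_def)

lemma subring_inv_along: "subring (inv_along v)"
  by (auto simp: subring_def inv_along_def)

definition specialize :: "('v \<Rightarrow> complex) \<Rightarrow> 'v polyfun poly \<Rightarrow> complex poly" where
  "specialize c P = map_poly (\<lambda>a. peval a c) P"

lemma coeff_specialize [simp]: "coeff (specialize c P) i = peval (coeff P i) c"
  by (simp add: specialize_def coeff_map_poly)

lemma poly_specialize: "poly (specialize c P) (peval x c) = peval (poly P x) c"
proof (induction P)
  case 0
  then show ?case by (simp add: specialize_def)
next
  case (pCons a P)
  have "specialize c (pCons a P) = pCons (peval a c) (specialize c P)"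
    by (simp add: specialize_def map_poly_pCons)
  then show ?case using pCons by simp
qed

text \<open>
  Along the line through \<open>c\<close> in direction \<open>v\<close> the invariant coefficients are constant, so the function
  restricts to the specialised univariate polynomial.  This makes expansions in the coordinate \<open>z\<close>
  unique.
\<close>

lemma peval_poly_along:
  assumes "P \<in> polys_over (inv_along v)" "v z = 1"
  shows "peval (poly P (pvar z)) (\<lambda>x. c x + s * v x) = poly (specialize c P) (c z + s)"
proof -
  let ?c = "\<lambda>x. c x + s * v x"
  have "specialize ?c P = specialize c P"
    using assms(1) by (intro poly_eqI) (auto simp: polys_over_def inv_along_def)
  then show ?thesis using poly_specialize[of ?c P "pvar z"] assms(2) by simp
qed

text \<open>
  A direction \<open>v\<close> with a coordinate \<open>z\<close> normalised along it.  The polynomial ring is the univariate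
  polynomial ring in \<open>pvar z\<close> over the subring of polynomials invariant along \<open>v\<close>, since
  \<open>pvar b - v b * pvar z\<close> is invariant for every \<open>b\<close>.  For a unit vector \<open>v\<close> this singles out one variable;
  for \<open>v = (1, \<dots>, 1)\<close> it describes the projection along the diagonal.  Below, the elements of the
  coefficient ring, that is, the polynomials invariant along \<open>v\<close>, are called constants.
\<close>

locale direction =
  fixes v :: "'v \<Rightarrow> complex" and z :: 'v
  assumes vz: "v z = 1"
begin

abbreviation "R \<equiv> inv_along v"

lemma poly_pvar_eq_0:
  assumes "P \<in> polys_over R" "poly P (pvar z) = 0"
  shows "P = 0"
proof -
  have "specialize c P = 0" for c
  proof -
    have "poly (specialize c P) t = 0" for t
      using peval_poly_along[OF assms(1) vz, of c "t - c z"] assms(2) by simp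
    then show ?thesis using poly_all_0_iff_0 by blast
  qed
  then have "peval (coeff P i) c = 0" for i c by (metis coeff_specialize coeff_0)
  then show ?thesis by (intro poly_eqI polyfun_eqI) simp
qed

lemma polys_over_R: "subring (polys_over R)"
  by (intro subring_polys_over subring_inv_along)

lemma rep_exists: "\<exists>P\<in>polys_over R. poly P (pvar z) = F"
proof (induction F rule: polyfun_induct)
  case (const k)
  have "pconst k \<in> R" by (simp add: inv_along_def)
  then show ?case by (intro bexI[of _ "[:pconst k:]"]) (simp_all add: subring_inv_along)
next
  case (var b)
  have "pconst (v b) \<in> R" "pvar b - pconst (v b) * pvar z \<in> R"
    using vz by (auto simp: inv_along_def algebra_simps)
  then have "[:pvar b - pconst (v b) * pvar z, pconst (v b):] \<in> polys_over R"
    using subringD(1)[OF subring_inv_along[of v]]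
    by (auto simp: polys_over_def coeff_pCons split: nat.splits)
  then show ?case by (rule bexI[rotated]) (simp add: algebra_simps)
next
  case (add F G)
  then show ?case using subringD(3)[OF polys_over_R] by (metis poly_add)
next
  case (mult F G)
  then show ?case using subringD(4)[OF polys_over_R] by (metis poly_mult)
qed

definition rep :: "'v polyfun \<Rightarrow> 'v polyfun poly" where
  "rep F = (SOME P. P \<in> polys_over R \<and> poly P (pvar z) = F)"

lemma rep: "rep F \<in> polys_over R" "poly (rep F) (pvar z) = F"
  using someI_ex[of "\<lambda>P. P \<in> polys_over R \<and> poly P (pvar z) = F"] rep_exists[of F]
  unfolding rep_def by blast+

lemma rep_unique:
  assumes "P \<in> polys_over R" "poly P (pvar z) = F" shows "rep F = P"
proof -
  have "rep F - P \<in> polys_over R" "poly (rep F - P) (pvar z) = 0"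
    using rep[of F] assms subringD(6)[OF polys_over_R] by auto
  then show ?thesis using poly_pvar_eq_0 by fastforce
qed

lemma rep_mult: "rep (F * G) = rep F * rep G"
  and rep_add: "rep (F + G) = rep F + rep G"
  and rep_diff: "rep (F - G) = rep F - rep G"
  using rep[of F] rep[of G] subringD[OF polys_over_R] by (auto intro!: rep_unique)

lemma rep_const: "F \<in> R \<Longrightarrow> rep F = [:F:]"
  by (intro rep_unique) (simp_all add: subring_inv_along)

lemma rep_eq_0_iff [simp]: "rep F = 0 \<longleftrightarrow> F = 0"
  using rep(2)[of F] poly_0[of "pvar z"] subringD(1)[OF polys_over_R] rep_unique[of 0 F] by auto

definition deg :: "'v polyfun \<Rightarrow> nat" where "deg F = degree (rep F)"

definition lc :: "'v polyfun \<Rightarrow> 'v polyfun" where "lc F = lead_coeff (rep F)"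

lemma deg_mult: "F \<noteq> 0 \<Longrightarrow> G \<noteq> 0 \<Longrightarrow> deg (F * G) = deg F + deg G"
  by (simp add: deg_def rep_mult degree_mult_eq)

lemma lc_mult: "lc (F * G) = lc F * lc G"
  by (simp add: lc_def rep_mult lead_coeff_mult)

lemma lc_eq_0_iff [simp]: "lc F = 0 \<longleftrightarrow> F = 0"
  by (simp add: lc_def)

lemma deg_eq_0_iff: "deg F = 0 \<longleftrightarrow> F \<in> R"
proof
  assume "deg F = 0"
  then obtain a where "rep F = [:a:]" by (metis deg_def degree_eq_zeroE)
  then show "F \<in> R" using rep[of F] by (auto simp: subring_inv_along)
qed (simp add: deg_def rep_const)

lemma lc_of_const: "F \<in> R \<Longrightarrow> lc F = F"
  by (simp add: lc_def rep_const)

text \<open>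
  Degrees in \<open>pvar z\<close> add up, so a divisor of a polynomial of degree \<open>0\<close> has degree \<open>0\<close>.  Because of
  this, divisibility in the subring and in the whole ring agree and one divisibility relation suffices.
\<close>

lemma inv_factor_closed: "F * G \<in> R \<Longrightarrow> F * G \<noteq> 0 \<Longrightarrow> F \<in> R"
  using deg_mult[of F G] by (auto simp flip: deg_eq_0_iff)

lemma const_dvd_iff:
  assumes "a \<in> R" shows "a dvd F \<longleftrightarrow> (\<forall>i. a dvd coeff (rep F) i)"
proof
  assume "a dvd F"
  then obtain G where "F = a * G" ..
  then have "rep F = [:a:] * rep G" by (simp add: rep_mult rep_const assms)
  then show "\<forall>i. a dvd coeff (rep F) i" by simp
next
  assume "\<forall>i. a dvd coeff (rep F) i"
  then show "a dvd F"
    using rep(2)[of F] by (metis (no_types, lifting) dvd_mult2 dvd_sum poly_altdef)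
qed

end

section \<open>Polynomials in a given set of variables\<close>

text \<open>
  Dependence on the variables in \<open>V\<close> only, phrased as invariance along all directions that do not
  move them, so that the results about directions apply.
\<close>

definition polys_in :: "'v set \<Rightarrow> 'v polyfun set" where
  "polys_in V = {F. \<forall>w. (\<forall>b\<in>V. w b = 0) \<longrightarrow> F \<in> inv_along w}"

lemma subring_polys_in: "subring (polys_in V)"
  by (simp add: subring_def polys_in_def inv_along_def)

lemma polys_in_mono: "V \<subseteq> W \<Longrightarrow> polys_in V \<subseteq> polys_in W"
  by (auto simp: polys_in_def)

lemma pvar_in: "b \<in> V \<Longrightarrow> pvar b \<in> polys_in V"
  by (auto simp: polys_in_def inv_along_def)

lemma pconst_in: "pconst k \<in> polys_in V"
  by (auto simp: polys_in_def inv_along_def)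

lemma polys_in_eqD:
  assumes "F \<in> polys_in V" "\<And>b. b \<in> V \<Longrightarrow> c b = c' b"
  shows "peval F c = peval F c'"
proof -
  have "F \<in> inv_along (\<lambda>x. c' x - c x)" using assms by (auto simp: polys_in_def)
  from inv_alongD[OF this, of c 1] show ?thesis by simp
qed

lemma polys_inI:
  assumes "\<And>c c'. (\<And>b. b \<in> V \<Longrightarrow> c b = c' b) \<Longrightarrow> peval F c = peval F c'"
  shows "F \<in> polys_in V"
  unfolding polys_in_def inv_along_def by (auto intro!: assms)

lemma finite_variables: "\<exists>V. finite V \<and> F \<in> polys_in V"
proof (induction F rule: polyfun_induct)
  case (const k) then show ?case using pconst_in by blast
next
  case (var b) then show ?case using pvar_in[of b "{b}"] by blast
next
  case (add F G)
  then obtain V W where "finite V" "finite W" "F \<in> polys_in V" "G \<in> polys_in W" by blast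
  then show ?case using polys_in_mono[of V "V \<union> W"] polys_in_mono[of W "V \<union> W"]
    by (intro exI[of _ "V \<union> W"]) (auto intro!: subringD(3)[OF subring_polys_in])
next
  case (mult F G)
  then obtain V W where "finite V" "finite W" "F \<in> polys_in V" "G \<in> polys_in W" by blast
  then show ?case using polys_in_mono[of V "V \<union> W"] polys_in_mono[of W "V \<union> W"]
    by (intro exI[of _ "V \<union> W"]) (auto intro!: subringD(4)[OF subring_polys_in])
qed

lemma polys_in_factor_closed:
  assumes "F * G \<in> polys_in V" "F * G \<noteq> 0"
  shows "F \<in> polys_in V"
proof -
  have "F \<in> inv_along w" if w: "\<forall>b\<in>V. w b = 0" for w
  proof (cases "\<exists>z. w z \<noteq> 0")
    case True
    then obtain z where z: "w z \<noteq> 0" by blast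
    define v where "v = (\<lambda>x. w x / w z)"
    have FG: "F * G \<in> inv_along v" using assms(1) w by (auto simp: polys_in_def v_def)
    interpret direction v z by unfold_locales (simp add: v_def z)
    have *: "F \<in> inv_along v" using inv_factor_closed FG assms(2) by blast
    show ?thesis unfolding inv_along_def
    proof (safe)
      fix c s
      show "peval F (\<lambda>x. c x + s * w x) = peval F c"
        using inv_alongD[OF *, of c "s * w z"] z by (simp add: v_def)
    qed
  qed (auto simp: inv_along_def)
  then show ?thesis by (auto simp: polys_in_def)
qed

definition unit_vec :: "'v \<Rightarrow> 'v \<Rightarrow> complex" where
  "unit_vec z x = (if x = z then 1 else 0)"

lemma direction_unit_vec: "direction (unit_vec z) z"
  by unfold_locales (simp add: unit_vec_def)

lemma polys_in_inv_along: "z \<notin> V \<Longrightarrow> F \<in> polys_in V \<Longrightarrow> F \<in> inv_along (unit_vec z)"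
  by (auto simp: polys_in_def unit_vec_def dest!: spec[of _ "unit_vec z"])

text \<open>
  A translation that fixes the coordinates in \<open>V\<close> moves the coordinate \<open>z\<close> as well; after the shift
  along \<open>z\<close> has been compensated for, the two specialised polynomials agree as functions of one variable.
\<close>

lemma coeff_rep_in:
  assumes F: "F \<in> polys_in (insert z V)"
  shows "coeff (direction.rep (unit_vec z) z F) i \<in> polys_in V"
proof -
  interpret direction "unit_vec z" z by (rule direction_unit_vec)
  have "coeff (rep F) i \<in> inv_along w" if w: "\<forall>b\<in>V. w b = 0" for w
    unfolding inv_along_def
  proof safe
    fix c s
    let ?c = "\<lambda>x. c x + s * w x"
    have "poly (specialize ?c (rep F)) t = poly (specialize c (rep F)) t" for t
    proof -
      have 1: "poly (specialize ?c (rep F)) t = peval F (\<lambda>x. ?c x + (t - ?c z) * unit_vec z x)"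
        using peval_poly_along[OF rep(1) vz, of F ?c "t - ?c z"] rep(2)[of F] by simp
      have 2: "poly (specialize c (rep F)) t = peval F (\<lambda>x. c x + (t - c z) * unit_vec z x)"
        using peval_poly_along[OF rep(1) vz, of F c "t - c z"] rep(2)[of F] by simp
      show ?thesis unfolding 1 2
        by (intro polys_in_eqD[OF F]) (use w in \<open>auto simp: unit_vec_def\<close>)
    qed
    then have "specialize ?c (rep F) = specialize c (rep F)"
      using poly_eq_poly_eq_iff by blast
    then show "peval (coeff (rep F) i) ?c = peval (coeff (rep F) i) c"
      by (metis coeff_specialize)
  qed
  then show ?thesis by (auto simp: polys_in_def)
qed

lemma poly_in: "subring R \<Longrightarrow> P \<in> polys_over R \<Longrightarrow> x \<in> R \<Longrightarrow> poly P x \<in> R"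
  unfolding poly_altdef by (intro subring_sum) (auto intro!: subringD simp: polys_over_def)

section \<open>Unique factorisation\<close>

definition prime_product :: "'a::comm_semiring_1 \<Rightarrow> bool" where
  "prime_product a \<longleftrightarrow> (\<exists>u ps. u dvd 1 \<and> (\<forall>p\<in>set ps. prime_elem p) \<and> a = u * prod_list ps)"

lemma prime_product_mult:
  assumes "prime_product a" "prime_product b" shows "prime_product (a * b)"
proof -
  obtain u ps w qs where "u dvd 1" "\<forall>p\<in>set ps. prime_elem p" "a = u * prod_list ps"
    "w dvd 1" "\<forall>p\<in>set qs. prime_elem p" "b = w * prod_list qs"
    using assms unfolding prime_product_def by blast
  then show ?thesis unfolding prime_product_def
    by (intro exI[of _ "u * w"] exI[of _ "ps @ qs"]) (auto simp: mult_ac intro: mult_dvd_mono[of u 1 w 1, simplified])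
qed

lemma prime_product_unit: "a dvd 1 \<Longrightarrow> prime_product a"
  unfolding prime_product_def by (intro exI[of _ a] exI[of _ "[]"]) auto

lemma prime_product_prime: "prime_elem a \<Longrightarrow> prime_product a"
  unfolding prime_product_def by (intro exI[of _ 1] exI[of _ "[a]"]) auto

context direction
begin

text \<open>
  Gauss's lemma in the form needed below: a primitive polynomial that divides \<open>c * b\<close> with constant
  \<open>c\<close> divides \<open>b\<close>.  The primes of \<open>c\<close> are cancelled one at a time; none of them can divide \<open>p\<close>.
\<close>

lemma cancel_into_primitive:
  assumes c: "prime_product c" "c \<in> R" "c \<noteq> 0"
    and prim: "\<And>\<pi>. \<pi> \<in> R \<Longrightarrow> prime_elem \<pi> \<Longrightarrow> \<not> \<pi> dvd p"
    and dvd: "p dvd c * b"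
  shows "p dvd b"
proof -
  obtain u ps where u: "u dvd 1" and ps: "\<forall>q\<in>set ps. prime_elem q" and c': "c = u * prod_list ps"
    using c(1) unfolding prime_product_def by blast
  have "p dvd b" if "u * prod_list ps \<in> R" "p dvd u * prod_list ps * b"
    using ps that
  proof (induction ps)
    case Nil
    then have "p dvd u * b * w" for w by simp
    moreover obtain w where "1 = u * w" using u ..
    then have "b = u * b * w" by (metis mult.commute mult.left_commute mult_1)
    ultimately show ?case by metis
  next
    case (Cons q ps)
    have q: "prime_elem q" using Cons.prems by simp
    have nz: "u * prod_list (q # ps) \<noteq> 0"
      using u Cons.prems(1) by (auto simp: prod_list_zero_iff prime_elem_def)
    have eq: "u * prod_list (q # ps) = q * (u * prod_list ps)"
      "u * prod_list (q # ps) = u * prod_list ps * q" by (simp_all add: mult_ac)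
    have "q \<in> R" "u * prod_list ps \<in> R"
      using inv_factor_closed Cons.prems(2) nz eq by metis+
    obtain h where h: "q * (u * prod_list ps) * b = p * h"
      using Cons.prems(3) unfolding eq(1) by (elim dvdE)
    then have "q dvd p * h" by (metis dvd_triv_left mult.assoc)
    then have "q dvd h" using q prim[OF \<open>q \<in> R\<close> q] by (simp add: prime_elem_dvd_mult_iff)
    then obtain h' where "h = q * h'" ..
    then have "q * (u * prod_list ps * b) = q * (p * h')" using h by (simp add: mult_ac)
    then have "u * prod_list ps * b = p * h'" using q by (simp add: prime_elem_def)
    then show ?case using Cons.IH Cons.prems(1) \<open>u * prod_list ps \<in> R\<close> by auto
  qed
  then show ?thesis using c dvd c' by blast
qed

text \<open>
  The primes of the constant \<open>c\<close> are distributed over the two factors \<open>g\<close> and \<open>q\<close>, so that \<open>p\<close> itself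
  factors, with \<open>g\<close> changed by a constant only.
\<close>

lemma split_product:
  assumes c: "prime_product c" "c \<in> R" "c \<noteq> 0" and eq: "c * p = g * q"
  shows "\<exists>d g0 q0. d \<in> R \<and> p = g0 * q0 \<and> g = d * g0"
proof -
  obtain u ps where u: "u dvd 1" and ps: "\<forall>q\<in>set ps. prime_elem q" and c': "c = u * prod_list ps"
    using c(1) unfolding prime_product_def by blast
  have "\<exists>d g0 q0. d \<in> R \<and> p = g0 * q0 \<and> g = d * g0"
    if "u * prod_list ps \<in> R" "u * prod_list ps * p = g * q"
    using ps that
  proof (induction ps arbitrary: g q)
    case Nil
    obtain w where w: "1 = u * w" using u ..
    have "p = w * (u * p)" using w by (metis mult.commute mult.left_commute mult_1)
    also have "\<dots> = g * (w * q)" using Nil by (simp add: mult_ac)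
    finally show ?case using subringD(2)[OF subring_inv_along[of v]]
      by (intro exI[of _ 1] exI[of _ g] exI[of _ "w * q"]) simp
  next
    case (Cons \<pi> ps)
    have q: "prime_elem \<pi>" using Cons.prems by simp
    have nz: "u * prod_list (\<pi> # ps) \<noteq> 0"
      using u Cons.prems(1) by (auto simp: prod_list_zero_iff prime_elem_def)
    have eq: "u * prod_list (\<pi> # ps) = \<pi> * (u * prod_list ps)"
      "u * prod_list (\<pi> # ps) = u * prod_list ps * \<pi>" by (simp_all add: mult_ac)
    have R: "\<pi> \<in> R" "u * prod_list ps \<in> R"
      using inv_factor_closed Cons.prems(2) nz eq by metis+
    have prod: "\<pi> * (u * prod_list ps * p) = g * q" using Cons.prems(3) by (simp add: mult_ac)
    then have "\<pi> dvd g * q" by (metis dvd_triv_left)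
    then consider "\<pi> dvd g" | "\<pi> dvd q" using q by (auto simp: prime_elem_dvd_mult_iff)
    then show ?case
    proof cases
      case 1
      then obtain g' where g': "g = \<pi> * g'" ..
      then have "u * prod_list ps * p = g' * q" using prod q by (simp add: prime_elem_def mult.assoc)
      then obtain d g0 q0 where "d \<in> R" "p = g0 * q0" "g' = d * g0"
        using Cons.IH[of g' q] Cons.prems(1) R by auto
      then show ?thesis using g' R(1) subringD(4)[OF subring_inv_along[of v]]
        by (intro exI[of _ "\<pi> * d"] exI[of _ g0] exI[of _ q0]) (auto simp: mult_ac)
    next
      case 2
      then obtain q' where q': "q = \<pi> * q'" ..
      then have "u * prod_list ps * p = g * q'"
        using prod q by (simp add: prime_elem_def mult.left_commute[of g])
      then show ?thesis using Cons.IH[of g q'] Cons.prems(1) R by auto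
    qed
  qed
  then show ?thesis using c eq c' by blast
qed

end

lemma least_in_set:
  fixes m :: "'a \<Rightarrow> nat"
  assumes "a \<in> S"
  obtains g where "g \<in> S" "\<forall>h\<in>S. m g \<le> m h"
  using ex_has_least_nat[of "\<lambda>x. x \<in> S" a m] assms by blast

text \<open>
  Primality in the ring of polynomials in the variables \<open>V\<close>.  The divisibility relation of the whole ring
  serves for this, since a divisor of a nonzero polynomial involves no further variables.
\<close>

definition prime_in :: "'v set \<Rightarrow> 'v polyfun \<Rightarrow> bool" where
  "prime_in V p \<longleftrightarrow> (\<forall>a\<in>polys_in V. \<forall>b\<in>polys_in V. p dvd a * b \<longrightarrow> p dvd a \<or> p dvd b)"

text \<open>
  If a prime \<open>p\<close> of the coefficient ring divided neither factor, then the coefficient of the product at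
  the sum of the first positions where \<open>p\<close> fails to divide would not be divisible by \<open>p\<close>.
\<close>

lemma prime_in_insert:
  assumes p: "p \<in> polys_in V" "prime_in V p" and z: "z \<notin> V"
  shows "prime_in (insert z V) p"
proof -
  interpret direction "unit_vec z" z by (rule direction_unit_vec)
  have pR: "p \<in> R" using polys_in_inv_along[OF z p(1)] .
  have "False" if a: "a \<in> polys_in (insert z V)" "\<not> p dvd a" and b: "b \<in> polys_in (insert z V)" "\<not> p dvd b"
    and ab: "p dvd a * b" for a b
  proof -
    let ?A = "coeff (rep a)" and ?B = "coeff (rep b)"
    have "\<exists>i. \<not> p dvd ?A i" "\<exists>j. \<not> p dvd ?B j" using a b const_dvd_iff[OF pR] by blast+
    then obtain i j where i: "\<not> p dvd ?A i" "\<And>k. k < i \<Longrightarrow> p dvd ?A k"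
      and j: "\<not> p dvd ?B j" "\<And>k. k < j \<Longrightarrow> p dvd ?B k"
      using exists_least_iff[of "\<lambda>i. \<not> p dvd ?A i"] exists_least_iff[of "\<lambda>i. \<not> p dvd ?B i"] by auto
    have "p dvd coeff (rep (a * b)) (i + j)" using ab const_dvd_iff[OF pR] by blast
    then have "p dvd (\<Sum>k\<le>i + j. ?A k * ?B (i + j - k))" by (simp add: rep_mult coeff_mult)
    also have "(\<Sum>k\<le>i + j. ?A k * ?B (i + j - k)) = ?A i * ?B j + (\<Sum>k\<in>{..i + j} - {i}. ?A k * ?B (i + j - k))"
      by (subst sum.remove[of _ i]) auto
    finally have "p dvd ?A i * ?B j + (\<Sum>k\<in>{..i + j} - {i}. ?A k * ?B (i + j - k))" .
    moreover have "p dvd (\<Sum>k\<in>{..i + j} - {i}. ?A k * ?B (i + j - k))"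
    proof (rule dvd_sum)
      fix k assume "k \<in> {..i + j} - {i}"
      then have "k < i \<or> i + j - k < j" by auto
      then show "p dvd ?A k * ?B (i + j - k)" using i(2) j(2) by auto
    qed
    ultimately have "p dvd ?A i * ?B j" by (simp add: dvd_add_left_iff)
    then show False using p(2) i(1) j(1) coeff_rep_in[OF a(1)] coeff_rep_in[OF b(1)]
      unfolding prime_in_def by blast
  qed
  then show ?thesis unfolding prime_in_def by blast
qed

lemma prime_in_imp_prime:
  assumes p: "p \<in> polys_in V" "prime_in V p" and V: "finite V" and nz: "p \<noteq> 0" "\<not> p dvd 1"
  shows "prime_elem p"
proof -
  have *: "prime_in (V \<union> W) p" if "finite W" for W
    using that
  proof induction
    case empty then show ?case using p by simp
  next
    case (insert z W)
    show ?case
    proof (cases "z \<in> V")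
      case False
      have "p \<in> polys_in (V \<union> W)" using p(1) polys_in_mono[of V "V \<union> W"] by blast
      then show ?thesis using prime_in_insert[of p "V \<union> W" z] insert False by simp
    qed (use insert in \<open>simp add: insert_absorb\<close>)
  qed
  have "p dvd a \<or> p dvd b" if ab: "p dvd a * b" for a b
  proof -
    obtain A B where A: "finite A" "a \<in> polys_in A" and B: "finite B" "b \<in> polys_in B"
      using finite_variables by metis
    have "a \<in> polys_in (V \<union> (A \<union> B))" "b \<in> polys_in (V \<union> (A \<union> B))"
      using A(2) B(2) polys_in_mono[of A "V \<union> (A \<union> B)"] polys_in_mono[of B "V \<union> (A \<union> B)"] by blast+
    then show ?thesis using *[of "A \<union> B"] A B ab unfolding prime_in_def by blast
  qed
  then show ?thesis using nz by (auto simp: prime_elem_def)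
qed

text \<open>
  Let \<open>p\<close> divide \<open>a * b\<close> but not \<open>a\<close>.  An element \<open>g\<close> of least degree in the ideal generated by \<open>p\<close> and
  \<open>a\<close> divides both, up to constants.  If \<open>g\<close> has positive degree, irreducibility makes it associated to
  \<open>p\<close> up to a constant, so \<open>p\<close> divides \<open>a\<close> after cancelling constants; otherwise \<open>g\<close> is a constant with
  \<open>p\<close> dividing \<open>g * b\<close>, and cancelling it gives \<open>p\<close> dividing \<open>b\<close>.
\<close>

lemma irreducible_imp_prime_in:
  assumes V: "z \<notin> V" and IH: "\<And>c. c \<in> polys_in V \<Longrightarrow> c \<noteq> 0 \<Longrightarrow> prime_product c"
    and p: "p \<in> polys_in (insert z V)" "irreducible p" "p \<notin> inv_along (unit_vec z)"
  shows "prime_in (insert z V) p"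
proof -
  interpret direction "unit_vec z" z by (rule direction_unit_vec)
  let ?P = "polys_in (insert z V)"
  note S = subringD[OF subring_polys_in]
  have nz: "p \<noteq> 0" using p(2) by auto
  have unitR: "u \<in> R" if "u dvd 1" for u
  proof -
    from that obtain w where w: "1 = u * w" ..
    have "1 \<in> R" by (rule subringD(2)[OF subring_inv_along])
    then show ?thesis using w inv_factor_closed[of u w] by simp
  qed
  have prim: "\<not> \<pi> dvd p" if \<pi>: "\<pi> \<in> R" "prime_elem \<pi>" for \<pi>
  proof
    assume "\<pi> dvd p"
    then obtain s where s: "p = \<pi> * s" ..
    then have "s dvd 1" using p(2) \<pi> irreducibleD by (metis prime_elem_def)
    then have "s \<in> R" by (rule unitR)
    then show False using p(3) s \<pi>(1) subringD(4)[OF subring_inv_along] by blast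
  qed
  have VR: "c \<in> R" if "c \<in> polys_in V" for c using that polys_in_inv_along[OF V] by blast
  have "p dvd b" if a: "a \<in> ?P" "\<not> p dvd a" and b: "b \<in> ?P" and ab: "p dvd a * b" for a b
  proof -
    define J where "J = {p * s + a * r | s r. s \<in> ?P \<and> r \<in> ?P}"
    have J_iff: "x \<in> J \<longleftrightarrow> (\<exists>s\<in>?P. \<exists>r\<in>?P. x = p * s + a * r)" for x
      by (auto simp: J_def)
    have pJ: "p \<in> J" unfolding J_iff
      by (rule bexI[of _ 1], rule bexI[of _ 0]) (simp_all add: S(1,2))
    have aJ: "a \<in> J" unfolding J_iff
      by (rule bexI[of _ 0], rule bexI[of _ 1]) (simp_all add: S(1,2))
    have JP: "x \<in> ?P" if "x \<in> J" for x
      using that p(1) a(1) S(3,4)[of _ "insert z V"] by (auto simp: J_iff)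
    have Jmult: "x * y \<in> J" if xy: "x \<in> J" "y \<in> ?P" for x y
    proof -
      obtain s r where sr: "s \<in> ?P" "r \<in> ?P" "x = p * s + a * r" using xy(1) J_iff by blast
      then have "x * y = p * (s * y) + a * (r * y)" by (simp add: algebra_simps)
      then show ?thesis unfolding J_iff
        by (intro bexI[of _ "s * y"] bexI[of _ "r * y"]) (auto intro: S(4) sr xy)
    qed
    have Jdiff: "x - y \<in> J" if xy: "x \<in> J" "y \<in> J" for x y
    proof -
      obtain s r where sr: "s \<in> ?P" "r \<in> ?P" "x = p * s + a * r"
        using xy(1) J_iff by blast
      obtain s' r' where sr': "s' \<in> ?P" "r' \<in> ?P" "y = p * s' + a * r'"
        using xy(2) J_iff by blast
      have "x - y = p * (s - s') + a * (r - r')" using sr sr' by (simp add: algebra_simps)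
      then show ?thesis unfolding J_iff
        by (intro bexI[of _ "s - s'"] bexI[of _ "r - r'"]) (auto intro: S(6) sr sr')
    qed
    have "p \<in> J - {0}" using pJ nz by simp
    then obtain g where g0: "g \<in> J - {0}" and g1: "\<forall>h\<in>J - {0}. deg g \<le> deg h"
      by (rule least_in_set)
    have g: "g \<in> J" "g \<noteq> 0" using g0 by simp_all
    have gmin: "deg g \<le> deg h" if "h \<in> J" "h \<noteq> 0" for h using g1 that by simp
    have divide: "\<exists>c q. c \<in> polys_in V \<and> c \<noteq> 0 \<and> c * h = g * q" if h: "h \<in> J" for h
    proof -
      have reps: "rep h \<in> polys_over (polys_in V)" "rep g \<in> polys_over (polys_in V)" "rep g \<noteq> 0"
        using coeff_rep_in[OF JP[OF h]] coeff_rep_in[OF JP[OF g(1)]] g(2) by (auto simp: polys_over_def)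
      obtain c q r where *: "c \<in> polys_in V" "c \<noteq> 0" "q \<in> polys_over (polys_in V)"
        "r \<in> polys_over (polys_in V)" "smult c (rep h) = rep g * q + r" "r = 0 \<or> degree r < degree (rep g)"
        using pseudo_division[OF subring_polys_in reps(2,3,1)] by auto
      let ?q = "poly q (pvar z)" and ?r = "poly r (pvar z)"
      have "c * h = g * ?q + ?r"
        using arg_cong[OF *(5), of "\<lambda>P. poly P (pvar z)"] rep(2) by simp
      have "c \<in> ?P" "?q \<in> ?P"
        using *(1,3) polys_in_mono[of V "insert z V"] pvar_in[of z "insert z V"]
        by (blast, intro poly_in[OF subring_polys_in]) (auto simp: polys_over_def)
      then have "?r \<in> J" using Jdiff[OF Jmult[OF h, of c] Jmult[OF g(1), of ?q]] \<open>c * h = _\<close>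
        by (simp add: mult.commute)
      moreover have "r \<in> polys_over R" using *(4) VR by (auto simp: polys_over_def)
      then have "rep ?r = r" by (rule rep_unique) simp
      ultimately have "?r = 0" using gmin[of ?r] *(6)
        by (cases "?r = 0") (auto simp: deg_def)
      then show ?thesis using * \<open>c * h = _\<close> by auto
    qed
    show ?thesis
    proof (cases "deg g = 0")
      case True
      then have gR: "g \<in> R" by (simp add: deg_eq_0_iff)
      have "g \<in> polys_in V"
        using coeff_rep_in[OF JP[OF g(1)], of 0] rep_const[OF gR] by simp
      then have "prime_product g" using IH g by blast
      moreover have "p dvd g * b"
      proof -
        obtain s r where "g = p * s + a * r" using g(1) J_iff by blast
        then have "g * b = p * (s * b) + a * b * r" by (simp add: algebra_simps)
        then show ?thesis using ab by simp
      qed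
      ultimately show ?thesis using cancel_into_primitive[OF _ gR g(2) prim] by blast
    next
      case False
      obtain c q where c: "c \<in> polys_in V" "c \<noteq> 0" "c * p = g * q" using divide[OF pJ] by blast
      obtain c' q' where c': "c' \<in> polys_in V" "c' \<noteq> 0" "c' * a = g * q'" using divide[OF aJ] by blast
      obtain d g0 q0 where d: "d \<in> R" "p = g0 * q0" "g = d * g0"
        using split_product[OF IH[OF c(1,2)] VR[OF c(1)] c(2,3)] by blast
      have "g0 \<notin> R" using d False subringD(4)[OF subring_inv_along] by (auto simp: deg_eq_0_iff)
      then have "\<not> g0 dvd 1" using unitR by blast
      then have "q0 dvd 1" using p(2) d(2) irreducibleD by blast
      then have "p dvd g0" using d(2) by (simp add: mult_unit_dvd_iff)
      then have "p dvd c' * a" using c'(3) d(3) by (simp add: mult.assoc)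
      then show ?thesis
        using cancel_into_primitive[OF IH[OF c'(1,2)] VR[OF c'(1)] c'(2) prim] a(2) by blast
    qed
  qed
  then show ?thesis unfolding prime_in_def by blast
qed

lemma polys_in_empty_unit: 
  assumes "F \<in> polys_in {}" "F \<noteq> 0" shows "F dvd 1"
proof -
  obtain k where F: "F = pconst k"
    using polys_in_eqD[OF assms(1)] by (metis empty_iff peval_simps(6) polyfun_eqI)
  have "k \<noteq> 0" using assms(2) F by (metis peval_simps(1,6) polyfun_eqI)
  then have "F * pconst (inverse k) = 1" unfolding F by (intro polyfun_eqI) simp
  then show ?thesis by (metis dvd_triv_left)
qed

text \<open>
  A substitute for the total degree: any measure that is additive on products and detects units
  bounds the number of non-units in a factorisation.
\<close>

definition additive_size :: "'v set \<Rightarrow> ('v polyfun \<Rightarrow> nat) \<Rightarrow> bool" where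
  "additive_size V \<mu> \<longleftrightarrow>
    (\<forall>a\<in>polys_in V - {0}. \<forall>b\<in>polys_in V - {0}. \<mu> (a * b) = \<mu> a + \<mu> b) \<and>
    (\<forall>a\<in>polys_in V - {0}. \<mu> a = 0 \<longrightarrow> a dvd 1)"

lemma additive_sizeD:
  assumes "additive_size V \<mu>" "a \<in> polys_in V - {0}"
  shows "b \<in> polys_in V - {0} \<Longrightarrow> \<mu> (a * b) = \<mu> a + \<mu> b" "\<mu> a = 0 \<Longrightarrow> a dvd 1"
  using assms by (simp_all add: additive_size_def)

text \<open>
  The degree in the new variable plus the size of the leading coefficient is additive, since leading
  coefficients multiply.
\<close>

lemma additive_size_exists:
  fixes V :: "'v set"
  assumes "finite V"
  shows "\<exists>\<mu>. additive_size V \<mu>"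
  using assms
proof induction
  case empty
  have "additive_size ({} :: 'v set) (\<lambda>_. 0)" using polys_in_empty_unit unfolding additive_size_def by auto
  then show ?case by blast
next
  case (insert z V)
  interpret direction "unit_vec z" z by (rule direction_unit_vec)
  obtain \<mu> where \<mu>: "additive_size V \<mu>" using insert.IH ..
  have lc: "lc a \<in> polys_in V - {0}" if "a \<in> polys_in (insert z V) - {0}" for a
    using that coeff_rep_in[of a z V "degree (rep a)"] lc_eq_0_iff[of a] unfolding lc_def by blast
  define \<nu> where "\<nu> a = deg a + \<mu> (lc a)" for a
  have "\<nu> (a * b) = \<nu> a + \<nu> b"
    if "a \<in> polys_in (insert z V) - {0}" "b \<in> polys_in (insert z V) - {0}" for a b
    using additive_sizeD(1)[OF \<mu> lc[OF that(1)] lc[OF that(2)]] that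
    by (simp add: \<nu>_def deg_mult lc_mult)
  moreover have "a dvd 1" if a: "a \<in> polys_in (insert z V) - {0}" "\<nu> a = 0" for a
  proof -
    have "lc a = a" using a(2) by (simp add: \<nu>_def lc_of_const deg_eq_0_iff)
    then show ?thesis using additive_sizeD(2)[OF \<mu> lc[OF a(1)]] a(2) by (simp add: \<nu>_def)
  qed
  ultimately have "additive_size (insert z V) \<nu>" by (simp add: additive_size_def)
  then show ?case by blast
qed

text \<open>
  Unique factorisation, stated as: every nonzero polynomial is a unit times a product of primes.  By
  induction on the set of variables irreducible elements are prime, and a factorisation into
  irreducibles exists because sizes drop.
\<close>

theorem polys_in_prime_product:
  assumes "finite V" "F \<in> polys_in V" "F \<noteq> 0"
  shows "prime_product F"
  using assms
proof (induction V arbitrary: F)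
  case empty
  then show ?case using polys_in_empty_unit prime_product_unit by blast
next
  case (insert z V)
  obtain \<mu> where \<mu>: "additive_size (insert z V) \<mu>"
    using additive_size_exists[of "insert z V"] insert.hyps by blast
  interpret direction "unit_vec z" z by (rule direction_unit_vec)
  from insert.prems show ?case
  proof (induction "\<mu> F" arbitrary: F rule: less_induct)
    case less
    show ?case
    proof (cases "F dvd 1 \<or> irreducible F")
      case True
      then consider "F dvd 1" | "irreducible F" "F \<in> R" | "irreducible F" "F \<notin> R" by blast
      then show ?thesis
      proof cases
        case 2
        then have "F \<in> polys_in V"
          using coeff_rep_in[OF less.prems(1), of 0] rep_const[of F] by simp
        then show ?thesis using insert.IH less.prems by blast
      next
        case 3
        then have "prime_in (insert z V) F"
          using irreducible_imp_prime_in[of z V F] insert less.prems by blast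
        then have "prime_elem F"
          using prime_in_imp_prime[of F "insert z V"] less.prems insert.hyps 3(1)
          by (auto simp: irreducible_def)
        then show ?thesis by (rule prime_product_prime)
      qed (simp add: prime_product_unit)
    next
      case False
      then obtain a b where ab: "F = a * b" "\<not> a dvd 1" "\<not> b dvd 1"
        using less.prems by (auto simp: irreducible_def)
      have "a \<in> polys_in (insert z V) - {0}" "b \<in> polys_in (insert z V) - {0}"
        using ab less.prems polys_in_factor_closed[of a b] polys_in_factor_closed[of b a]
        by (auto simp: mult.commute)
      moreover from this have "\<mu> a \<noteq> 0" "\<mu> b \<noteq> 0" "\<mu> F = \<mu> a + \<mu> b"
        using additive_sizeD[OF \<mu>] ab by blast+
      ultimately have "\<mu> a < \<mu> F" "\<mu> b < \<mu> F" "a \<in> polys_in (insert z V)" "a \<noteq> 0"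
        "b \<in> polys_in (insert z V)" "b \<noteq> 0" by simp_all
      then show ?thesis using less.hyps[of a] less.hyps[of b] ab(1) prime_product_mult by blast
    qed
  qed
qed

corollary polyfun_prime_product: "F \<noteq> 0 \<Longrightarrow> prime_product (F :: 'v polyfun)"
  using finite_variables[of F] polys_in_prime_product by blast

section \<open>Prime ideals that avoid the invariants of a direction\<close>

text \<open>
  Height-one primes are principal.  Take \<open>p\<close> of least degree along the direction and, among those, of
  least size.  It is primitive: a constant prime factor cannot lie in the ideal, so its cofactor
  would be a smaller choice.  Pseudo-division of any \<open>q\<close> in the ideal by \<open>p\<close> leaves no remainder,
  and \<open>p\<close> divides \<open>c * q\<close> with constant \<open>c\<close>, hence \<open>q\<close>.
\<close>

theorem (in direction) prime_ideal_generator: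
  fixes I :: "'v polyfun set"
  assumes mult: "\<And>F G. F \<in> I \<Longrightarrow> F * G \<in> I"
    and diff: "\<And>F G. F \<in> I \<Longrightarrow> G \<in> I \<Longrightarrow> F - G \<in> I"
    and prime: "\<And>F G. F * G \<in> I \<Longrightarrow> F \<in> I \<or> G \<in> I"
    and nontriv: "\<exists>F\<in>I. F \<noteq> 0"
    and proj: "\<And>F. F \<in> I \<Longrightarrow> F \<in> R \<Longrightarrow> F = 0"
  shows "\<exists>p\<in>I. p \<noteq> 0 \<and> (\<forall>q\<in>I. p dvd q)"
proof -
  obtain F0 where F0: "F0 \<in> I" "F0 \<noteq> 0" using nontriv by blast
  have "F0 \<in> I - {0}" using F0 by simp
  then obtain p1 where p10: "p1 \<in> I - {0}" and p11: "\<forall>h\<in>I - {0}. deg p1 \<le> deg h"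
    by (rule least_in_set)
  have p1: "p1 \<in> I" "p1 \<noteq> 0" using p10 by simp_all
  have min1: "deg p1 \<le> deg h" if "h \<in> I" "h \<noteq> 0" for h using p11 that by simp
  obtain V where V: "finite V" "p1 \<in> polys_in V" using finite_variables by blast
  obtain \<mu> where \<mu>: "additive_size V \<mu>"
    using additive_size_exists[OF V(1)] by blast
  define L where "L = {h \<in> I \<inter> polys_in V. h \<noteq> 0 \<and> deg h = deg p1}"
  have "p1 \<in> L" using p1 V by (simp add: L_def)
  then obtain p where "p \<in> L" and min0: "\<forall>h\<in>L. \<mu> p \<le> \<mu> h" by (rule least_in_set)
  then have p: "p \<in> I" "p \<noteq> 0" "deg p = deg p1" "p \<in> polys_in V" by (simp_all add: L_def)
  have min: "\<mu> p \<le> \<mu> h" if "h \<in> I" "h \<noteq> 0" "deg h = deg p1" "h \<in> polys_in V" for h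
    using min0 that by (simp add: L_def)
  have prim: "\<not> \<pi> dvd p" if \<pi>: "\<pi> \<in> R" "prime_elem \<pi>" for \<pi>
  proof
    assume "\<pi> dvd p"
    then obtain s where s: "p = \<pi> * s" ..
    have nz: "\<pi> \<noteq> 0" "s \<noteq> 0" using p(2) s by auto
    have "\<pi> \<notin> I" using proj \<pi> nz by blast
    then have sI: "s \<in> I" using prime p(1) s by blast
    have "deg s = deg p1" using s p(3) nz \<pi>(1) by (simp add: deg_mult deg_eq_0_iff[THEN iffD2])
    moreover have in_V: "\<pi> \<in> polys_in V" "s \<in> polys_in V"
      using p(2,4) s polys_in_factor_closed[of \<pi> s] polys_in_factor_closed[of s \<pi>] by (auto simp: mult.commute)
    ultimately have "\<mu> p \<le> \<mu> s" using min[of s] sI nz by blast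
    moreover have "\<mu> p = \<mu> \<pi> + \<mu> s" using s additive_sizeD(1)[OF \<mu>] in_V nz by blast
    ultimately have "\<pi> dvd 1" using additive_sizeD(2)[OF \<mu>, of \<pi>] in_V nz by simp
    then show False using \<pi>(2) by (auto simp: prime_elem_def)
  qed
  have "p dvd q" if q: "q \<in> I" for q
  proof -
    have rp: "rep p \<noteq> 0" using p(2) by simp
    obtain c s r where *: "c \<in> R" "c \<noteq> 0" "s \<in> polys_over R"
        "r \<in> polys_over R" "smult c (rep q) = rep p * s + r" "r = 0 \<or> degree r < degree (rep p)"
      using pseudo_division[OF subring_inv_along rep(1) rp rep(1), of q] by auto
    let ?s = "poly s (pvar z)" and ?r = "poly r (pvar z)"
    have eq: "q * c = p * ?s + ?r"
      using arg_cong[OF *(5), of "\<lambda>P. poly P (pvar z)"] rep(2) by (simp add: mult.commute)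
    then have "?r \<in> I" using diff[OF mult[OF q, of c] mult[OF p(1), of ?s]] by simp
    moreover have "rep ?r = r" using *(4) by (rule rep_unique) simp
    ultimately have "?r = 0" using min1[of ?r] *(6) p(3)
      by (cases "?r = 0") (auto simp: deg_def)
    then have "p dvd c * q" using eq by (metis add.right_neutral dvd_triv_left mult.commute)
    then show ?thesis
      using cancel_into_primitive[OF polyfun_prime_product[OF *(2)] *(1,2) prim] by blast
  qed
  then show ?thesis using p by blast
qed

section \<open>Multivariate polynomials and the functions that they define\<close>

abbreviation "lookup \<equiv> Poly_Mapping.lookup"
abbreviation "keys \<equiv> Poly_Mapping.keys"

definition monom_eval :: "('v \<Rightarrow>\<^sub>0 nat) \<Rightarrow> ('v \<Rightarrow> 'r::comm_semiring_1) \<Rightarrow> 'r" where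
  "monom_eval m x = (\<Prod>v\<in>keys m. x v ^ lookup m v)"

lemma monom_eval_superset:
  "finite S \<Longrightarrow> keys m \<subseteq> S \<Longrightarrow> monom_eval m x = (\<Prod>v\<in>S. x v ^ lookup m v)"
  unfolding monom_eval_def by (rule prod.mono_neutral_left) (auto simp: in_keys_iff)

lemma monom_eval_0 [simp]: "monom_eval 0 x = 1"
  by (simp add: monom_eval_def)

lemma monom_eval_add: "monom_eval (m + m') x = monom_eval m x * monom_eval m' x"
proof -
  let ?S = "keys m \<union> keys m'"
  have "keys (m + m') \<subseteq> ?S" by (rule Poly_Mapping.keys_add)
  then show ?thesis
    by (simp add: monom_eval_superset[of ?S] lookup_add power_add prod.distrib)
qed

lemma mpoly_eval_superset:
  "finite S \<Longrightarrow> keys p \<subseteq> S \<Longrightarrow> mpoly_eval p x = (\<Sum>m\<in>S. lookup p m * monom_eval m x)"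
  unfolding mpoly_eval_def monom_eval_def by (rule sum.mono_neutral_left) (auto simp: in_keys_iff)

lemma mpoly_eval_single [simp]: "mpoly_eval (Poly_Mapping.single m k) x = k * monom_eval m x"
  using mpoly_eval_superset[of "{m}" "Poly_Mapping.single m k" x] by (cases "k = 0") auto

lemma mpoly_eval_0 [simp]: "mpoly_eval 0 x = 0"
  by (simp add: mpoly_eval_def)

lemma mpoly_eval_add: "mpoly_eval (p + q) x = mpoly_eval p x + mpoly_eval q x"
  using Poly_Mapping.keys_add[of p q]
  by (simp add: mpoly_eval_superset[of "keys p \<union> keys q"] lookup_add distrib_right sum.distrib)

lemma mpoly_eval_sum: "mpoly_eval (\<Sum>i\<in>S. p i) x = (\<Sum>i\<in>S. mpoly_eval (p i) x)"
  by (induction S rule: infinite_finite_induct) (auto simp: mpoly_eval_add)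

lemma sum_single: "p = (\<Sum>m\<in>keys p. Poly_Mapping.single m (lookup p m))"
proof (rule poly_mapping_eqI)
  fix k
  have "lookup (\<Sum>m\<in>keys p. Poly_Mapping.single m (lookup p m)) k = (\<Sum>m\<in>keys p. if m = k then lookup p m else 0)"
    unfolding lookup_sum by (intro sum.cong) (simp_all add: lookup_single when_def)
  also have "\<dots> = lookup p k" by (simp add: in_keys_iff)
  finally show "lookup p k = lookup (\<Sum>m\<in>keys p. Poly_Mapping.single m (lookup p m)) k" ..
qed

lemma lookup_sum_single:
  assumes "finite B"
  shows "lookup (\<Sum>b\<in>B. Poly_Mapping.single b (m b)) a = (if a \<in> B then m a else 0)"
proof -
  have "lookup (\<Sum>b\<in>B. Poly_Mapping.single b (m b)) a = (\<Sum>b\<in>B. if b = a then m b else 0)"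
    unfolding lookup_sum by (intro sum.cong) (simp_all add: lookup_single when_def)
  then show ?thesis using assms by simp
qed

lemma mpoly_eval_mult: "mpoly_eval (p * q) x = mpoly_eval p x * mpoly_eval q x"
proof -
  have "p * q = (\<Sum>m\<in>keys p. Poly_Mapping.single m (lookup p m)) * (\<Sum>m\<in>keys q. Poly_Mapping.single m (lookup q m))"
    using sum_single[of p] sum_single[of q] by simp
  also have "\<dots> = (\<Sum>m\<in>keys p. \<Sum>m'\<in>keys q. Poly_Mapping.single (m + m') (lookup p m * lookup q m'))"
    unfolding sum_product mult_single ..
  finally have "p * q = (\<Sum>m\<in>keys p. \<Sum>m'\<in>keys q. Poly_Mapping.single (m + m') (lookup p m * lookup q m'))" .
  then show ?thesis
    by (simp add: mpoly_eval_sum monom_eval_add mpoly_eval_superset[of "keys p" p]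
      mpoly_eval_superset[of "keys q" q] sum_product mult_ac)
qed

lemma mpoly_eval_1 [simp]: "mpoly_eval 1 x = 1"
  using mpoly_eval_single[of 0 1 x] by simp

lemma mpoly_eval_prod: "mpoly_eval (\<Prod>i\<in>S. p i) x = (\<Prod>i\<in>S. mpoly_eval (p i) x)"
  by (induction S rule: infinite_finite_induct) (auto simp: mpoly_eval_mult)

lemma monom_eval_mult: "monom_eval m (\<lambda>v. x v * y v) = monom_eval m x * monom_eval m y"
  by (simp add: monom_eval_def power_mult_distrib prod.distrib)

text \<open>
  Monomials are distinct characters of the multiplicative monoid of points, and distinct characters
  are linearly independent (Artin): two copies of a relation, one evaluated at \<open>x * y\<close> and one
  multiplied by the value of the monomial \<open>a\<close> at \<open>y\<close>, differ by a shorter relation.  Only real points are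
  used, so a nonzero complex polynomial is nonzero at some real point.
\<close>

lemma monomials_independent:
  fixes k :: "('v \<Rightarrow>\<^sub>0 nat) \<Rightarrow> complex"
  assumes "finite M" "\<And>x :: 'v \<Rightarrow> real. (\<Sum>m\<in>M. k m * monom_eval m (\<lambda>v. of_real (x v))) = 0"
  shows "\<forall>m\<in>M. k m = 0"
  using assms
proof (induction M arbitrary: k)
  case (insert a M)
  have "k m = 0" if m: "m \<in> M" for m
  proof -
    have "m \<noteq> a" using insert.hyps m by blast
    then obtain v where v: "lookup m v \<noteq> lookup a v" by (metis poly_mapping_eqI)
    \<comment> \<open>At this point the monomials with different exponents of \<open>v\<close> take different powers of \<open>2\<close>.\<close>
    define y :: "'v \<Rightarrow> real" where "y = (\<lambda>w. if w = v then 2 else 1)"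
    let ?\<chi> = "\<lambda>m (x :: 'v \<Rightarrow> real). monom_eval m (\<lambda>v. complex_of_real (x v))"
    have \<chi>y: "?\<chi> m' y = 2 ^ lookup m' v" for m'
    proof -
      have "?\<chi> m' y = (\<Prod>w\<in>insert v (keys m'). of_real (y w) ^ lookup m' w)"
        by (rule monom_eval_superset) auto
      also have "\<dots> = (\<Prod>w\<in>insert v (keys m'). if w = v then 2 ^ lookup m' v else 1)"
        by (intro prod.cong) (auto simp: y_def)
      finally show ?thesis by simp
    qed
    have "(\<Sum>m\<in>M. k m * (?\<chi> m y - ?\<chi> a y) * ?\<chi> m x) = 0" for x
    proof -
      have 1: "k a * ?\<chi> a x * ?\<chi> a y + (\<Sum>m\<in>M. k m * ?\<chi> m x * ?\<chi> m y) = 0"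
        using insert.prems[of "\<lambda>v. x v * y v"] insert.hyps
        by (simp add: monom_eval_mult mult.assoc)
      have 2: "(k a * ?\<chi> a x + (\<Sum>m\<in>M. k m * ?\<chi> m x)) * ?\<chi> a y = 0"
        using insert.prems[of x] insert.hyps by simp
      have "(\<Sum>m\<in>M. k m * (?\<chi> m y - ?\<chi> a y) * ?\<chi> m x) =
        (k a * ?\<chi> a x * ?\<chi> a y + (\<Sum>m\<in>M. k m * ?\<chi> m x * ?\<chi> m y))
        - (k a * ?\<chi> a x + (\<Sum>m\<in>M. k m * ?\<chi> m x)) * ?\<chi> a y"
        by (simp add: algebra_simps sum_subtractf sum_distrib_left)
      then show ?thesis unfolding 1 2 by simp
    qed
    then have "k m * (?\<chi> m y - ?\<chi> a y) = 0" using insert.IH[of "\<lambda>m. k m * (?\<chi> m y - ?\<chi> a y)"] m by blast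
    moreover have "(2 :: complex) ^ lookup m v \<noteq> 2 ^ lookup a v"
    proof
      assume "(2 :: complex) ^ lookup m v = 2 ^ lookup a v"
      then have "(of_nat (2 ^ lookup m v) :: complex) = of_nat (2 ^ lookup a v)" by simp
      then have "(2::nat) ^ lookup m v = 2 ^ lookup a v" using of_nat_eq_iff by blast
      then show False using v by simp
    qed
    ultimately show ?thesis by (simp add: \<chi>y)
  qed
  moreover from this have "k a = 0"
    using insert.prems[of "\<lambda>_. 1"] insert.hyps by (simp add: monom_eval_def)
  ultimately show ?case by simp
qed simp

definition polyfun_of :: "('v, complex) mpoly \<Rightarrow> 'v polyfun" where
  "polyfun_of p = (\<Sum>m\<in>keys p. pconst (lookup p m) * (\<Prod>v\<in>keys m. pvar v ^ lookup m v))"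

lemma peval_polyfun_of [simp]: "peval (polyfun_of p) = mpoly_eval p"
  by (simp add: polyfun_of_def mpoly_eval_def fun_eq_iff)

lemma polyfun_of_hom:
  "polyfun_of (p + q) = polyfun_of p + polyfun_of q"
  "polyfun_of (p * q) = polyfun_of p * polyfun_of q"
  "polyfun_of 1 = 1"  "polyfun_of 0 = 0"
  by (intro polyfun_eqI; simp add: mpoly_eval_add mpoly_eval_mult)+

lemma mpoly_eval_real_inject:
  fixes p q :: "('v, complex) mpoly"
  assumes "\<And>x :: 'v \<Rightarrow> real. mpoly_eval p (\<lambda>v. of_real (x v)) = mpoly_eval q (\<lambda>v. of_real (x v))"
  shows "p = q"
proof (rule poly_mapping_eqI)
  fix m
  let ?S = "keys p \<union> keys q"
  have "\<forall>m\<in>?S. lookup p m - lookup q m = 0"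
  proof (rule monomials_independent)
    fix x :: "'v \<Rightarrow> real"
    show "(\<Sum>m\<in>?S. (lookup p m - lookup q m) * monom_eval m (\<lambda>v. complex_of_real (x v))) = 0"
      using assms[of x] by (simp add: mpoly_eval_superset[of ?S] left_diff_distrib sum_subtractf)
  qed simp
  then have "lookup p m = lookup q m" if "m \<in> ?S" using that by auto
  moreover have "lookup p m = 0" "lookup q m = 0" if "m \<notin> ?S" using that by (simp_all add: in_keys_iff)
  ultimately show "lookup p m = lookup q m" by metis
qed

lemma polyfun_of_inject: "polyfun_of p = polyfun_of q \<longleftrightarrow> p = q"
proof
  assume eq: "polyfun_of p = polyfun_of q"
  have "mpoly_eval p = mpoly_eval q" using arg_cong[OF eq, of peval] by simp
  then show "p = q" by (intro mpoly_eval_real_inject) simp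
qed simp

lemma polyfun_of_surj: "\<exists>p. polyfun_of p = F"
proof (induction F rule: polyfun_induct)
  case (const k)
  show ?case
    by (intro exI[of _ "Poly_Mapping.single 0 k"] polyfun_eqI) simp
next
  case (var v)
  show ?case
    by (intro exI[of _ "Poly_Mapping.single (Poly_Mapping.single v 1) 1"] polyfun_eqI)
       (simp add: monom_eval_def)
next
  case (add F G) then show ?case by (metis polyfun_of_hom(1))
next
  case (mult F G) then show ?case by (metis polyfun_of_hom(2))
qed

lemma polyfun_of_dvd_iff: "polyfun_of p dvd polyfun_of q \<longleftrightarrow> p dvd q"
proof
  assume "polyfun_of p dvd polyfun_of q"
  then obtain F where F: "polyfun_of q = polyfun_of p * F" ..
  obtain r where "polyfun_of r = F" using polyfun_of_surj by blast
  then have "polyfun_of q = polyfun_of (p * r)" using F by (simp add: polyfun_of_hom)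
  then show "p dvd q" by (simp add: polyfun_of_inject)
qed (auto simp: dvd_def polyfun_of_hom)

lemma nonzero_at_real_point:
  assumes "F \<noteq> 0" shows "\<exists>x :: 'v \<Rightarrow> real. peval F (\<lambda>v. of_real (x v)) \<noteq> 0"
proof -
  obtain p where p: "polyfun_of p = F" using polyfun_of_surj by blast
  then have "p \<noteq> 0" using assms by (metis polyfun_of_hom(4))
  then have "\<exists>x :: 'v \<Rightarrow> real. mpoly_eval p (\<lambda>v. of_real (x v)) \<noteq> mpoly_eval 0 (\<lambda>v. of_real (x v))"
    using mpoly_eval_real_inject by blast
  then show ?thesis using p by auto
qed

lemma monom_eval_upd_0:
  "monom_eval m (x(v := 0)) = (if v \<in> keys m then 0 else monom_eval m (x :: _ \<Rightarrow> 'r::{comm_semiring_1,semiring_no_zero_divisors}))"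
proof (cases "v \<in> keys m")
  case True
  then have "monom_eval m (x(v := 0)) = 0"
    unfolding monom_eval_def by (intro prod_zero bexI[of _ v]) (simp_all add: in_keys_iff zero_power)
  then show ?thesis using True by simp
next
  case False
  then have "monom_eval m (x(v := 0)) = monom_eval m x"
    unfolding monom_eval_def by (intro prod.cong refl) auto
  then show ?thesis using False by simp
qed

text \<open>
  If the function does not depend on \<open>v\<close>, then setting \<open>v\<close> to \<open>0\<close> removes the monomials containing \<open>v\<close>
  without changing any value, so their coefficients vanish by independence.
\<close>

lemma coeff_polys_iff:
  fixes B :: "'n expo set"
  shows "p \<in> coeff_polys B \<longleftrightarrow> polyfun_of p \<in> polys_in B"
proof
  assume p: "p \<in> coeff_polys B"
  show "polyfun_of p \<in> polys_in B"
  proof (rule polys_inI)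
    fix c c' :: "'n expo \<Rightarrow> complex" assume eq: "\<And>b. b \<in> B \<Longrightarrow> c b = c' b"
    show "peval (polyfun_of p) c = peval (polyfun_of p) c'"
      unfolding peval_polyfun_of mpoly_eval_def
    proof (intro sum.cong refl arg_cong2[of _ _ _ _ "(*)"] prod.cong)
      fix m v assume "m \<in> keys p" "v \<in> keys m"
      then have "v \<in> B" using p by (auto simp: coeff_polys_def)
      then show "c v ^ lookup m v = c' v ^ lookup m v" by (simp add: eq)
    qed
  qed
next
  assume p: "polyfun_of p \<in> polys_in B"
  show "p \<in> coeff_polys B" unfolding coeff_polys_def
  proof (safe, rule ccontr)
    fix m v assume m: "m \<in> keys p" "v \<in> keys m" "v \<notin> B"
    let ?M = "{m \<in> keys p. v \<in> keys m}"
    have "\<forall>m\<in>?M. lookup p m = 0"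
    proof (rule monomials_independent)
      fix x :: "'n expo \<Rightarrow> real"
      let ?x = "\<lambda>v. complex_of_real (x v)"
      have "mpoly_eval p ?x = mpoly_eval p (?x(v := 0))"
        unfolding peval_polyfun_of[symmetric] by (rule polys_in_eqD[OF p]) (use m(3) in auto)
      also have "\<dots> = (\<Sum>m\<in>keys p. if v \<in> keys m then 0 else lookup p m * monom_eval m ?x)"
        unfolding mpoly_eval_superset[OF finite_keys order_refl] monom_eval_upd_0
        by (intro sum.cong) auto
      also have "mpoly_eval p ?x = (\<Sum>m\<in>keys p. if v \<in> keys m then 0 else lookup p m * monom_eval m ?x)
          + (\<Sum>m\<in>keys p. if v \<in> keys m then lookup p m * monom_eval m ?x else 0)"
        unfolding mpoly_eval_superset[OF finite_keys order_refl] sum.distrib[symmetric]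
        by (intro sum.cong) auto
      finally show "(\<Sum>m\<in>?M. lookup p m * monom_eval m ?x) = 0"
        by (simp add: sum.inter_filter)
    qed simp
    then show False using m by (auto simp: in_keys_iff)
  qed
qed

section \<open>Singular polynomials satisfy an algebraic relation\<close>

text \<open>
  A homogeneous linear system with more unknowns than equations has a nontrivial solution, by
  Gaussian elimination of one equation and one unknown at a time.
\<close>

lemma homogeneous_system:
  fixes M :: "'x \<Rightarrow> 'y \<Rightarrow> 'a::field"
  assumes "finite Y" "finite X" "card Y < card X"
  shows "\<exists>k. (\<exists>x\<in>X. k x \<noteq> 0) \<and> (\<forall>y\<in>Y. (\<Sum>x\<in>X. k x * M x y) = 0)"
  using assms
proof (induction Y arbitrary: X M)
  case empty
  then have "X \<noteq> {}" by auto
  then show ?case by (intro exI[of _ "\<lambda>_. 1"]) auto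
next
  case (insert y0 Y)
  show ?case
  proof (cases "\<forall>x\<in>X. M x y0 = 0")
    case True
    have "card Y < card X" using insert.prems insert.hyps by simp
    then obtain k where "\<exists>x\<in>X. k x \<noteq> 0" "\<forall>y\<in>Y. (\<Sum>x\<in>X. k x * M x y) = 0"
      using insert.IH[OF insert.prems(1)] by blast
    then show ?thesis using True by (intro exI[of _ k]) auto
  next
    case False
    then obtain x0 where x0: "x0 \<in> X" "M x0 y0 \<noteq> 0" by blast
    define r where "r x = M x y0 / M x0 y0" for x
    have "card Y < card (X - {x0})" using insert.prems insert.hyps x0 by simp
    then obtain k where k: "\<exists>x\<in>X - {x0}. k x \<noteq> 0"
      "\<forall>y\<in>Y. (\<Sum>x\<in>X - {x0}. k x * (M x y - r x * M x0 y)) = 0"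
      using insert.IH[of "X - {x0}" "\<lambda>x y. M x y - r x * M x0 y"] insert.prems by auto
    define k' where "k' x = (if x = x0 then - (\<Sum>x\<in>X - {x0}. k x * r x) else k x)" for x
    have split: "(\<Sum>x\<in>X. k' x * M x y) = (\<Sum>x\<in>X - {x0}. k x * (M x y - r x * M x0 y))" for y
    proof -
      have "(\<Sum>x\<in>X. k' x * M x y) = k' x0 * M x0 y + (\<Sum>x\<in>X - {x0}. k' x * M x y)"
        using insert.prems x0 by (simp add: sum.remove)
      also have "(\<Sum>x\<in>X - {x0}. k' x * M x y) = (\<Sum>x\<in>X - {x0}. k x * M x y)"
        by (intro sum.cong) (auto simp: k'_def)
      finally show ?thesis
        by (simp add: k'_def sum_distrib_right right_diff_distrib sum_subtractf mult.assoc)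
    qed
    have "(\<Sum>x\<in>X. k' x * M x y) = 0" if "y \<in> insert y0 Y" for y
      using that k(2) x0(2) unfolding split by (auto simp: r_def)
    moreover have "\<exists>x\<in>X. k' x \<noteq> 0" using k(1) by (auto simp: k'_def)
    ultimately show ?thesis by blast
  qed
qed

definition lin_span :: "('p \<Rightarrow> 'a::field) set \<Rightarrow> ('p \<Rightarrow> 'a) set" where
  "lin_span G = {F. \<exists>k. \<forall>p. F p = (\<Sum>g\<in>G. k g * g p)}"

lemma lin_span_base: "finite G \<Longrightarrow> g \<in> G \<Longrightarrow> g \<in> lin_span G"
proof -
  assume g: "finite G" "g \<in> G"
  have "g p = (\<Sum>h\<in>G. (if h = g then 1 else 0) * h p)" for p
  proof -
    have "(\<Sum>h\<in>G. (if h = g then 1 else 0) * h p) = (\<Sum>h\<in>G. if h = g then h p else 0)"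
      by (intro sum.cong) auto
    then show ?thesis using g by simp
  qed
  then show ?thesis unfolding lin_span_def mem_Collect_eq by (intro exI allI)
qed

lemma lin_span_scale: "F \<in> lin_span G \<Longrightarrow> (\<lambda>p. a * F p) \<in> lin_span G"
proof -
  assume "F \<in> lin_span G"
  then obtain k where "\<forall>p. F p = (\<Sum>g\<in>G. k g * g p)" unfolding lin_span_def by blast
  then show ?thesis unfolding lin_span_def
    by (intro CollectI exI[of _ "\<lambda>g. a * k g"]) (simp add: sum_distrib_left mult.assoc)
qed

lemma lin_span_sum:
  "(\<And>i. i \<in> S \<Longrightarrow> F i \<in> lin_span G) \<Longrightarrow> (\<lambda>p. \<Sum>i\<in>S. F i p) \<in> lin_span G"
proof -
  assume "\<And>i. i \<in> S \<Longrightarrow> F i \<in> lin_span G"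
  then have "\<forall>i\<in>S. \<exists>k. \<forall>p. F i p = (\<Sum>g\<in>G. k g * g p)" unfolding lin_span_def by blast
  then obtain k where k: "\<forall>i\<in>S. \<forall>p. F i p = (\<Sum>g\<in>G. k i g * g p)" by metis
  then have "(\<Sum>i\<in>S. F i p) = (\<Sum>g\<in>G. (\<Sum>i\<in>S. k i g) * g p)" for p
    by (simp add: sum_distrib_right sum.swap[of _ G S])
  then show ?thesis unfolding lin_span_def mem_Collect_eq by (intro exI allI)
qed

lemma lin_span_linear_image:
  assumes F: "F \<in> lin_span G" and H: "\<And>g. g \<in> G \<Longrightarrow> (\<lambda>q. h q * g (\<phi> q)) \<in> lin_span H"
  shows "(\<lambda>q. h q * F (\<phi> q)) \<in> lin_span H"
proof -
  obtain k where k: "\<forall>p. F p = (\<Sum>g\<in>G. k g * g p)" using F unfolding lin_span_def by blast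
  have "(\<lambda>q. \<Sum>g\<in>G. k g * (h q * g (\<phi> q))) \<in> lin_span H"
    by (intro lin_span_sum lin_span_scale H)
  then show ?thesis using k by (simp add: sum_distrib_left mult.left_commute)
qed

lemma lin_span_mono:
  assumes F: "F \<in> lin_span G" and GH: "G \<subseteq> H" "finite H" shows "F \<in> lin_span H"
proof -
  have "(\<lambda>q. 1 * F q) \<in> lin_span H"
  proof (rule lin_span_linear_image[OF F])
    fix g assume "g \<in> G"
    then have "g \<in> lin_span H" using GH by (intro lin_span_base) auto
    then show "(\<lambda>q. 1 * g q) \<in> lin_span H" by simp
  qed
  then show ?thesis by simp
qed

lemma dependent_in_lin_span:
  assumes "finite G" "finite X" "card G < card X" "\<And>x. x \<in> X \<Longrightarrow> F x \<in> lin_span G"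
  shows "\<exists>k. (\<exists>x\<in>X. k x \<noteq> 0) \<and> (\<forall>p. (\<Sum>x\<in>X. k x * F x p) = 0)"
proof -
  have "\<forall>x\<in>X. \<exists>k. \<forall>p. F x p = (\<Sum>g\<in>G. k g * g p)" using assms(4) unfolding lin_span_def by blast
  then obtain M where M: "\<forall>x\<in>X. \<forall>p. F x p = (\<Sum>g\<in>G. M x g * g p)" by metis
  obtain k where k: "\<exists>x\<in>X. k x \<noteq> 0" "\<forall>g\<in>G. (\<Sum>x\<in>X. k x * M x g) = 0"
    using homogeneous_system[OF assms(1-3)] by blast
  have "(\<Sum>x\<in>X. k x * F x p) = 0" for p
  proof -
    have "(\<Sum>x\<in>X. k x * F x p) = (\<Sum>x\<in>X. \<Sum>g\<in>G. k x * M x g * g p)"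
      using M by (simp add: sum_distrib_left mult.assoc)
    also have "\<dots> = (\<Sum>g\<in>G. (\<Sum>x\<in>X. k x * M x g) * g p)"
      by (subst sum.swap) (simp add: sum_distrib_right)
    finally show ?thesis using k(2) by simp
  qed
  then show ?thesis using k(1) by blast
qed

text \<open>
  For a minimal set \<open>J\<close> of coordinates that determines the vectors of \<open>V\<close>, each \<open>j \<in> J\<close> comes with a vector of
  \<open>V\<close> whose only nonzero coordinate in \<open>J\<close> is the one at \<open>j\<close>.  These vectors are independent.
\<close>

lemma few_determining_coordinates:
  fixes V :: "(real ^ 'n) set"
  assumes V: "subspace V"
  obtains J where "card J \<le> dim V"
    "\<And>x y. x \<in> V \<Longrightarrow> y \<in> V \<Longrightarrow> (\<And>j. j \<in> J \<Longrightarrow> x $ j = y $ j) \<Longrightarrow> x = y"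
proof -
  define P where "P J \<longleftrightarrow> (\<forall>x\<in>V. (\<forall>j\<in>J. x $ j = 0) \<longrightarrow> x = 0)" for J
  have "P UNIV" by (auto simp: P_def vec_eq_iff)
  then obtain J where J: "P J" and min: "\<forall>K. P K \<longrightarrow> card J \<le> card K"
    using ex_has_least_nat[of P UNIV card] by blast
  have "\<exists>x. x \<in> V \<and> x $ j \<noteq> 0 \<and> (\<forall>i\<in>J - {j}. x $ i = 0)" if j: "j \<in> J" for j
  proof -
    have "card (J - {j}) < card J" using j by (intro psubset_card_mono) auto
    then have "\<not> P (J - {j})" using min by (meson not_le)
    then obtain x where x: "x \<in> V" "\<forall>i\<in>J - {j}. x $ i = 0" "x \<noteq> 0" unfolding P_def by blast
    then have "x $ j \<noteq> 0" using J unfolding P_def by (metis DiffI singletonD)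
    then show ?thesis using x by blast
  qed
  then obtain b where b: "\<And>j. j \<in> J \<Longrightarrow> b j \<in> V" "\<And>j. j \<in> J \<Longrightarrow> b j $ j \<noteq> 0"
    "\<And>i j. j \<in> J \<Longrightarrow> i \<in> J \<Longrightarrow> i \<noteq> j \<Longrightarrow> b j $ i = 0" by (metis DiffI singletonD)
  have inj: "inj_on b J" using b by (metis inj_onI)
  have "independent (b ` J)"
    unfolding independent_explicit
  proof (intro conjI allI impI ballI)
    fix u v assume z: "(\<Sum>v\<in>b ` J. u v *\<^sub>R v) = 0" and v: "v \<in> b ` J"
    then obtain i where i: "i \<in> J" "v = b i" by blast
    have "0 = (\<Sum>j\<in>J. u (b j) *\<^sub>R b j) $ i" using z inj by (simp add: sum.reindex)
    also have "\<dots> = (\<Sum>j\<in>J. if j = i then u (b i) * b i $ i else 0)"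
      unfolding sum_component by (intro sum.cong) (auto simp: b i)
    also have "\<dots> = u (b i) * b i $ i" using i by simp
    finally show "u v = 0" using b(2)[OF i(1)] i by simp
  qed simp
  moreover have "b ` J \<subseteq> V" using b by blast
  ultimately have "card (b ` J) \<le> dim V" using independent_card_le_dim by blast
  then have "card J \<le> dim V" using inj by (simp add: card_image)
  moreover have "x = y" if "x \<in> V" "y \<in> V" "\<And>j. j \<in> J \<Longrightarrow> x $ j = y $ j" for x y
  proof -
    have "x - y \<in> V" using V that subspace_diff by blast
    then show ?thesis using J that(3) unfolding P_def by (metis eq_iff_diff_eq_0 vector_minus_component)
  qed
  ultimately show ?thesis using that by blast
qed

text \<open>
  The space of affine relations among the points \<open>e b\<close> has dimension \<open>card B - dim - 1\<close>, where \<open>dim\<close> is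
  the dimension of their affine hull: choosing an affine basis among the points, the weights at
  the basis points are linear functions of the remaining weights.
\<close>

lemma affine_relations_parametrized:
  fixes e :: "'b \<Rightarrow> real ^ 'n"
  assumes B: "finite B" "b0 \<in> B"
  shows "\<exists>B' L. B' \<subseteq> B \<and> card B' + dim ((\<lambda>b. e b - e b0) ` B) + 1 = card B \<and>
    (\<forall>w :: 'b \<Rightarrow> complex. (\<Sum>b\<in>B. w b) = 0 \<longrightarrow> (\<forall>i. (\<Sum>b\<in>B. of_real (e b $ i) * w b) = 0) \<longrightarrow>
      (\<forall>b\<in>B. w b = (\<Sum>b'\<in>B'. L b b' * w b')))"
proof -
  let ?E = "(\<lambda>b. e b - e b0) ` B"
  obtain \<beta> where \<beta>: "\<beta> \<subseteq> ?E" "independent \<beta>" "?E \<subseteq> span \<beta>" "card \<beta> = dim ?E"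
    using basis_exists by blast
  have fin: "finite \<beta>" using \<beta>(2) independent_explicit by blast
  have "\<forall>x\<in>\<beta>. \<exists>b\<in>B. e b - e b0 = x" using \<beta>(1) by auto
  then obtain s where s: "\<And>x. x \<in> \<beta> \<Longrightarrow> s x \<in> B" "\<And>x. x \<in> \<beta> \<Longrightarrow> e (s x) - e b0 = x" by metis
  have inj: "inj_on s \<beta>" using s(2) by (metis inj_onI)
  have b0: "b0 \<notin> s ` \<beta>" using s(2) \<beta>(2) by (metis diff_self dependent_zero imageE)
  have "\<forall>b\<in>B. \<exists>u. e b - e b0 = (\<Sum>x\<in>\<beta>. u x *\<^sub>R x)"
    using \<beta>(3) unfolding span_finite[OF fin] by blast
  then obtain u where u: "\<And>b. b \<in> B \<Longrightarrow> e b - e b0 = (\<Sum>x\<in>\<beta>. u b x *\<^sub>R x)" by metis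
  \<comment> \<open>The coordinates of \<open>e b - e b0\<close> in the basis, chosen to be those of a unit vector for basis points.\<close>
  define l where "l b x = (if b \<in> s ` \<beta> then (if e b - e b0 = x then 1 else 0) else if b = b0 then 0 else u b x)" for b x
  have l: "e b - e b0 = (\<Sum>x\<in>\<beta>. l b x *\<^sub>R x)" if b: "b \<in> B" for b
  proof -
    consider x where "x \<in> \<beta>" "b = s x" | "b \<notin> s ` \<beta>" "b = b0" | "b \<notin> s ` \<beta>" "b \<noteq> b0" by blast
    then show ?thesis
    proof cases
      case 1
      then have "(\<Sum>x'\<in>\<beta>. l b x' *\<^sub>R x') = (\<Sum>x'\<in>\<beta>. if x = x' then x' else 0)"
        using s(2)[of x] by (intro sum.cong) (auto simp: l_def)
      then show ?thesis using 1 s(2)[of x] fin by simp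
    qed (use u b in \<open>simp_all add: l_def\<close>)
  qed
  define B' where "B' = B - insert b0 (s ` \<beta>)"
  have sB: "insert b0 (s ` \<beta>) \<subseteq> B" using s(1) B by blast
  have cardB: "card B' + dim ?E + 1 = card B"
  proof -
    have "card (insert b0 (s ` \<beta>)) = dim ?E + 1"
      using b0 fin inj \<beta>(4) by (simp add: card_image)
    then show ?thesis unfolding B'_def
      using card_Diff_subset[of "insert b0 (s ` \<beta>)" B] card_mono[OF B(1) sB] fin sB by simp
  qed
  define K where "K b b' = (if b \<in> s ` \<beta> then - complex_of_real (l b' (e b - e b0))
      else if b = b' then 1 else 0)" for b b'
  define L where "L b b' = (if b = b0 then - (\<Sum>b\<in>B - {b0}. K b b') else K b b')" for b b'
  have main: "\<forall>b\<in>B. w b = (\<Sum>b'\<in>B'. L b b' * w b')"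
    if w: "(\<Sum>b\<in>B. w b) = 0" "\<And>i. (\<Sum>b\<in>B. of_real (e b $ i) * w b) = 0" for w :: "'b \<Rightarrow> complex"
  proof -
    define z where "z x = (\<Sum>b\<in>B. of_real (l b x) * w b)" for x
    have comp: "(\<Sum>x\<in>\<beta>. of_real (x $ i) * z x) = 0" for i
    proof -
      have "(\<Sum>x\<in>\<beta>. of_real (x $ i) * z x) = (\<Sum>b\<in>B. of_real (\<Sum>x\<in>\<beta>. l b x * x $ i) * w b)"
        unfolding z_def by (simp add: sum_distrib_left sum_distrib_right sum.swap[of _ \<beta> B] mult_ac)
      also have "\<dots> = (\<Sum>b\<in>B. of_real ((e b - e b0) $ i) * w b)"
        by (intro sum.cong) (simp_all add: l)
      also have "\<dots> = (\<Sum>b\<in>B. of_real (e b $ i) * w b) - of_real (e b0 $ i) * (\<Sum>b\<in>B. w b)"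
        by (simp add: left_diff_distrib sum_subtractf sum_distrib_left)
      finally show ?thesis using w by simp
    qed
    have z0: "z x = 0" if x: "x \<in> \<beta>" for x
    proof -
      have "(\<Sum>x\<in>\<beta>. Re (z x) *\<^sub>R x) = 0" "(\<Sum>x\<in>\<beta>. Im (z x) *\<^sub>R x) = 0"
        using arg_cong[OF comp, of Re] arg_cong[OF comp, of Im]
        by (simp_all add: vec_eq_iff Re_sum Im_sum mult.commute)
      then show ?thesis using \<beta>(2) x unfolding independent_explicit by (auto simp: complex_eq_iff)
    qed
    have K: "w b = (\<Sum>b'\<in>B'. K b b' * w b')" if b: "b \<in> B" "b \<noteq> b0" for b
    proof (cases "b \<in> s ` \<beta>")
      case True
      then obtain x where x: "x \<in> \<beta>" "b = s x" by blast
      have "0 = (\<Sum>b\<in>insert b0 (s ` \<beta>). of_real (l b x) * w b) + (\<Sum>b\<in>B'. of_real (l b x) * w b)"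
        using z0[OF x(1)] sum.subset_diff[OF sB B(1), of "\<lambda>b. of_real (l b x) * w b"]
        unfolding z_def B'_def by (simp add: add.commute)
      also have "(\<Sum>b\<in>insert b0 (s ` \<beta>). of_real (l b x) * w b) = (\<Sum>x'\<in>\<beta>. of_real (l (s x') x) * w (s x'))"
        using b0 fin inj by (simp add: l_def sum.reindex)
      also have "\<dots> = (\<Sum>x'\<in>\<beta>. if x' = x then w b else 0)"
        using s(2) x by (intro sum.cong) (auto simp: l_def)
      also have "\<dots> = w b" using x fin by simp
      finally have "w b = - (\<Sum>b\<in>B'. of_real (l b x) * w b)" by (simp add: eq_neg_iff_add_eq_0)
      then show ?thesis using x s(2)[OF x(1)] by (simp add: K_def sum_negf)
    next
      case False
      then have "b \<in> B'" using b by (simp add: B'_def)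
      moreover have "(\<Sum>b'\<in>B'. K b b' * w b') = (\<Sum>b'\<in>B'. if b = b' then w b' else 0)"
        using False by (intro sum.cong) (auto simp: K_def)
      ultimately show ?thesis using B(1) by (simp add: B'_def)
    qed
    have "w b0 = - (\<Sum>b\<in>B - {b0}. w b)"
      using w(1) B by (simp add: sum.remove eq_neg_iff_add_eq_0)
    also have "(\<Sum>b\<in>B - {b0}. w b) = (\<Sum>b\<in>B - {b0}. \<Sum>b'\<in>B'. K b b' * w b')"
      by (intro sum.cong) (auto intro: K)
    also have "- \<dots> = (\<Sum>b'\<in>B'. L b0 b' * w b')"
      by (subst sum.swap) (simp add: L_def sum_negf sum_distrib_right)
    finally have b0: "w b0 = (\<Sum>b'\<in>B'. L b0 b' * w b')" .
    show ?thesis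
    proof
      fix b assume "b \<in> B"
      then show "w b = (\<Sum>b'\<in>B'. L b b' * w b')"
        using b0 K[of b] by (cases "b = b0") (simp_all add: L_def)
    qed
  qed
  have "B' \<subseteq> B" by (auto simp: B'_def)
  then show ?thesis using cardB main by (intro exI[of _ B'] exI[of _ L] conjI) simp_all
qed


text \<open>
  The coefficient vectors of the polynomials supported on \<open>B\<close> with a singular point in the torus.  The
  partial derivatives are multiplied by \<open>x\<^sub>i\<close>, which makes the conditions linear in the terms of the polynomial.
\<close>

definition sing_coeffs :: "'n::finite expo set \<Rightarrow> ('n expo \<Rightarrow> complex) set" where
  "sing_coeffs B = {c. \<exists>x. (\<forall>i. x i \<noteq> 0) \<and> (\<Sum>b\<in>B. c b * monom_eval b x) = 0 \<and>
    (\<forall>i. (\<Sum>b\<in>B. of_nat (lookup b i) * (c b * monom_eval b x)) = 0)}"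

text \<open>
  The monomial \<open>x\<^sup>\<beta>\<close> in logarithmic coordinates \<open>x = exp \<theta>\<close>, in which negative exponents cause no trouble.
\<close>

definition character :: "real ^ 'n \<Rightarrow> ('n \<Rightarrow> complex) \<Rightarrow> complex" where
  "character \<beta> \<theta> = exp (\<Sum>i\<in>UNIV. of_real (\<beta> $ i) * \<theta> i)"

lemma character_add: "character (\<beta> + \<gamma>) \<theta> = character \<beta> \<theta> * character \<gamma> \<theta>"
  by (simp add: character_def distrib_right sum.distrib exp_add)

lemma character_0 [simp]: "character 0 \<theta> = 1"
  by (simp add: character_def)

lemma character_of_nat_scale: "character (real k *\<^sub>R \<beta>) \<theta> = character \<beta> \<theta> ^ k"
  by (induction k) (simp_all add: distrib_right scaleR_add_left character_add)

lemma character_sum: "character (\<Sum>b\<in>S. f b) \<theta> = (\<Prod>b\<in>S. character (f b) \<theta>)"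
  by (induction S rule: infinite_finite_induct) (simp_all add: character_add)

text \<open>
  A product of \<open>\<Sum> m\<close> linear forms in the variables \<open>B'\<close> is a combination of monomials in these variables
  with all exponents at most \<open>\<Sum> m\<close>.
\<close>

lemma power_product_in_lin_span:
  fixes l :: "'b \<Rightarrow> 'b \<Rightarrow> complex" and m :: "'b \<Rightarrow> nat"
  assumes fin: "finite B'" "finite S"
  defines "Mon \<equiv> \<lambda>K. (\<lambda>\<alpha> u. \<Prod>b\<in>B'. u b ^ \<alpha> b) ` (B' \<rightarrow>\<^sub>E {..K::nat})"
  shows "(\<lambda>u. \<Prod>b\<in>S. (\<Sum>b'\<in>B'. l b b' * u b') ^ m b) \<in> lin_span (Mon (\<Sum>b\<in>S. m b))"
proof -
  have finMon: "finite (Mon K)" for K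
    unfolding Mon_def using fin by (intro finite_imageI finite_PiE) auto
  have step: "(\<lambda>u. (\<Sum>b'\<in>B'. l b b' * u b') * F u) \<in> lin_span (Mon (Suc K))"
    if F: "F \<in> lin_span (Mon K)" for F K b
  proof -
    have "(\<lambda>u. u b' * F u) \<in> lin_span (Mon (Suc K))" if b': "b' \<in> B'" for b'
    proof (rule lin_span_linear_image[OF F, of "\<lambda>u. u b'" "\<lambda>u. u"])
      fix g assume "g \<in> Mon K"
      then obtain \<alpha> where \<alpha>: "\<alpha> \<in> B' \<rightarrow>\<^sub>E {..K}" "g = (\<lambda>u. \<Prod>b\<in>B'. u b ^ \<alpha> b)" unfolding Mon_def by blast
      have "u b' * g u = (\<Prod>b\<in>B'. u b ^ (\<alpha>(b' := Suc (\<alpha> b'))) b)" for u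
      proof -
        have "(\<Prod>b\<in>B' - {b'}. u b ^ (\<alpha>(b' := Suc (\<alpha> b'))) b) = (\<Prod>b\<in>B' - {b'}. u b ^ \<alpha> b)"
          by (intro prod.cong) auto
        then show ?thesis using b' fin(1) by (simp add: \<alpha>(2) prod.remove[of B' b'])
      qed
      moreover have "\<alpha>(b' := Suc (\<alpha> b')) \<in> B' \<rightarrow>\<^sub>E {..Suc K}"
        using \<alpha>(1) b' by (fastforce simp: PiE_iff extensional_def)
      ultimately have "(\<lambda>u. u b' * g u) \<in> Mon (Suc K)" unfolding Mon_def by (intro image_eqI) auto
      then show "(\<lambda>u. u b' * g u) \<in> lin_span (Mon (Suc K))" by (rule lin_span_base[OF finMon])
    qed
    then have "(\<lambda>u. \<Sum>b'\<in>B'. l b b' * (u b' * F u)) \<in> lin_span (Mon (Suc K))"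
      by (intro lin_span_sum lin_span_scale)
    then show ?thesis by (simp add: sum_distrib_right mult.assoc)
  qed
  have pow: "(\<lambda>u. (\<Sum>b'\<in>B'. l b b' * u b') ^ k * F u) \<in> lin_span (Mon (k + K))"
    if F: "F \<in> lin_span (Mon K)" for F K b k
  proof (induction k)
    case (Suc k)
    from step[OF this, of b] show ?case by (simp add: mult.assoc)
  qed (use F in simp)
  have one: "(\<lambda>u. 1) \<in> lin_span (Mon 0)"
  proof (rule lin_span_base[OF finMon])
    have "(\<lambda>b\<in>B'. 0) \<in> B' \<rightarrow>\<^sub>E {..0::nat}" by auto
    then show "(\<lambda>u. 1) \<in> Mon 0" unfolding Mon_def by (rule image_eqI[rotated]) simp
  qed
  from fin(2) show ?thesis
  proof induction
    case empty
    then show ?case using one by simp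
  next
    case (insert b S)
    from pow[OF insert.IH, of b "m b"] show ?case using insert.hyps by simp
  qed
qed

text \<open>
  The exponents \<open>\<Sum> m\<^sub>b d\<^sub>b\<close> are integer vectors in the span of the \<open>d\<^sub>b\<close>; they are determined by as many
  coordinates as the dimension of that span, each of them bounded linearly in \<open>D\<close>.
\<close>

lemma few_exponents:
  fixes d :: "'b \<Rightarrow> real ^ 'n" and D M :: nat
  assumes B: "finite B" and int: "\<And>b i. b \<in> B \<Longrightarrow> \<exists>k. d b $ i = of_int k \<and> \<bar>k\<bar> \<le> int M"
  defines "T \<equiv> (\<lambda>m. \<Sum>b\<in>B. real (m b) *\<^sub>R d b) ` (B \<rightarrow>\<^sub>E {..D::nat})"
  shows "finite T" "card T \<le> (2 * (card B * D * M) + 1) ^ dim (d ` B)"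
proof -
  show fin: "finite T" unfolding T_def using B by (intro finite_imageI finite_PiE) auto
  let ?C = "card B * D * M"
  let ?V = "span (d ` B)"
  obtain J where J: "card J \<le> dim ?V"
    "\<And>x y. x \<in> ?V \<Longrightarrow> y \<in> ?V \<Longrightarrow> (\<And>j. j \<in> J \<Longrightarrow> x $ j = y $ j) \<Longrightarrow> x = y"
    using few_determining_coordinates[OF subspace_span] by blast
  obtain k where k: "\<And>b i. b \<in> B \<Longrightarrow> d b $ i = of_int (k b i)" "\<And>b i. b \<in> B \<Longrightarrow> \<bar>k b i\<bar> \<le> int M"
    using int by metis
  have TV: "T \<subseteq> ?V" unfolding T_def by (auto intro!: span_sum span_scale intro: span_base)
  define \<pi> where "\<pi> t = (\<lambda>j\<in>J. t $ j)" for t :: "real ^ 'n"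
  let ?R = "real_of_int ` {- int ?C..int ?C}"
  have "inj_on \<pi> T"
  proof (rule inj_onI)
    fix x y assume "x \<in> T" "y \<in> T" and eq: "\<pi> x = \<pi> y"
    then show "x = y" using J(2)[of x y] TV by (metis \<pi>_def restrict_apply' subsetD)
  qed
  moreover have "\<pi> ` T \<subseteq> J \<rightarrow>\<^sub>E ?R"
  proof (rule image_subsetI)
    fix t assume "t \<in> T"
    then obtain m where m: "m \<in> B \<rightarrow>\<^sub>E {..D}" "t = (\<Sum>b\<in>B. real (m b) *\<^sub>R d b)" unfolding T_def by blast
    have "t $ j \<in> ?R" for j
    proof -
      have "t $ j = real_of_int (\<Sum>b\<in>B. int (m b) * k b j)" unfolding m(2) by (simp add: k(1))
      moreover have "\<bar>\<Sum>b\<in>B. int (m b) * k b j\<bar> \<le> (\<Sum>b\<in>B. int D * int M)"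
      proof (rule order_trans[OF sum_abs sum_mono])
        fix b assume "b \<in> B"
        then show "\<bar>int (m b) * k b j\<bar> \<le> int D * int M"
          using m(1) k(2)[of b j] unfolding abs_mult by (intro mult_mono) auto
      qed
      ultimately show ?thesis by (intro image_eqI[of _ _ "\<Sum>b\<in>B. int (m b) * k b j"]) auto
    qed
    then show "\<pi> t \<in> J \<rightarrow>\<^sub>E ?R" by (auto simp: \<pi>_def)
  qed
  ultimately have "card T \<le> card (J \<rightarrow>\<^sub>E ?R)"
    by (intro card_inj_on_le) (auto intro!: finite_PiE)
  also have "\<dots> = (2 * ?C + 1) ^ card J"
  proof -
    have "card ?R = card {- int ?C..int ?C}" by (rule card_image) (simp add: inj_on_def)
    also have "\<dots> = 2 * ?C + 1" by (simp only: card_atLeastAtMost_int)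
    finally show ?thesis by (simp add: card_PiE)
  qed
  also have "\<dots> \<le> (2 * ?C + 1) ^ dim (d ` B)" using J(1) by (intro power_increasing) auto
  finally show "card T \<le> (2 * ?C + 1) ^ dim (d ` B)" .
qed


lemma expo_vec_nth [simp]: "expo_vec b $ i = real (lookup b i)"
  by (simp add: expo_vec_def)

lemma monom_eval_UNIV:
  fixes x :: "'n::finite \<Rightarrow> 'r::comm_semiring_1"
  shows "monom_eval b x = (\<Prod>i\<in>UNIV. x i ^ lookup b i)"
  by (rule monom_eval_superset) auto

lemma character_expo_vec:
  "character (expo_vec b) \<theta> = monom_eval b (\<lambda>i. exp (\<theta> i))"
  by (simp add: character_def monom_eval_UNIV exp_sum exp_of_nat_mult)

text \<open>
  The singular polynomials do not fill the coefficient space.  With \<open>N = card B\<close> and \<open>r\<close> the dimension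
  of the affine hull of \<open>B\<close>, a singular polynomial is determined by an affine relation of the exponents
  (\<open>N - r - 1\<close> parameters) and by the position of the singular point, which matters only through \<open>r\<close>
  characters once a common factor is absorbed into the relation.  So there are \<open>N - 1\<close> parameters for
  \<open>N\<close> coefficients.  To obtain a relation, consider the \<open>(D + 1)\<^sup>N\<close> monomials in the coefficients with
  exponents at most \<open>D\<close>: expressed in the parameters they lie in a space whose dimension is
  bounded by a constant multiple of \<open>(D + 1)\<^sup>N\<^sup>-\<^sup>1\<close>, so for large \<open>D\<close> they are linearly dependent.
\<close>

theorem vanishing_polynomial_exists:
  fixes B :: "'n::finite expo set"
  assumes B: "finite B" "B \<noteq> {}"
  shows "\<exists>F. F \<noteq> 0 \<and> F \<in> polys_in B \<and> (\<forall>c\<in>sing_coeffs B. peval F c = 0)"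
proof -
  obtain b0 where b0: "b0 \<in> B" using B by blast
  define d where "d = (\<lambda>b :: 'n expo. expo_vec b - expo_vec b0)"
  have "\<exists>B' L. B' \<subseteq> B \<and> card B' + dim (d ` B) + 1 = card B \<and>
    (\<forall>w :: 'n expo \<Rightarrow> complex. (\<Sum>b\<in>B. w b) = 0 \<longrightarrow> (\<forall>i. (\<Sum>b\<in>B. of_real (expo_vec b $ i) * w b) = 0) \<longrightarrow>
      (\<forall>b\<in>B. w b = (\<Sum>b'\<in>B'. L b b' * w b')))"
    unfolding d_def by (rule affine_relations_parametrized[OF B(1) b0])
  then obtain B' L where B': "B' \<subseteq> B" "card B' + dim (d ` B) + 1 = card B"
    and L: "\<forall>w :: 'n expo \<Rightarrow> complex. (\<Sum>b\<in>B. w b) = 0 \<longrightarrow> (\<forall>i. (\<Sum>b\<in>B. of_real (expo_vec b $ i) * w b) = 0) \<longrightarrow>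
      (\<forall>b\<in>B. w b = (\<Sum>b'\<in>B'. L b b' * w b'))"
    by (elim exE conjE)
  have finB': "finite B'" using B' B finite_subset by blast
  define N where "N = card B"
  define M where "M = (\<Sum>b\<in>B. \<Sum>i\<in>UNIV. lookup b i) + 1"
  have M: "lookup b i < M" if "b \<in> B" for b i
  proof -
    have "lookup b i \<le> (\<Sum>i\<in>UNIV. lookup b i)" by (intro member_le_sum) auto
    also have "\<dots> \<le> (\<Sum>b\<in>B. \<Sum>i\<in>UNIV. lookup b i)" using that B by (intro member_le_sum) auto
    finally show ?thesis by (simp add: M_def)
  qed
  have int: "\<exists>k. d b $ i = of_int k \<and> \<bar>k\<bar> \<le> int M" if "b \<in> B" for b i
    using M[OF that, of i] M[OF b0, of i]
    by (intro exI[of _ "int (lookup b i) - int (lookup b0 i)"]) (simp add: d_def)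
  define q where "q = 2 * (N * M)"
  \<comment> \<open>Large enough for \<open>(q * (D + 1)) ^ (N - 1) < (D + 1) ^ N\<close>.\<close>
  define D where "D = q ^ (N - 1)"
  define X where "X = B \<rightarrow>\<^sub>E {..D}"
  define T where "T = (\<lambda>m. \<Sum>b\<in>B. real (m b) *\<^sub>R d b) ` X"
  define Mon where "Mon = (\<lambda>\<alpha> (u :: 'n expo \<Rightarrow> complex). \<Prod>b\<in>B'. u b ^ \<alpha> b) ` (B' \<rightarrow>\<^sub>E {..N * D})"
  define G where "G = (\<lambda>(f, t) (u, \<theta>). f u * character t \<theta>) ` (Mon \<times> T)"
  \<comment> \<open>The monomial \<open>m\<close> in the coefficients, expressed in the parameters \<open>u\<close> (relation) and \<open>\<theta>\<close> (position).\<close>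
  define F where "F m = (\<lambda>(u, \<theta>). (\<Prod>b\<in>B. (\<Sum>b'\<in>B'. L b b' * u b') ^ m b) *
    character (\<Sum>b\<in>B. real (m b) *\<^sub>R d b) \<theta>)" for m
  have T: "finite T" "card T \<le> (2 * (N * D * M) + 1) ^ dim (d ` B)"
    unfolding T_def X_def N_def using few_exponents[OF B(1) int] by auto
  have Mon: "finite Mon" "card Mon \<le> (N * D + 1) ^ card B'"
  proof -
    show "finite Mon" unfolding Mon_def using finB' by (intro finite_imageI finite_PiE) auto
    have "card Mon \<le> card (B' \<rightarrow>\<^sub>E {..N * D})"
      unfolding Mon_def using finB' by (intro card_image_le finite_PiE) auto
    then show "card Mon \<le> (N * D + 1) ^ card B'" using finB' by (simp add: card_PiE)
  qed
  have finG: "finite G" unfolding G_def using T Mon by blast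
  have finX: "finite X" unfolding X_def using B by (intro finite_PiE) auto
  have N: "N > 0" using B by (simp add: N_def card_gt_0_iff)
  have "card G < card X"
  proof -
    have "card G \<le> card Mon * card T"
      unfolding G_def using card_image_le[of "Mon \<times> T"] T Mon by (simp add: card_cartesian_product)
    also have "\<dots> \<le> (2 * (N * D * M) + 1) ^ card B' * (2 * (N * D * M) + 1) ^ dim (d ` B)"
    proof (intro mult_mono T(2) order_trans[OF Mon(2)] power_mono)
      show "N * D + 1 \<le> 2 * (N * D * M) + 1" using M_def by simp
    qed auto
    also have "\<dots> = (2 * (N * D * M) + 1) ^ (N - 1)"
      using B'(2) by (simp add: N_def power_add[symmetric] flip: B'(2))
    also have "\<dots> \<le> (q * (D + 1)) ^ (N - 1)"
      using N by (intro power_mono) (auto simp: q_def M_def algebra_simps)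
    also have "\<dots> = D * (D + 1) ^ (N - 1)" by (simp only: power_mult_distrib D_def)
    also have "\<dots> < (D + 1) * (D + 1) ^ (N - 1)" by simp
    also have "\<dots> = (D + 1) ^ N" using N by (cases N) simp_all
    also have "\<dots> = card X" using B by (simp add: X_def card_PiE N_def)
    finally show ?thesis .
  qed
  moreover have "F m \<in> lin_span G" if m: "m \<in> X" for m
  proof -
    let ?t = "\<Sum>b\<in>B. real (m b) *\<^sub>R d b"
    let ?f = "\<lambda>u. \<Prod>b\<in>B. (\<Sum>b'\<in>B'. L b b' * u b') ^ m b"
    have "(\<Sum>b\<in>B. m b) \<le> N * D"
      using sum_bounded_above[of B m D] m by (auto simp: X_def N_def)
    then have "(\<lambda>\<alpha> u. \<Prod>b\<in>B'. u b ^ \<alpha> b) ` (B' \<rightarrow>\<^sub>E {..\<Sum>b\<in>B. m b}) \<subseteq> Mon"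
      unfolding Mon_def by (intro image_mono PiE_mono) auto
    then have "?f \<in> lin_span Mon"
      by (rule lin_span_mono[OF power_product_in_lin_span[OF finB' B(1)] _ Mon(1)])
    then have "(\<lambda>p. character ?t (snd p) * ?f (fst p)) \<in> lin_span G"
    proof (rule lin_span_linear_image[where h = "\<lambda>p. character ?t (snd p)" and \<phi> = fst])
      fix g assume "g \<in> Mon"
      then have "(\<lambda>(u, \<theta>). g u * character ?t \<theta>) \<in> G"
        unfolding G_def T_def using m by (intro image_eqI[of _ _ "(g, ?t)"]) auto
      then show "(\<lambda>p. character ?t (snd p) * g (fst p)) \<in> lin_span G"
        using lin_span_base[OF finG] by (simp add: case_prod_beta' mult.commute)
    qed
    then show ?thesis by (simp add: F_def case_prod_beta' mult.commute)
  qed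
  ultimately obtain k where k: "\<exists>m\<in>X. k m \<noteq> 0" "\<And>p. (\<Sum>m\<in>X. k m * F m p) = 0"
    using dependent_in_lin_span[OF finG finX, of F] by blast
  \<comment> \<open>The linear dependence is turned into a polynomial in the coefficients.\<close>
  define \<mu> where "\<mu> m = (\<Sum>b\<in>B. Poly_Mapping.single b (m b))" for m :: "'n expo \<Rightarrow> nat"
  have \<mu>: "lookup (\<mu> m) b = (if b \<in> B then m b else 0)" for m b
    unfolding \<mu>_def by (rule lookup_sum_single[OF B(1)])
  have inj: "inj_on \<mu> X"
  proof (rule inj_onI)
    fix m m' assume mm: "m \<in> X" "m' \<in> X" and eq: "\<mu> m = \<mu> m'"
    have "m b = m' b" if "b \<in> B" for b using \<mu>[of m b] \<mu>[of m' b] eq that by simp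
    then show "m = m'" by (rule PiE_ext[OF mm[unfolded X_def]])
  qed
  define P :: "('n expo, complex) mpoly" where "P = (\<Sum>m\<in>X. Poly_Mapping.single (\<mu> m) (k m))"
  have P: "mpoly_eval P c = (\<Sum>m\<in>X. k m * (\<Prod>b\<in>B. c b ^ m b))" for c
  proof -
    have "monom_eval (\<mu> m) c = (\<Prod>b\<in>B. c b ^ m b)" for m
      using B(1) \<mu> by (subst monom_eval_superset[of B]) (auto simp: in_keys_iff split: if_splits)
    then show ?thesis by (simp add: P_def mpoly_eval_sum)
  qed
  have "P \<noteq> 0"
  proof
    assume "P = 0"
    have "lookup P (\<mu> m0) = k m0" if m0: "m0 \<in> X" for m0
    proof -
      have "lookup P (\<mu> m0) = (\<Sum>m\<in>X. if m = m0 then k m else 0)"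
        unfolding P_def lookup_sum using inj m0
        by (intro sum.cong) (auto simp: lookup_single when_def dest: inj_onD)
      then show ?thesis using m0 finX by simp
    qed
    then show False using k(1) \<open>P = 0\<close> by simp
  qed
  then have "polyfun_of P \<noteq> 0" by (metis polyfun_of_hom(4) polyfun_of_inject)
  moreover have "polyfun_of P \<in> polys_in B"
    by (rule polys_inI) (auto simp: P intro!: sum.cong prod.cong)
  moreover have "peval (polyfun_of P) c = 0" if c: "c \<in> sing_coeffs B" for c
  proof -
    obtain x where x: "\<And>i. x i \<noteq> 0" "(\<Sum>b\<in>B. c b * monom_eval b x) = 0"
      "\<And>i. (\<Sum>b\<in>B. of_nat (lookup b i) * (c b * monom_eval b x)) = 0"
      using c unfolding sing_coeffs_def by blast
    define \<theta> where "\<theta> i = - Ln (x i)" for i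
    \<comment> \<open>The terms of the polynomial at its singular point form an affine relation; the factor at \<open>b0\<close> leaves the differences \<open>d b\<close> as exponents.\<close>
    define u where "u b = c b * monom_eval b x * character (expo_vec b0) \<theta>" for b
    have ch: "monom_eval b x * character (expo_vec b) \<theta> = 1" for b
    proof -
      have "monom_eval b x * character (expo_vec b) \<theta> = monom_eval b (\<lambda>i. x i * exp (\<theta> i))"
        by (simp add: character_expo_vec monom_eval_mult)
      also have "\<dots> = monom_eval b (\<lambda>_. 1)" using x(1) by (simp add: \<theta>_def exp_minus)
      finally show ?thesis by (simp add: monom_eval_def)
    qed
    have cu: "c b = u b * character (d b) \<theta>" for b
    proof -
      have "character (expo_vec b0) \<theta> * character (d b) \<theta> = character (expo_vec b) \<theta>"
        by (simp add: d_def flip: character_add)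
      then show ?thesis using ch[of b] by (simp add: u_def mult.assoc)
    qed
    have u: "u b = (\<Sum>b'\<in>B'. L b b' * u b')" if "b \<in> B" for b
    proof -
      have "(\<Sum>b\<in>B. u b) = 0"
        using x(2) by (simp add: u_def flip: sum_distrib_right)
      moreover have "(\<Sum>b\<in>B. of_real (expo_vec b $ i) * u b) = 0" for i
        using x(3)[of i] by (simp add: u_def mult.assoc[symmetric] flip: sum_distrib_right)
      ultimately show ?thesis using L that by blast
    qed
    have "(\<Prod>b\<in>B. c b ^ m b) = F m (u, \<theta>)" for m
      unfolding F_def split_conv character_sum character_of_nat_scale prod.distrib[symmetric]
      by (intro prod.cong) (simp_all add: power_mult_distrib[symmetric] cu flip: u)
    then show ?thesis using k(2)[of "(u, \<theta>)"] P by simp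
  qed
  ultimately show ?thesis by blast
qed

section \<open>The discriminant of a support set\<close>

lemma monom_eval_upd:
  fixes x :: "'n::finite \<Rightarrow> 'a::comm_semiring_1"
  shows "monom_eval b (x(i := t)) = t ^ lookup b i * (\<Prod>j\<in>UNIV - {i}. x j ^ lookup b j)"
proof -
  have "monom_eval b (x(i := t)) = (\<Prod>j\<in>insert i (UNIV - {i}). (x(i := t)) j ^ lookup b j)"
    by (simp add: monom_eval_UNIV insert_absorb)
  also have "\<dots> = t ^ lookup b i * (\<Prod>j\<in>UNIV - {i}. (x(i := t)) j ^ lookup b j)"
    by (subst prod.insert) auto
  also have "(\<Prod>j\<in>UNIV - {i}. (x(i := t)) j ^ lookup b j) = (\<Prod>j\<in>UNIV - {i}. x j ^ lookup b j)"
    by (intro prod.cong) auto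
  finally show ?thesis .
qed

text \<open>
  Stated over real and complex numbers alike: the real version is used at a minimum, the complex
  version for the torus.
\<close>

lemma euler_derivative:
  fixes x :: "'n::finite \<Rightarrow> 'a::real_normed_field" and B :: "'n expo set"
  shows "\<exists>D. ((\<lambda>t. \<Sum>b\<in>B. c b * monom_eval b (x(i := t))) has_field_derivative D) (at (x i)) \<and>
    x i * D = (\<Sum>b\<in>B. of_nat (lookup b i) * (c b * monom_eval b x))"
proof -
  let ?r = "\<lambda>b. \<Prod>j\<in>UNIV - {i}. x j ^ lookup b j"
  let ?D = "\<Sum>b\<in>B. c b * (of_nat (lookup b i) * x i ^ (lookup b i - 1) * ?r b)"
  have "((\<lambda>t. \<Sum>b\<in>B. c b * (t ^ lookup b i * ?r b)) has_field_derivative ?D) (at (x i))"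
    by (auto intro!: derivative_eq_intros sum.cong)
  moreover have "x i * ?D = (\<Sum>b\<in>B. of_nat (lookup b i) * (c b * monom_eval b x))"
    unfolding sum_distrib_left
  proof (intro sum.cong refl)
    fix b
    have "x i * x i ^ (lookup b i - 1) = x i ^ lookup b i" if "lookup b i \<noteq> 0"
      using that by (cases "lookup b i") auto
    moreover have "monom_eval b x = x i ^ lookup b i * ?r b"
      using monom_eval_upd[of b x i "x i"] by simp
    ultimately show "x i * (c b * (of_nat (lookup b i) * x i ^ (lookup b i - 1) * ?r b)) =
      of_nat (lookup b i) * (c b * monom_eval b x)"
      by (cases "lookup b i = 0") (simp_all add: mult_ac)
  qed
  ultimately show ?thesis unfolding monom_eval_upd by blast
qed

lemma singular_polys_iff:
  fixes B :: "'n::finite expo set"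
  assumes "finite B" "g \<in> polys_on B"
  shows "g \<in> singular_polys B \<longleftrightarrow> lookup g \<in> sing_coeffs B"
proof -
  have ev: "mpoly_eval g x = (\<Sum>b\<in>B. lookup g b * monom_eval b x)" for x
    using assms by (intro mpoly_eval_superset) (auto simp: polys_on_def)
  have "deriv (\<lambda>t. mpoly_eval g (x(i := t))) (x i) = 0 \<longleftrightarrow>
      (\<Sum>b\<in>B. of_nat (lookup b i) * (lookup g b * monom_eval b x)) = 0" if "x i \<noteq> 0" for x i
  proof -
    obtain D where D: "((\<lambda>t. mpoly_eval g (x(i := t))) has_field_derivative D) (at (x i))"
      "x i * D = (\<Sum>b\<in>B. of_nat (lookup b i) * (lookup g b * monom_eval b x))"
      using euler_derivative[where B = B and c = "lookup g" and x = x and i = i] unfolding ev by blast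
    show ?thesis unfolding DERIV_imp_deriv[OF D(1)] D(2)[symmetric] using that by simp
  qed
  then show ?thesis using assms(2) by (auto simp: singular_polys_def sing_coeffs_def ev)
qed

definition sing_ideal :: "'n::finite expo set \<Rightarrow> 'n expo polyfun set" where
  "sing_ideal B = {F. \<forall>c\<in>sing_coeffs B. peval F c = 0}"

text \<open>
  A singular polynomial with singular point \<open>x\<close> has coefficients \<open>w\<^sub>b y\<^sup>b\<close>, where \<open>y = 1 / x\<close> and
  the terms \<open>w\<^sub>b\<close> satisfy linear equations independent of the point.  Joining two parameters
  \<open>(w, y)\<close> and \<open>(w', y')\<close> by a line gives a polynomial curve of coefficient vectors.  It stays in the singular
  locus except where a coordinate of \<open>y\<close> vanishes, that is, for finitely many values of \<open>t\<close>.  Two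
  polynomials that do not vanish at the respective ends therefore have a common point of the locus where neither vanishes.
\<close>

lemma sing_ideal_prime:
  fixes B :: "'n::finite expo set"
  assumes FG: "F * G \<in> sing_ideal B"
  shows "F \<in> sing_ideal B \<or> G \<in> sing_ideal B"
proof (rule ccontr)
  assume "\<not> ?thesis"
  then obtain c c' where c: "c \<in> sing_coeffs B" "peval F c \<noteq> 0" and c': "c' \<in> sing_coeffs B" "peval G c' \<noteq> 0"
    unfolding sing_ideal_def by blast
  obtain x where x: "\<And>i. x i \<noteq> 0" "(\<Sum>b\<in>B. c b * monom_eval b x) = 0"
      "\<And>i. (\<Sum>b\<in>B. of_nat (lookup b i) * (c b * monom_eval b x)) = 0"
    using c(1) unfolding sing_coeffs_def by blast
  obtain x' where x': "\<And>i. x' i \<noteq> 0" "(\<Sum>b\<in>B. c' b * monom_eval b x') = 0"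
      "\<And>i. (\<Sum>b\<in>B. of_nat (lookup b i) * (c' b * monom_eval b x')) = 0"
    using c'(1) unfolding sing_coeffs_def by blast
  define w where "w b = c b * monom_eval b x" for b
  define w' where "w' b = c' b * monom_eval b x'" for b
  define Y where "Y i = [:inverse (x i), inverse (x' i) - inverse (x i):]" for i
  define X where "X b = (if b \<in> B then [:w b, w' b - w b:] * (\<Prod>i\<in>UNIV. Y i ^ lookup b i) else [:c b, c' b - c b:])" for b
  have inv: "monom_eval b z * monom_eval b (\<lambda>i. inverse (z i)) = 1" if "\<And>i. z i \<noteq> 0" for b and z :: "'n \<Rightarrow> complex"
    unfolding monom_eval_mult[symmetric] using that by (simp add: monom_eval_def)
  have X: "poly (X b) t = (w b + t * (w' b - w b)) * monom_eval b (\<lambda>i. poly (Y i) t)" if "b \<in> B" for b t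
    using that by (simp add: X_def poly_prod monom_eval_UNIV distrib_right mult.assoc)
  have "(\<lambda>b. poly (X b) 0) = c"
  proof
    fix b
    show "poly (X b) 0 = c b"
      using inv[OF x(1), of b] X[of b 0] by (cases "b \<in> B") (simp_all add: w_def X_def Y_def mult.assoc)
  qed
  moreover have "(\<lambda>b. poly (X b) 1) = c'"
  proof
    fix b
    show "poly (X b) 1 = c' b"
      using inv[OF x'(1), of b] X[of b 1] by (cases "b \<in> B") (simp_all add: w'_def X_def Y_def mult.assoc)
  qed
  moreover obtain P where P: "\<forall>t. peval F (\<lambda>b. poly (X b) t) = poly P t" using peval_along_curve[of F X] by blast
  moreover obtain Q where Q: "\<forall>t. peval G (\<lambda>b. poly (X b) t) = poly Q t" using peval_along_curve[of G X] by blast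
  ultimately have "poly P 0 \<noteq> 0" "poly Q 1 \<noteq> 0" using c(2) c'(2) by metis+
  then have "P \<noteq> 0" "Q \<noteq> 0" by auto
  moreover have "Y i \<noteq> 0" for i using x(1)[of i] by (simp add: Y_def)
  ultimately have "P * Q * (\<Prod>i\<in>UNIV. Y i) \<noteq> 0" by simp
  then obtain t where "poly (P * Q * (\<Prod>i\<in>UNIV. Y i)) t \<noteq> 0" using poly_all_0_iff_0 by blast
  then have t: "poly P t \<noteq> 0" "poly Q t \<noteq> 0" "\<And>i. poly (Y i) t \<noteq> 0"
    by (auto simp: poly_prod)
  have "(\<lambda>b. poly (X b) t) \<in> sing_coeffs B"
  proof -
    let ?z = "\<lambda>i. inverse (poly (Y i) t)"
    have z: "poly (X b) t * monom_eval b ?z = (1 - t) * w b + t * w' b" if "b \<in> B" for b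
      using inv[of "\<lambda>i. poly (Y i) t" b] t(3) X[OF that, of t] by (simp add: mult.assoc) (simp add: algebra_simps)
    have "(\<Sum>b\<in>B. poly (X b) t * monom_eval b ?z) = (1 - t) * (\<Sum>b\<in>B. w b) + t * (\<Sum>b\<in>B. w' b)"
      by (simp add: z sum.distrib sum_distrib_left)
    moreover have "(\<Sum>b\<in>B. of_nat (lookup b i) * (poly (X b) t * monom_eval b ?z)) =
      (1 - t) * (\<Sum>b\<in>B. of_nat (lookup b i) * w b) + t * (\<Sum>b\<in>B. of_nat (lookup b i) * w' b)" for i
      by (simp add: z sum.distrib sum_distrib_left distrib_left mult.left_commute)
    ultimately show ?thesis unfolding sing_coeffs_def
      using x(2,3) x'(2,3) t(3) by (intro CollectI exI[of _ ?z]) (simp add: w_def w'_def)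
  qed
  then have "peval (F * G) (\<lambda>b. poly (X b) t) = 0" using FG unfolding sing_ideal_def by blast
  then show False using t P Q by simp
qed

lemma sing_coeffs_cong:
  assumes "\<And>b. b \<in> B \<Longrightarrow> c b = c' b"
  shows "c \<in> sing_coeffs B \<longleftrightarrow> c' \<in> sing_coeffs B"
proof -
  have 1: "(\<Sum>b\<in>B. c b * monom_eval b x) = (\<Sum>b\<in>B. c' b * monom_eval b x)" for x
    by (intro sum.cong) (auto simp: assms)
  have 2: "(\<Sum>b\<in>B. of_nat (lookup b i) * (c b * monom_eval b x)) = (\<Sum>b\<in>B. of_nat (lookup b i) * (c' b * monom_eval b x))" for x i
    by (intro sum.cong) (auto simp: assms)
  show ?thesis unfolding sing_coeffs_def mem_Collect_eq 1 2 ..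
qed

lemma poly_with_coefficients:
  assumes "finite B" obtains g where "g \<in> polys_on B" "\<And>b. b \<in> B \<Longrightarrow> lookup g b = (c b :: 'r::comm_monoid_add)"
proof -
  let ?g = "\<Sum>b\<in>B. Poly_Mapping.single b (c b)"
  show ?thesis using lookup_sum_single[OF assms, of c]
    by (intro that[of ?g]) (auto simp: polys_on_def in_keys_iff split: if_splits)
qed

text \<open>
  A generator \<open>p\<close> of the ideal is irreducible because the ideal is prime, it involves only variables of
  \<open>B\<close> because it divides a relation that does, and its zeros are the common zeros of the ideal.  So the
  Zariski closure is the hypersurface of an irreducible polynomial, and whichever such polynomial is
  chosen as discriminant vanishes on the singular locus.
\<close>

theorem generator_gives_discriminant:
  fixes B :: "'n::finite expo set"
  assumes B: "finite B" "B \<noteq> {}"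
    and p: "p \<in> sing_ideal B" "p \<noteq> 0" "\<And>q. q \<in> sing_ideal B \<Longrightarrow> p dvd q" and np: "\<not> p dvd 1"
    and c: "c \<in> sing_coeffs B"
  shows "mpoly_eval (discriminant B) c = 0"
proof -
  obtain D where D: "polyfun_of D = p" using polyfun_of_surj by blast
  obtain F where F: "F \<noteq> 0" "F \<in> polys_in B" "F \<in> sing_ideal B"
    using vanishing_polynomial_exists[OF B] unfolding sing_ideal_def by blast
  obtain h where "F = p * h" using p(3)[OF F(3)] ..
  then have "p \<in> polys_in B" using F polys_in_factor_closed by blast
  then have DB: "D \<in> coeff_polys B" by (simp add: coeff_polys_iff D)
  have "irreducible D"
  proof (rule irreducibleI)
    show "D \<noteq> 0" using p(2) D polyfun_of_hom(4) by auto
    show "\<not> D dvd 1" using np D polyfun_of_dvd_iff[of D 1] by (simp add: polyfun_of_hom)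
    fix a b assume ab: "D = a * b"
    have unit: "b' dvd 1" if ab': "D = a' * b'" and a': "polyfun_of a' \<in> sing_ideal B" for a' b'
    proof -
      obtain s where "polyfun_of a' = p * s" using p(3)[OF a'] ..
      then have "p * 1 = p * (s * polyfun_of b')" using D ab' by (simp add: polyfun_of_hom mult.assoc)
      then have "1 = polyfun_of b' * s" using p(2) by (simp add: mult.commute)
      then have "polyfun_of b' dvd polyfun_of 1" unfolding polyfun_of_hom by (rule dvdI)
      then show ?thesis by (simp add: polyfun_of_dvd_iff)
    qed
    have "polyfun_of a * polyfun_of b \<in> sing_ideal B" using p(1) D ab by (simp add: polyfun_of_hom)
    then show "a dvd 1 \<or> b dvd 1"
      using sing_ideal_prime unit[of a b] unit[of b a] ab by (metis mult.commute)
  qed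
  let ?S = "singular_polys B" and ?Z = "zariski_closure B (singular_polys B)"
  have van: "?S \<subseteq> zero_locus B q \<longleftrightarrow> polyfun_of q \<in> sing_ideal B" if q: "q \<in> coeff_polys B" for q
  proof
    assume sub: "?S \<subseteq> zero_locus B q"
    have "mpoly_eval q c = 0" if c: "c \<in> sing_coeffs B" for c
    proof -
      obtain g where g: "g \<in> polys_on B" "\<And>b. b \<in> B \<Longrightarrow> lookup g b = c b"
        using poly_with_coefficients[OF B(1), of c] by blast
      then have "g \<in> ?S" using singular_polys_iff[OF B(1) g(1)] sing_coeffs_cong[of B "lookup g" c] c by blast
      then have "mpoly_eval q (lookup g) = 0" using sub by (auto simp: zero_locus_def)
      moreover have "mpoly_eval q (lookup g) = mpoly_eval q c"
        using polys_in_eqD[of "polyfun_of q" B "lookup g" c] q g(2) by (simp add: coeff_polys_iff)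
      ultimately show ?thesis by simp
    qed
    then show "polyfun_of q \<in> sing_ideal B" by (simp add: sing_ideal_def)
  next
    assume "polyfun_of q \<in> sing_ideal B"
    then show "?S \<subseteq> zero_locus B q"
      using singular_polys_iff[OF B(1)] by (auto simp: zero_locus_def sing_ideal_def singular_polys_def)
  qed
  have Z: "zero_locus B D = ?Z"
  proof (rule set_eqI)
    fix g
    show "g \<in> zero_locus B D \<longleftrightarrow> g \<in> ?Z"
    proof
      assume g: "g \<in> zero_locus B D"
      have "g \<in> zero_locus B q" if "q \<in> coeff_polys B" "?S \<subseteq> zero_locus B q" for q
      proof -
        have "D dvd q" using van[OF that(1)] that(2) p(3) D polyfun_of_dvd_iff by metis
        then obtain r where "q = D * r" ..
        then show ?thesis using g by (simp add: zero_locus_def mpoly_eval_mult)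
      qed
      then show "g \<in> ?Z" using g by (auto simp: zariski_closure_def zero_locus_def)
    next
      assume "g \<in> ?Z"
      then show "g \<in> zero_locus B D"
        using van[OF DB] DB p(1) D by (auto simp: zariski_closure_def)
    qed
  qed
  have "is_hypersurface B ?Z"
    unfolding is_hypersurface_def
  proof (intro bexI[OF _ DB] conjI)
    show "\<not> keys D \<subseteq> {0}"
    proof
      assume k: "keys D \<subseteq> {0}"
      then have "D \<noteq> 0 \<Longrightarrow> lookup D 0 \<noteq> 0" by (metis in_keys_iff keys_eq_empty subset_singletonD singletonI)
      moreover have "D \<noteq> 0" using p(2) D polyfun_of_hom(4) by auto
      moreover have "p = pconst (lookup D 0)"
        using mpoly_eval_superset[OF _ k] by (intro polyfun_eqI) (simp flip: D)
      ultimately have "p * pconst (inverse (lookup D 0)) = 1"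
        by (intro polyfun_eqI) simp
      then show False using np by (metis dvd_triv_left)
    qed
  qed (simp add: Z)
  then have "discriminant B = (SOME D. D \<in> coeff_polys B \<and> irreducible D \<and> zero_locus B D = ?Z)"
    by (simp add: discriminant_def)
  then have disc: "discriminant B \<in> coeff_polys B \<and> irreducible (discriminant B) \<and> zero_locus B (discriminant B) = ?Z"
    using someI[of "\<lambda>D. D \<in> coeff_polys B \<and> irreducible D \<and> zero_locus B D = ?Z" D] DB \<open>irreducible D\<close> Z by simp
  have "?S \<subseteq> ?Z" by (auto simp: zariski_closure_def singular_polys_def)
  then have "polyfun_of (discriminant B) \<in> sing_ideal B" using van disc by blast
  then show ?thesis using c by (simp add: sing_ideal_def)
qed

text \<open>
  If no nonzero polynomial invariant along the diagonal vanishes on the singular locus, then the ideal of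
  the locus has a generator.  Otherwise the projection of the locus along the diagonal lies in a proper
  algebraic subset.
\<close>

theorem discriminant_or_projection:
  fixes B :: "'n::finite expo set"
  assumes B: "finite B" "B \<noteq> {}"
  shows "(\<forall>c\<in>sing_coeffs B. mpoly_eval (discriminant B) c = 0) \<or>
    (\<exists>F. F \<noteq> 0 \<and> F \<in> inv_along (\<lambda>_. 1) \<and> (\<forall>c\<in>sing_coeffs B. peval F c = 0))"
proof (cases "\<exists>F. F \<noteq> 0 \<and> F \<in> inv_along (\<lambda>_. 1) \<and> F \<in> sing_ideal B")
  case True
  then show ?thesis unfolding sing_ideal_def by blast
next
  case False
  \<comment> \<open>Every entry of the direction is \<open>1\<close>, so any coordinate is normalised along it.\<close>
  interpret direction "\<lambda>_. 1" "undefined :: 'n expo" by unfold_locales simp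
  have "\<exists>F\<in>sing_ideal B. F \<noteq> 0"
    using vanishing_polynomial_exists[OF B] unfolding sing_ideal_def by blast
  then have "\<exists>p\<in>sing_ideal B. p \<noteq> 0 \<and> (\<forall>q\<in>sing_ideal B. p dvd q)"
  proof (rule prime_ideal_generator[rotated 3])
    fix F G :: "'n expo polyfun"
    show "F \<in> sing_ideal B \<Longrightarrow> F * G \<in> sing_ideal B"
      "F \<in> sing_ideal B \<Longrightarrow> G \<in> sing_ideal B \<Longrightarrow> F - G \<in> sing_ideal B" by (auto simp: sing_ideal_def)
    show "F * G \<in> sing_ideal B \<Longrightarrow> F \<in> sing_ideal B \<or> G \<in> sing_ideal B" by (rule sing_ideal_prime)
    show "F \<in> sing_ideal B \<Longrightarrow> F \<in> R \<Longrightarrow> F = 0" using False by blast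
  qed
  then obtain p where p: "p \<in> sing_ideal B" "p \<noteq> 0" "\<And>q. q \<in> sing_ideal B \<Longrightarrow> p dvd q" by blast
  have np: "\<not> p dvd 1"
  proof
    assume "p dvd 1"
    then obtain h where "1 = p * h" ..
    moreover have "p * h \<in> sing_ideal B" using p(1) by (simp add: sing_ideal_def)
    ultimately have "(1 :: 'n expo polyfun) \<in> sing_ideal B" by simp
    moreover have "(1 :: 'n expo polyfun) \<in> R" by (rule subringD(2)[OF subring_inv_along])
    ultimately have "(1 :: 'n expo polyfun) = 0" using False by blast
    then show False by simp
  qed
  show ?thesis using generator_gives_discriminant[OF B p np] by blast
qed

section \<open>Limits of normalised monomials\<close>

lemma convergent_subsequence_family:
  fixes f :: "nat \<Rightarrow> 'a \<Rightarrow> real"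
  assumes "finite A" "\<And>k a. a \<in> A \<Longrightarrow> f k a \<in> {0..1}"
  shows "\<exists>r l. strict_mono (r :: nat \<Rightarrow> nat) \<and> (\<forall>a\<in>A. (\<lambda>k. f (r k) a) \<longlonglongrightarrow> l a)"
  using assms
proof (induction A)
  case empty
  have "strict_mono (id :: nat \<Rightarrow> nat)" by (simp add: strict_mono_def)
  then show ?case by blast
next
  case (insert a A)
  then obtain r l where r: "strict_mono (r :: nat \<Rightarrow> nat)" "\<forall>a\<in>A. (\<lambda>k. f (r k) a) \<longlonglongrightarrow> l a" by auto
  have "compact {0..1::real}" by simp
  moreover have "\<forall>k. f (r k) a \<in> {0..1}" using insert.prems by simp
  ultimately obtain x s where s: "strict_mono (s :: nat \<Rightarrow> nat)" "((\<lambda>k. f (r k) a) \<circ> s) \<longlonglongrightarrow> x"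
    unfolding compact_def by meson
  have "(\<lambda>k. f ((r \<circ> s) k) b) \<longlonglongrightarrow> (l(a := x)) b" if "b \<in> insert a A" for b
  proof (cases "b = a")
    case True
    then show ?thesis using s(2) by (simp add: o_def)
  next
    case False
    then have "(\<lambda>k. f (r k) b) \<longlonglongrightarrow> l b" using r(2) that by simp
    from LIMSEQ_subseq_LIMSEQ[OF this s(1)] show ?thesis using False by (simp add: o_def)
  qed
  moreover have "strict_mono (r \<circ> s)" using r(1) s(1) by (rule strict_mono_o)
  ultimately show ?case by (intro exI[of _ "r \<circ> s"] exI[of _ "l(a := x)"] conjI ballI)
qed

lemma expo_vec_inject: "expo_vec a = expo_vec b \<longleftrightarrow> a = b"
  by (auto simp: vec_eq_iff intro: poly_mapping_eqI)

lemma newton_polytope_iff: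
  assumes "finite A"
  shows "p \<in> newton_polytope A \<longleftrightarrow>
    (\<exists>\<mu>. (\<forall>a\<in>A. 0 \<le> \<mu> a) \<and> (\<Sum>a\<in>A. \<mu> a) = 1 \<and> p = (\<Sum>a\<in>A. \<mu> a *\<^sub>R expo_vec a))"
proof -
  have inj: "inj_on expo_vec A" by (simp add: inj_on_def expo_vec_inject)
  show ?thesis
  proof
    assume "p \<in> newton_polytope A"
    then obtain \<mu> where "\<forall>x\<in>expo_vec ` A. 0 \<le> \<mu> x" "sum \<mu> (expo_vec ` A) = 1" "(\<Sum>x\<in>expo_vec ` A. \<mu> x *\<^sub>R x) = p"
      using assms by (auto simp: newton_polytope_def convex_hull_finite)
    then show "\<exists>\<mu>. (\<forall>a\<in>A. 0 \<le> \<mu> a) \<and> (\<Sum>a\<in>A. \<mu> a) = 1 \<and> p = (\<Sum>a\<in>A. \<mu> a *\<^sub>R expo_vec a)"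
      using inj by (intro exI[of _ "\<lambda>a. \<mu> (expo_vec a)"]) (simp add: sum.reindex)
  next
    assume "\<exists>\<mu>. (\<forall>a\<in>A. 0 \<le> \<mu> a) \<and> (\<Sum>a\<in>A. \<mu> a) = 1 \<and> p = (\<Sum>a\<in>A. \<mu> a *\<^sub>R expo_vec a)"
    then show "p \<in> newton_polytope A"
      unfolding newton_polytope_def using assms
      by (auto intro!: convex_sum convex_convex_hull intro: hull_inc)
  qed
qed

text \<open>
  The smallest face of \<open>P\<close> containing \<open>p\<close>: the points \<open>q\<close> such that a segment in \<open>P\<close> starting at \<open>q\<close> has
  \<open>p\<close> in its interior.
\<close>

definition carrier_face :: "'a::real_vector set \<Rightarrow> 'a \<Rightarrow> 'a set" where
  "carrier_face P p = {q \<in> P. \<exists>q'\<in>P. \<exists>e. 0 < e \<and> e < 1 \<and> p = e *\<^sub>R q + (1 - e) *\<^sub>R q'}"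

lemma carrier_face:
  assumes P: "convex P" "p \<in> P"
  shows "carrier_face P p face_of P" "p \<in> carrier_face P p"
proof -
  show "p \<in> carrier_face P p"
    unfolding carrier_face_def using P(2)
    by (intro CollectI conjI bexI[of _ p] exI[of _ "1/2"]) (auto simp: algebra_simps simp flip: scaleR_add_left)
  show "carrier_face P p face_of P"
    unfolding face_of_def
  proof (intro conjI ballI impI)
    show "carrier_face P p \<subseteq> P" by (auto simp: carrier_face_def)
    show "convex (carrier_face P p)"
    proof (rule convexI)
      fix x y and a b :: real
      assume x: "x \<in> carrier_face P p" and y: "y \<in> carrier_face P p" and ab: "0 \<le> a" "0 \<le> b" "a + b = 1"
      obtain x' e where x': "x \<in> P" "x' \<in> P" "0 < e" "e < 1" "p = e *\<^sub>R x + (1 - e) *\<^sub>R x'"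
        using x unfolding carrier_face_def by blast
      obtain y' f where y': "y \<in> P" "y' \<in> P" "0 < f" "f < 1" "p = f *\<^sub>R y + (1 - f) *\<^sub>R y'"
        using y unfolding carrier_face_def by blast
      \<comment> \<open>The two representations of \<open>p\<close> are averaged with weights \<open>t\<close> and \<open>1 - t\<close> such that \<open>x\<close> and \<open>y\<close> occur in the ratio \<open>a : b\<close>.\<close>
      define N where "N = a * f + b * e"
      have N: "N > 0"
        using ab x'(3) y'(3) unfolding N_def
        by (cases "a = 0") (auto intro: add_pos_nonneg)
      define t where "t = a * f / N"
      have t: "0 \<le> t" "t \<le> 1" "1 - t = b * e / N"
        using N ab x'(3) y'(3) by (auto simp: t_def N_def field_simps)
      define g where "g = e * f / N"
      have te: "t * e = g * a" "(1 - t) * f = g * b"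
        unfolding t(3) by (simp_all add: t_def g_def)
      have g: "0 < g" using N x'(3) y'(3) by (simp add: g_def)
      have ge: "g = t * e + (1 - t) * f" using te ab by (metis distrib_left mult.right_neutral)
      have g1: "g < 1"
      proof -
        have "t * e + (1 - t) * f < 1"
        proof (cases "t = 0")
          case True then show ?thesis using y' by simp
        next
          case False
          then have "t * e < t" using t x'(4) by simp
          moreover have "(1 - t) * f \<le> 1 - t" using mult_left_mono[of f 1 "1 - t"] t y'(4) by simp
          ultimately show ?thesis by simp
        qed
        then show ?thesis using ge by simp
      qed
      define q where "q = (t * (1 - e) / (1 - g)) *\<^sub>R x' + ((1 - t) * (1 - f) / (1 - g)) *\<^sub>R y'"
      have sum: "t * (1 - e) / (1 - g) + (1 - t) * (1 - f) / (1 - g) = 1"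
      proof -
        have "t * (1 - e) + (1 - t) * (1 - f) = 1 - g" unfolding ge by (simp add: algebra_simps)
        then show ?thesis using g1 by (simp add: add_divide_distrib[symmetric])
      qed
      have "q \<in> P" unfolding q_def
        by (intro convexD[OF P(1) x'(2) y'(2) _ _ sum] divide_nonneg_pos mult_nonneg_nonneg)
           (use t(1,2) g1 x'(4) y'(4) in simp_all)
      moreover have "p = g *\<^sub>R (a *\<^sub>R x + b *\<^sub>R y) + (1 - g) *\<^sub>R q"
      proof -
        have "p = t *\<^sub>R p + (1 - t) *\<^sub>R p" by (simp flip: scaleR_add_left)
        also have "\<dots> = t *\<^sub>R (e *\<^sub>R x + (1 - e) *\<^sub>R x') + (1 - t) *\<^sub>R (f *\<^sub>R y + (1 - f) *\<^sub>R y')"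
          using x'(5) y'(5) by simp
        also have "\<dots> = (t * e) *\<^sub>R x + ((1 - t) * f) *\<^sub>R y + ((t * (1 - e)) *\<^sub>R x' + ((1 - t) * (1 - f)) *\<^sub>R y')"
          by (simp only: scaleR_add_right scaleR_scaleR ac_simps)
        also have "((t * (1 - e)) *\<^sub>R x' + ((1 - t) * (1 - f)) *\<^sub>R y') = (1 - g) *\<^sub>R q"
          using g1 by (simp add: q_def scaleR_add_right)
        finally show ?thesis unfolding te by (simp add: scaleR_add_right)
      qed
      moreover have "a *\<^sub>R x + b *\<^sub>R y \<in> P" using convexD[OF P(1) x'(1) y'(1) ab] .
      ultimately show "a *\<^sub>R x + b *\<^sub>R y \<in> carrier_face P p"
        unfolding carrier_face_def using g g1 by blast
    qed
    have half: "a \<in> carrier_face P p"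
      if ab: "a \<in> P" "b \<in> P" and x: "x \<in> carrier_face P p" and seg: "x \<in> open_segment a b" for a b x
    proof -
      obtain x' e where x': "x' \<in> P" "0 < e" "e < 1" "p = e *\<^sub>R x + (1 - e) *\<^sub>R x'"
        using x unfolding carrier_face_def by blast
      obtain s where s: "0 < s" "s < 1" "x = (1 - s) *\<^sub>R a + s *\<^sub>R b"
        using seg unfolding in_segment by blast
      define g where "g = e * (1 - s)"
      have g: "0 < g" "g < 1"
      proof -
        show "0 < g" using x' s by (simp add: g_def)
        have "g \<le> e * 1" unfolding g_def using x' s by (intro mult_left_mono) auto
        then show "g < 1" using x' by simp
      qed
      define q where "q = (e * s / (1 - g)) *\<^sub>R b + ((1 - e) / (1 - g)) *\<^sub>R x'"
      have sum: "e * s / (1 - g) + (1 - e) / (1 - g) = 1"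
      proof -
        have "e * s + (1 - e) = 1 - g" by (simp add: g_def algebra_simps)
        then show ?thesis using g by (simp add: add_divide_distrib[symmetric])
      qed
      have "q \<in> P" unfolding q_def
        using convexD[OF P(1) ab(2) x'(1) _ _ sum] g x' s by simp
      moreover have "p = g *\<^sub>R a + (1 - g) *\<^sub>R q"
        using g by (simp add: x'(4) s(3) q_def scaleR_add_right g_def)
      ultimately show ?thesis unfolding carrier_face_def using ab g by blast
    qed
    fix a b x assume "a \<in> P" "b \<in> P" "x \<in> carrier_face P p" "x \<in> open_segment a b"
    then show "a \<in> carrier_face P p" "b \<in> carrier_face P p"
      using half[of a b x] half[of b a x] by (auto simp: open_segment_commute)
  qed
qed


lemma monom_eval_pos:
  fixes u :: "'n::finite \<Rightarrow> real"
  shows "(\<And>i. 0 < u i) \<Longrightarrow> 0 < monom_eval a u"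
  by (simp add: monom_eval_UNIV prod_pos)

text \<open>
  Let \<open>l\<close> be a limit of the vectors of normalised monomials, \<open>p = \<Sum> l\<^sub>a a\<close> and \<open>Q\<close> the smallest face containing
  \<open>p\<close>.  The support of \<open>l\<close> lies in \<open>Q\<close>.  Conversely, for \<open>a\<close> in \<open>Q\<close> there are weights \<open>\<mu>\<close> with the same
  barycentre \<open>p\<close> and \<open>\<mu>\<^sub>a > 0\<close>.  The logarithms of the normalised monomials are affine in the exponent,
  so their averages with weights \<open>l\<close> and \<open>\<mu>\<close> agree; the first stays bounded, hence the
  logarithm at \<open>a\<close> is bounded below, and \<open>l\<^sub>a > 0\<close>.  On \<open>Q\<close> the logarithms converge, and a limit of affine
  functions on a finite set is affine, which gives the point \<open>w\<close>.
\<close>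

lemma toric_limit:
  fixes u :: "nat \<Rightarrow> 'n::finite \<Rightarrow> real"
  assumes A: "finite A" "A \<noteq> {}" and u: "\<And>k i. 0 < u k i"
  shows "\<exists>r Q w C. strict_mono (r :: nat \<Rightarrow> nat) \<and> Q \<in> poly_faces A \<and> {a \<in> A. expo_vec a \<in> Q} \<noteq> {} \<and>
    (\<forall>i. 0 < w i) \<and> 0 < (C :: real) \<and>
    (\<forall>a\<in>A. (\<lambda>k. monom_eval a (u (r k)) / (\<Sum>b\<in>A. monom_eval b (u (r k)))) \<longlonglongrightarrow>
      (if expo_vec a \<in> Q then C * monom_eval a w else 0))"
proof -
  define s where "s k = (\<Sum>b\<in>A. monom_eval b (u k))" for k
  define \<Lambda> where "\<Lambda> k a = monom_eval a (u k) / s k" for k a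
  have un: "u k i \<noteq> 0" for k i using u[of k i] by simp
  have mpos: "0 < monom_eval a (u k)" for a k using u by (rule monom_eval_pos)
  have spos: "0 < s k" for k unfolding s_def using A mpos by (intro sum_pos)
  have \<Lambda>pos: "0 < \<Lambda> k a" for k a using mpos spos by (simp add: \<Lambda>_def)
  have \<Lambda>sum: "(\<Sum>a\<in>A. \<Lambda> k a) = 1" for k
    using spos[of k] by (simp add: \<Lambda>_def s_def flip: sum_divide_distrib)
  have \<Lambda>le: "\<Lambda> k a \<le> 1" if "a \<in> A" for k a
    using member_le_sum[of a A "\<Lambda> k"] that A(1) \<Lambda>pos \<Lambda>sum by (simp add: less_imp_le)
  have "\<exists>r l. strict_mono (r :: nat \<Rightarrow> nat) \<and> (\<forall>a\<in>A. (\<lambda>k. \<Lambda> (r k) a) \<longlonglongrightarrow> l a)"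
    using A(1) \<Lambda>le \<Lambda>pos by (intro convergent_subsequence_family) (auto simp: less_imp_le)
  then obtain r l where r: "strict_mono (r :: nat \<Rightarrow> nat)" and lim': "\<forall>a\<in>A. (\<lambda>k. \<Lambda> (r k) a) \<longlonglongrightarrow> l a"
    by (elim exE conjE)
  have lim: "(\<lambda>k. \<Lambda> (r k) a) \<longlonglongrightarrow> l a" if "a \<in> A" for a using lim' that by blast
  have l0: "0 \<le> l a" if "a \<in> A" for a
    using LIMSEQ_le_const[OF lim[OF that], of 0] \<Lambda>pos by (auto simp: less_imp_le)
  have l1: "(\<Sum>a\<in>A. l a) = 1"
  proof -
    have "(\<lambda>k. \<Sum>a\<in>A. \<Lambda> (r k) a) \<longlonglongrightarrow> (\<Sum>a\<in>A. l a)" by (intro tendsto_sum lim)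
    then show ?thesis by (simp add: \<Lambda>sum LIMSEQ_const_iff)
  qed
  define p where "p = (\<Sum>a\<in>A. l a *\<^sub>R expo_vec a)"
  let ?P = "newton_polytope A"
  define Q where "Q = carrier_face ?P p"
  have pP: "p \<in> ?P" using newton_polytope_iff[OF A(1)] l0 l1 p_def by blast
  have "convex ?P" by (simp add: newton_polytope_def)
  then have Q: "Q face_of ?P" "p \<in> Q" unfolding Q_def using carrier_face pP by blast+
  have eP: "expo_vec a \<in> ?P" if "a \<in> A" for a
    unfolding newton_polytope_def using that by (intro hull_inc) auto
  have supp_Q: "expo_vec a \<in> Q" if a: "a \<in> A" "0 < l a" for a
  proof -
    define e where "e = l a / 2"
    have "l a \<le> 1" using member_le_sum[of a A l] a(1) l0 l1 A(1) by simp
    then have e: "0 < e" "e < 1" "e \<le> l a" using a(2) by (auto simp: e_def)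
    define \<nu> where "\<nu> b = (l b - (if b = a then e else 0)) / (1 - e)" for b
    define q where "q = (\<Sum>b\<in>A. \<nu> b *\<^sub>R expo_vec b)"
    have "(\<Sum>b\<in>A. l b - (if b = a then e else 0)) = 1 - e"
      using a A(1) l1 by (simp add: sum_subtractf)
    then have "(\<Sum>b\<in>A. \<nu> b) = 1" using e unfolding \<nu>_def by (simp flip: sum_divide_distrib)
    moreover have "0 \<le> \<nu> b" if "b \<in> A" for b using e l0[OF that] by (auto simp: \<nu>_def)
    ultimately have "q \<in> ?P" using newton_polytope_iff[OF A(1)] q_def by blast
    moreover have "p = e *\<^sub>R expo_vec a + (1 - e) *\<^sub>R q"
    proof -
      have "(1 - e) *\<^sub>R q = (\<Sum>b\<in>A. (l b - (if b = a then e else 0)) *\<^sub>R expo_vec b)"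
        using e by (simp add: q_def scaleR_sum_right \<nu>_def)
      also have "\<dots> = (\<Sum>b\<in>A. l b *\<^sub>R expo_vec b - (if b = a then e *\<^sub>R expo_vec b else 0))"
        by (intro sum.cong) (auto simp: scaleR_diff_left)
      also have "\<dots> = p - e *\<^sub>R expo_vec a" using a A(1) by (simp add: sum_subtractf p_def)
      finally show ?thesis by simp
    qed
    ultimately show ?thesis unfolding Q_def carrier_face_def using e eP[OF a(1)] by blast
  qed
  define \<theta> where "\<theta> k = (\<chi> i. ln (u (r k) i))" for k
  define \<sigma> where "\<sigma> k = ln (s (r k))" for k
  have ln\<Lambda>: "ln (\<Lambda> (r k) a) = inner (\<theta> k) (expo_vec a) - \<sigma> k" for k a
  proof -
    have "ln (monom_eval a (u (r k))) = (\<Sum>i\<in>UNIV. ln (u (r k) i ^ lookup a i))"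
      unfolding monom_eval_UNIV using un by (intro ln_prod) auto
    also have "\<dots> = inner (\<theta> k) (expo_vec a)"
      using u by (simp add: inner_vec_def \<theta>_def ln_realpow mult.commute)
    finally show ?thesis
      using mpos[of a "r k"] spos[of "r k"] by (simp add: \<Lambda>_def \<sigma>_def ln_div)
  qed
  have barycentre: "(\<Sum>a\<in>A. \<mu> a * ln (\<Lambda> (r k) a)) = inner (\<theta> k) p - \<sigma> k"
    if "(\<Sum>a\<in>A. \<mu> a) = 1" "p = (\<Sum>a\<in>A. \<mu> a *\<^sub>R expo_vec a)" for \<mu> k
    using that(1) by (simp add: ln\<Lambda> right_diff_distrib sum_subtractf that(2) inner_sum_right flip: sum_distrib_right)
  have Q_supp: "0 < l a" if a: "a \<in> A" "expo_vec a \<in> Q" for a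
  proof -
    obtain q e where q: "q \<in> ?P" "0 < e" "e < 1" "p = e *\<^sub>R expo_vec a + (1 - e) *\<^sub>R q"
      using a(2) unfolding Q_def carrier_face_def by blast
    obtain \<nu> where \<nu>: "\<forall>b\<in>A. 0 \<le> \<nu> b" "(\<Sum>b\<in>A. \<nu> b) = 1" "q = (\<Sum>b\<in>A. \<nu> b *\<^sub>R expo_vec b)"
      using q(1) newton_polytope_iff[OF A(1)] by blast
    define \<mu> where "\<mu> b = (1 - e) * \<nu> b + (if b = a then e else 0)" for b
    have \<mu>: "(\<Sum>b\<in>A. \<mu> b) = 1" "0 \<le> \<mu> b" if "b \<in> A" for b
      using a A(1) \<nu> q that by (auto simp: \<mu>_def sum.distrib simp flip: sum_distrib_left)
    have \<mu>sum: "(\<Sum>b\<in>A. \<mu> b) = 1" using \<mu>(1)[OF a(1)] .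
    have \<mu>p: "p = (\<Sum>b\<in>A. \<mu> b *\<^sub>R expo_vec b)"
    proof -
      have "(\<Sum>b\<in>A. \<mu> b *\<^sub>R expo_vec b) =
        (\<Sum>b\<in>A. (1 - e) *\<^sub>R (\<nu> b *\<^sub>R expo_vec b) + (if b = a then e *\<^sub>R expo_vec b else 0))"
        by (intro sum.cong) (auto simp: \<mu>_def scaleR_add_left)
      also have "\<dots> = (1 - e) *\<^sub>R q + e *\<^sub>R expo_vec a"
        using a A(1) by (simp add: sum.distrib \<nu>(3) scaleR_sum_right)
      finally show ?thesis using q(4) by (simp add: add.commute)
    qed
    define S where "S k = (\<Sum>b\<in>A. l b * ln (\<Lambda> (r k) b))" for k
    have "(\<lambda>k. l b * ln (\<Lambda> (r k) b)) \<longlonglongrightarrow> l b * ln (l b)" if b: "b \<in> A" for b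
    proof (cases "l b = 0")
      case False
      then show ?thesis using lim[OF b] by (intro tendsto_mult tendsto_const tendsto_ln)
    qed simp
    then have "S \<longlonglongrightarrow> (\<Sum>b\<in>A. l b * ln (l b))" unfolding S_def by (intro tendsto_sum)
    then have "Bseq S" by (intro convergent_imp_Bseq) (auto simp: convergent_def)
    then obtain K where K: "\<And>k. norm (S k) \<le> K" unfolding Bseq_def by blast
    have lower: "exp (- K / e) \<le> \<Lambda> (r k) a" for k
    proof -
      have "S k = (\<Sum>b\<in>A. \<mu> b * ln (\<Lambda> (r k) b))"
        unfolding S_def using barycentre[OF l1 p_def] barycentre[OF \<mu>sum \<mu>p] by simp
      also have "\<dots> = \<mu> a * ln (\<Lambda> (r k) a) + (\<Sum>b\<in>A - {a}. \<mu> b * ln (\<Lambda> (r k) b))"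
        using A(1) a(1) by (rule sum.remove)
      also have "\<dots> \<le> \<mu> a * ln (\<Lambda> (r k) a) + 0"
        using \<mu>(2) \<Lambda>le \<Lambda>pos by (intro add_left_mono sum_nonpos) (auto simp: mult_le_0_iff)
      also have "\<dots> \<le> e * ln (\<Lambda> (r k) a)"
      proof -
        have "e \<le> \<mu> a" using \<nu>(1) a(1) q(3) by (simp add: \<mu>_def)
        then show ?thesis using \<Lambda>le[OF a(1), of "r k"] \<Lambda>pos[of "r k" a] by (simp add: mult_right_mono_neg)
      qed
      finally have "- K \<le> e * ln (\<Lambda> (r k) a)" using K[of k] by simp
      then have "- K / e \<le> ln (\<Lambda> (r k) a)" by (simp only: pos_divide_le_eq[OF q(2)] mult.commute[of e])
      then show ?thesis using \<Lambda>pos[of "r k" a] by (metis exp_le_cancel_iff exp_ln)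
    qed
    have "exp (- K / e) \<le> l a" using LIMSEQ_le_const[OF lim[OF a(1)]] lower by blast
    then show ?thesis by (rule less_le_trans[OF exp_gt_zero])
  qed
  let ?B = "{a \<in> A. expo_vec a \<in> Q}"
  \<comment> \<open>Affine functions of the exponent become linear on vectors \<open>(a, 1)\<close>; \<open>\<phi>\<close> extends the limit linearly from a basis.\<close>
  define \<Phi> where "\<Phi> k = inner (\<theta> k, - \<sigma> k)" for k
  let ?E = "(\<lambda>a. (expo_vec a, 1 :: real)) ` ?B"
  obtain \<beta> where \<beta>: "\<beta> \<subseteq> ?E" "independent \<beta>" "?E \<subseteq> span \<beta>" using maximal_independent_subset[of ?E] by blast
  have lim\<Phi>: "(\<lambda>k. \<Phi> k (expo_vec a, 1)) \<longlonglongrightarrow> ln (l a)" if a: "a \<in> A" "expo_vec a \<in> Q" for a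
  proof -
    have "(\<lambda>k. ln (\<Lambda> (r k) a)) \<longlonglongrightarrow> ln (l a)"
      using Q_supp[OF a] by (intro tendsto_ln lim a) simp
    then show ?thesis by (simp add: \<Phi>_def ln\<Lambda>)
  qed
  obtain \<phi> :: "(real ^ 'n) \<times> real \<Rightarrow> real" where \<phi>: "linear \<phi>" "\<forall>x\<in>\<beta>. \<phi> x = lim (\<lambda>k. \<Phi> k x)"
    using linear_independent_extend[OF \<beta>(2), of "\<lambda>x. lim (\<lambda>k. \<Phi> k x)"] by blast
  have span: "(\<lambda>k. \<Phi> k x) \<longlonglongrightarrow> \<phi> x" if "x \<in> span \<beta>" for x
    using that
  proof (induction rule: span_induct_alt)
    case base
    then show ?case using linear_0[OF \<phi>(1)] by (simp add: \<Phi>_def)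
  next
    case (step c x y)
    obtain a where a: "a \<in> A" "expo_vec a \<in> Q" "x = (expo_vec a, 1)" using \<beta>(1) step(1) by blast
    have "(\<lambda>k. \<Phi> k x) \<longlonglongrightarrow> \<phi> x"
      using lim\<Phi>[OF a(1,2)] \<phi>(2) step(1) a(3) by (metis limI)
    then have "(\<lambda>k. c * \<Phi> k x + \<Phi> k y) \<longlonglongrightarrow> c * \<phi> x + \<phi> y" by (intro tendsto_intros step)
    then show ?case by (simp add: \<Phi>_def inner_add_right linear_add[OF \<phi>(1)] linear_cmul[OF \<phi>(1)])
  qed
  define w where "w i = exp (\<phi> (axis i 1, 0))" for i
  define C where "C = exp (\<phi> (0, 1))"
  have l_eq: "l a = C * monom_eval a w" if a: "a \<in> A" "expo_vec a \<in> Q" for a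
  proof -
    have "(expo_vec a, 1) \<in> span \<beta>" using \<beta>(3) a by blast
    then have "ln (l a) = \<phi> (expo_vec a, 1)" using span lim\<Phi>[OF a] LIMSEQ_unique by blast
    also have "(expo_vec a, 1) = (\<Sum>i\<in>UNIV. (expo_vec a $ i) *\<^sub>R (axis i 1 :: real ^ 'n, 0 :: real)) + (0, 1)"
    proof -
      have "(\<Sum>i\<in>UNIV. (expo_vec a $ i) *\<^sub>R (axis i 1 :: real ^ 'n)) = expo_vec a"
        using basis_expansion[of "expo_vec a"] by (simp add: scalar_mult_eq_scaleR)
      then show ?thesis by (simp add: prod_eq_iff fst_sum snd_sum)
    qed
    also have "\<phi> \<dots> = (\<Sum>i\<in>UNIV. real (lookup a i) * \<phi> (axis i 1, 0)) + \<phi> (0, 1)"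
      unfolding linear_add[OF \<phi>(1)] linear_sum[OF \<phi>(1)] linear_cmul[OF \<phi>(1)] by simp
    finally have "l a = exp ((\<Sum>i\<in>UNIV. real (lookup a i) * \<phi> (axis i 1, 0)) + \<phi> (0, 1))"
      using Q_supp[OF a] by (metis exp_ln)
    then show ?thesis by (simp add: exp_add exp_sum exp_of_nat_mult C_def w_def monom_eval_UNIV mult.commute)
  qed
  have limits: "(\<lambda>k. monom_eval a (u (r k)) / (\<Sum>b\<in>A. monom_eval b (u (r k)))) \<longlonglongrightarrow>
      (if expo_vec a \<in> Q then C * monom_eval a w else 0)" if a: "a \<in> A" for a
  proof -
    have "l a = (if expo_vec a \<in> Q then C * monom_eval a w else 0)"
      using l_eq[OF a] supp_Q[OF a] l0[OF a] by (cases "l a = 0") auto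
    then show ?thesis using lim[OF a] by (simp add: \<Lambda>_def s_def)
  qed
  have "?B \<noteq> {}"
  proof
    assume "?B = {}"
    then have "l a = 0" if "a \<in> A" for a using supp_Q[OF that] l0[OF that] that by force
    then show False using l1 by simp
  qed
  moreover have "Q \<in> poly_faces A" using Q by (auto simp: poly_faces_def)
  moreover have "0 < w i" for i by (simp add: w_def)
  moreover have "0 < C" by (simp add: C_def)
  ultimately show ?thesis using r limits
    by (intro exI[of _ r] exI[of _ Q] exI[of _ w] exI[of _ C] conjI ballI allI) simp_all
qed

text \<open>
  Dividing by the sum of all monomials and passing to the limit turns the negative values into a
  nonpositive value of the restriction to a face.  Rescaling \<open>u\<^sub>k\<close> coordinatewise by \<open>w' / w\<close>
  moves the limit point from \<open>w\<close> to an arbitrary positive \<open>w'\<close>, so the restriction is nonnegative.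
\<close>

lemma nonneg_limit_face_zero:
  fixes u :: "nat \<Rightarrow> 'n::finite \<Rightarrow> real"
  assumes A: "finite A"
    and c: "\<And>a. a \<in> A \<Longrightarrow> (\<lambda>k. ck k a) \<longlonglongrightarrow> c a"
    and u: "\<And>k i. 0 < u k i" and neg: "\<And>k. (\<Sum>a\<in>A. ck k a * monom_eval a (u k)) < 0"
    and nonneg: "\<And>w. (\<And>i. 0 < w i) \<Longrightarrow> 0 \<le> (\<Sum>a\<in>A. c a * monom_eval a w)"
  shows "\<exists>Q\<in>poly_faces A. {a \<in> A. expo_vec a \<in> Q} \<noteq> {} \<and> (\<exists>w. (\<forall>i. 0 < w i) \<and>
    (\<Sum>a\<in>{a \<in> A. expo_vec a \<in> Q}. c a * monom_eval a w) = 0 \<and>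
    (\<forall>w'. (\<forall>i. 0 < w' i) \<longrightarrow> 0 \<le> (\<Sum>a\<in>{a \<in> A. expo_vec a \<in> Q}. c a * monom_eval a w')))"
proof -
  have "A \<noteq> {}" using neg[of 0] by auto
  then obtain r Q w C where r: "strict_mono (r :: nat \<Rightarrow> nat)" and Q: "Q \<in> poly_faces A" "{a \<in> A. expo_vec a \<in> Q} \<noteq> {}"
    and w: "\<forall>i. 0 < w i" and C: "0 < (C :: real)"
    and lim: "\<forall>a\<in>A. (\<lambda>k. monom_eval a (u (r k)) / (\<Sum>b\<in>A. monom_eval b (u (r k)))) \<longlonglongrightarrow>
      (if expo_vec a \<in> Q then C * monom_eval a w else 0)"
    using toric_limit[of A u] A u by blast
  let ?B = "{a \<in> A. expo_vec a \<in> Q}"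
  define s where "s k = (\<Sum>b\<in>A. monom_eval b (u k))" for k
  have spos: "0 < s k" for k unfolding s_def using A \<open>A \<noteq> {}\<close> monom_eval_pos[OF u] by (intro sum_pos)
  have split: "(\<Sum>a\<in>A. h a * (if expo_vec a \<in> Q then C * monom_eval a w else 0)) = C * (\<Sum>a\<in>?B. h a * monom_eval a w)"
    for h :: "'n expo \<Rightarrow> real"
  proof -
    have "(\<Sum>a\<in>?B. h a * monom_eval a w) = (\<Sum>a\<in>A. if expo_vec a \<in> Q then h a * monom_eval a w else 0)"
      using A by (simp add: sum.inter_filter)
    then have "C * (\<Sum>a\<in>?B. h a * monom_eval a w) = (\<Sum>a\<in>A. C * (if expo_vec a \<in> Q then h a * monom_eval a w else 0))"
      by (simp only: sum_distrib_left)
    also have "\<dots> = (\<Sum>a\<in>A. h a * (if expo_vec a \<in> Q then C * monom_eval a w else 0))"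
      by (intro sum.cong) auto
    finally show ?thesis by simp
  qed
  have lim_nonneg: "0 \<le> (\<Sum>a\<in>?B. c a * monom_eval a w')" if w': "\<forall>i. 0 < w' i" for w'
  proof -
    define q where "q i = w' i / w i" for i
    have L: "(\<lambda>k. \<Sum>a\<in>A. c a * monom_eval a q * (monom_eval a (u (r k)) / s (r k))) \<longlonglongrightarrow>
      (\<Sum>a\<in>A. c a * monom_eval a q * (if expo_vec a \<in> Q then C * monom_eval a w else 0))"
      using lim unfolding s_def by (intro tendsto_sum tendsto_mult_left) auto
    moreover have "0 \<le> (\<Sum>a\<in>A. c a * monom_eval a q * (monom_eval a (u (r k)) / s (r k)))" for k
    proof -
      have "0 \<le> (\<Sum>a\<in>A. c a * monom_eval a (\<lambda>i. q i * u (r k) i)) / s (r k)"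
        using w w' u spos by (intro divide_nonneg_pos nonneg) (auto simp: q_def)
      then show ?thesis by (simp add: monom_eval_mult sum_divide_distrib mult_ac)
    qed
    ultimately have "0 \<le> C * (\<Sum>a\<in>?B. c a * monom_eval a q * monom_eval a w)"
      using LIMSEQ_le_const[OF L[unfolded split], of 0] by blast
    moreover have "monom_eval a q * monom_eval a w = monom_eval a w'" for a
    proof -
      have "w i \<noteq> 0" for i using w by (metis less_irrefl)
      then show ?thesis unfolding monom_eval_mult[symmetric] by (simp add: q_def)
    qed
    ultimately show ?thesis using C by (simp add: mult.assoc zero_le_mult_iff)
  qed
  have L: "(\<lambda>k. \<Sum>a\<in>A. ck (r k) a * (monom_eval a (u (r k)) / s (r k))) \<longlonglongrightarrow>
    (\<Sum>a\<in>A. c a * (if expo_vec a \<in> Q then C * monom_eval a w else 0))"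
    using lim LIMSEQ_subseq_LIMSEQ[OF c r] unfolding s_def
    by (intro tendsto_sum tendsto_mult) (auto simp: o_def)
  moreover have "(\<Sum>a\<in>A. ck (r k) a * (monom_eval a (u (r k)) / s (r k))) \<le> 0" for k
    using neg[of "r k"] spos[of "r k"] by (simp add: sum_divide_distrib[symmetric] divide_nonpos_pos less_imp_le)
  ultimately have "C * (\<Sum>a\<in>?B. c a * monom_eval a w) \<le> 0"
    using LIMSEQ_le_const2[OF L[unfolded split], of 0] by blast
  then have "(\<Sum>a\<in>?B. c a * monom_eval a w) \<le> 0" using C by (simp add: mult_le_0_iff)
  then have "(\<Sum>a\<in>?B. c a * monom_eval a w) = 0" using lim_nonneg[OF w] by simp
  then show ?thesis using Q w lim_nonneg by (intro bexI[OF _ Q(1)] conjI exI[of _ w]) auto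
qed

section \<open>The boundary of the copositive cone\<close>

definition copositive :: "'n::finite expo set \<Rightarrow> ('n expo \<Rightarrow> real) \<Rightarrow> bool" where
  "copositive A c \<longleftrightarrow> (\<forall>u. (\<forall>i. 0 \<le> u i) \<longrightarrow> 0 \<le> (\<Sum>a\<in>A. c a * monom_eval a u))"

text \<open>
  The topological boundary in terms of coefficient functions defined for all exponents, which can be
  moved along \<open>(1, \<dots>, 1)\<close> in all variables at once.
\<close>

definition copositive_boundary :: "'n::finite expo set \<Rightarrow> ('n expo \<Rightarrow> real) \<Rightarrow> bool" where
  "copositive_boundary A c \<longleftrightarrow> (\<forall>\<epsilon>>0. (\<exists>g. (\<forall>a\<in>A. \<bar>g a - c a\<bar> < \<epsilon>) \<and> copositive A g) \<and>
    (\<exists>g. (\<forall>a\<in>A. \<bar>g a - c a\<bar> < \<epsilon>) \<and> \<not> copositive A g))"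

lemma copositive_cone_iff:
  "finite A \<Longrightarrow> f \<in> copositive_cone A \<longleftrightarrow> f \<in> polys_on A \<and> copositive A (lookup f)"
  by (auto simp: copositive_cone_def copositive_def polys_on_def mpoly_eval_superset)

lemma frontier_imp_boundary:
  fixes A :: "'n::finite expo set"
  assumes A: "finite A" and f: "f \<in> coeff_space_topology A frontier_of copositive_cone A"
  shows "f \<in> polys_on A" "copositive_boundary A (lookup f)"
proof -
  let ?X = "coeff_space_topology A"
  have cl: "f \<in> ?X closure_of copositive_cone A" and int: "f \<notin> ?X interior_of copositive_cone A"
    using f by (auto simp: frontier_of_def)
  show fA: "f \<in> polys_on A"
    using cl by (auto simp: in_closure_of coeff_space_topology_def topspace_pullback_topology)
  show "copositive_boundary A (lookup f)"
    unfolding copositive_boundary_def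
  proof (intro allI impI)
    fix \<epsilon> :: real assume \<epsilon>: "\<epsilon> > 0"
    define U where "U = (\<Inter>a\<in>A. {g :: 'n expo \<Rightarrow> real. \<bar>g a - lookup f a\<bar> < \<epsilon>})"
    define N where "N = lookup -` U \<inter> polys_on A"
    have "open U" unfolding U_def
      by (intro open_INT A ballI open_Collect_less continuous_intros continuous_on_product_coordinates)
    then have N: "openin ?X N"
      unfolding coeff_space_topology_def N_def openin_pullback_topology by auto
    have fN: "f \<in> N" using fA \<epsilon> by (simp add: N_def U_def)
    obtain h where h: "h \<in> copositive_cone A" "h \<in> N" using cl N fN unfolding in_closure_of by blast
    have "\<not> N \<subseteq> copositive_cone A" using int interior_of_maximal[OF _ N] fN by blast
    then obtain g where g: "g \<in> N" "g \<notin> copositive_cone A" by blast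
    have "\<forall>a\<in>A. \<bar>lookup h a - lookup f a\<bar> < \<epsilon>" "copositive A (lookup h)"
      "\<forall>a\<in>A. \<bar>lookup g a - lookup f a\<bar> < \<epsilon>" "\<not> copositive A (lookup g)"
      using h g copositive_cone_iff[OF A] by (auto simp: N_def U_def)
    then show "(\<exists>g. (\<forall>a\<in>A. \<bar>g a - lookup f a\<bar> < \<epsilon>) \<and> copositive A g) \<and>
      (\<exists>g. (\<forall>a\<in>A. \<bar>g a - lookup f a\<bar> < \<epsilon>) \<and> \<not> copositive A g)" by blast
  qed
qed

lemma copositive_mono:
  assumes "copositive A g" "\<And>a. a \<in> A \<Longrightarrow> g a \<le> g' a"
  shows "copositive A g'"
  unfolding copositive_def
proof (intro allI impI)
  fix u :: "'a \<Rightarrow> real" assume u: "\<forall>i. 0 \<le> u i"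
  have "0 \<le> (\<Sum>a\<in>A. g a * monom_eval a u)" using assms(1) u by (simp add: copositive_def)
  also have "\<dots> \<le> (\<Sum>a\<in>A. g' a * monom_eval a u)"
    using u assms(2) by (intro sum_mono mult_right_mono) (auto simp: monom_eval_def intro!: prod_nonneg)
  finally show "0 \<le> (\<Sum>a\<in>A. g' a * monom_eval a u)" .
qed

text \<open>
  Increasing coefficients preserves copositivity.  Since \<open>f\<close> has copositive and non-copositive
  polynomials arbitrarily close by, \<open>h + \<epsilon>\<close> dominates one of the former and \<open>h - \<epsilon>\<close> is dominated by one of the
  latter; the transition takes place on the boundary.
\<close>

lemma boundary_crossed_diagonally:
  assumes A: "finite A" and f: "copositive_boundary A f" and h: "\<And>a. a \<in> A \<Longrightarrow> \<bar>h a - f a\<bar> < \<epsilon>" and \<epsilon>: "0 < \<epsilon>"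
  shows "\<exists>s. \<bar>s\<bar> \<le> \<epsilon> \<and> copositive_boundary A (\<lambda>a. h a + s)"
proof -
  define S where "S = {s. copositive A (\<lambda>a. h a + s)}"
  define M where "M = Max (insert 0 ((\<lambda>a. \<bar>h a - f a\<bar>) ` A))"
  have M: "M < \<epsilon>" using A h \<epsilon> by (simp add: M_def)
  have hM: "\<bar>h a - f a\<bar> \<le> M" if "a \<in> A" for a unfolding M_def using A that by (intro Max_ge) auto
  have up: "s' \<in> S" if "s \<in> S" "s \<le> s'" for s s'
    using that copositive_mono[of A "\<lambda>a. h a + s" "\<lambda>a. h a + s'"] by (simp add: S_def)
  obtain g where g: "\<forall>a\<in>A. \<bar>g a - f a\<bar> < \<epsilon> - M" "copositive A g"
    using f M unfolding copositive_boundary_def by (metis diff_gt_0_iff_gt)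
  obtain g' where g': "\<forall>a\<in>A. \<bar>g' a - f a\<bar> < \<epsilon> - M" "\<not> copositive A g'"
    using f M unfolding copositive_boundary_def by (metis diff_gt_0_iff_gt)
  have "g a \<le> h a + \<epsilon>" if "a \<in> A" for a using bspec[OF g(1) that] hM[OF that] by linarith
  then have "\<epsilon> \<in> S" unfolding S_def using copositive_mono[OF g(2)] by simp
  have "h a + - \<epsilon> \<le> g' a" if "a \<in> A" for a using bspec[OF g'(1) that] hM[OF that] by linarith
  then have "- \<epsilon> \<notin> S" unfolding S_def using copositive_mono[of A "\<lambda>a. h a + - \<epsilon>" g'] g'(2) by blast
  then have low: "- \<epsilon> \<le> s" if "s \<in> S" for s using up[OF that, of "- \<epsilon>"] by linarith
  then have bdd: "bdd_below S" by (rule bdd_belowI)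
  define s where "s = Inf S"
  have "s \<le> \<epsilon>" unfolding s_def using \<open>\<epsilon> \<in> S\<close> bdd by (rule cInf_lower)
  moreover have "- \<epsilon> \<le> s" unfolding s_def using \<open>\<epsilon> \<in> S\<close> low by (intro cInf_greatest) auto
  moreover have "copositive_boundary A (\<lambda>a. h a + s)"
    unfolding copositive_boundary_def
  proof (intro allI impI)
    fix \<eta> :: real assume \<eta>: "\<eta> > 0"
    have "Inf S < s + \<eta> / 2" using \<eta> by (simp add: s_def)
    then obtain s' where "s' \<in> S" "s' < s + \<eta> / 2" using cInf_lessD[of S] \<open>\<epsilon> \<in> S\<close> by blast
    then have "s + \<eta> / 2 \<in> S" using up by simp
    moreover have "s - \<eta> / 2 \<notin> S" using cInf_lower[OF _ bdd, of "s - \<eta> / 2"] \<eta> by (auto simp: s_def)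
    ultimately show "(\<exists>g. (\<forall>a\<in>A. \<bar>g a - (h a + s)\<bar> < \<eta>) \<and> copositive A g) \<and>
      (\<exists>g. (\<forall>a\<in>A. \<bar>g a - (h a + s)\<bar> < \<eta>) \<and> \<not> copositive A g)"
      using \<eta> by (intro conjI exI[of _ "\<lambda>a. h a + (s + \<eta> / 2)"] exI[of _ "\<lambda>a. h a + (s - \<eta> / 2)"])
        (auto simp: S_def)
  qed
  ultimately show ?thesis by (intro exI[of _ s]) simp
qed

lemma not_copositive_interior_point:
  assumes A: "finite A" and g: "\<not> copositive A g"
  shows "\<exists>u. (\<forall>i. 0 < u i) \<and> (\<Sum>a\<in>A. g a * monom_eval a u) < 0"
proof -
  obtain u where u: "\<forall>i. 0 \<le> u i" "(\<Sum>a\<in>A. g a * monom_eval a u) < 0"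
    using g by (auto simp: copositive_def not_le)
  let ?p = "\<lambda>t. \<Sum>a\<in>A. g a * monom_eval a (\<lambda>i. u i + t)"
  have "isCont ?p 0" unfolding monom_eval_def by (intro continuous_intros)
  then have "(?p \<longlongrightarrow> ?p 0) (at_right 0)" by (auto simp: isCont_def intro: filterlim_mono at_le)
  then have "eventually (\<lambda>t. ?p t < 0) (at_right 0)"
    using u(2) by (intro order_tendstoD(2)) auto
  moreover have "eventually (\<lambda>t. t > (0::real)) (at_right 0)" by (simp add: eventually_at_right_less)
  ultimately have "eventually (\<lambda>t. ?p t < 0 \<and> t > 0) (at_right 0)" by eventually_elim simp
  then obtain t :: real where "?p t < 0" "t > 0" using eventually_happens trivial_limit_at_right_real by blast
  then show ?thesis using u(1) by (intro exI[of _ "\<lambda>i. u i + t"]) (auto intro: add_nonneg_pos)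
qed

text \<open>
  A zero of a function that is nonnegative on an open set is a local minimum in each coordinate.
\<close>

lemma minimum_zero_singular:
  fixes B :: "'n::finite expo set" and c :: "'n expo \<Rightarrow> real"
  assumes w: "\<forall>i. 0 < w i" and zero: "(\<Sum>a\<in>B. c a * monom_eval a w) = 0"
    and min: "\<forall>w'. (\<forall>i. 0 < w' i) \<longrightarrow> 0 \<le> (\<Sum>a\<in>B. c a * monom_eval a w')"
  shows "(\<lambda>a. complex_of_real (c a)) \<in> sing_coeffs B"
proof -
  let ?w = "\<lambda>i. complex_of_real (w i)"
  have mono: "monom_eval b ?w = of_real (monom_eval b w)" for b :: "'n expo" by (simp add: monom_eval_def)
  have deriv: "(\<Sum>b\<in>B. of_nat (lookup b i) * (c b * monom_eval b w)) = 0" for i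
  proof -
    obtain D where D: "((\<lambda>t. \<Sum>b\<in>B. c b * monom_eval b (w(i := t))) has_field_derivative D) (at (w i))"
      "w i * D = (\<Sum>b\<in>B. of_nat (lookup b i) * (c b * monom_eval b w))"
      using euler_derivative by blast
    have "D = 0"
    proof (rule DERIV_local_min[OF D(1)])
      show "0 < w i" using w by blast
      show "\<forall>y. \<bar>w i - y\<bar> < w i \<longrightarrow> (\<Sum>b\<in>B. c b * monom_eval b (w(i := w i))) \<le> (\<Sum>b\<in>B. c b * monom_eval b (w(i := y)))"
      proof (intro allI impI)
        fix y assume "\<bar>w i - y\<bar> < w i"
        then have "\<forall>j. 0 < (w(i := y)) j" using w by auto
        then show "(\<Sum>b\<in>B. c b * monom_eval b (w(i := w i))) \<le> (\<Sum>b\<in>B. c b * monom_eval b (w(i := y)))"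
          using min zero by simp
      qed
    qed
    then show ?thesis using D(2) by simp
  qed
  have "(\<Sum>b\<in>B. complex_of_real (c b) * monom_eval b ?w) = of_real (\<Sum>b\<in>B. c b * monom_eval b w)"
    by (simp add: mono)
  moreover have "(\<Sum>b\<in>B. of_nat (lookup b i) * (complex_of_real (c b) * monom_eval b ?w)) =
    of_real (\<Sum>b\<in>B. of_nat (lookup b i) * (c b * monom_eval b w))" for i
    by (simp add: mono)
  moreover have "?w i \<noteq> 0" for i using w by (metis less_irrefl of_real_eq_0_iff)
  ultimately show ?thesis unfolding sing_coeffs_def using zero deriv
    by (intro CollectI exI[of _ ?w]) simp
qed

theorem boundary_singular_on_face:
  fixes A :: "'n::finite expo set"
  assumes A: "finite A" and c: "copositive_boundary A c"
  shows "\<exists>Q\<in>poly_faces A. {a \<in> A. expo_vec a \<in> Q} \<noteq> {} \<and>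
    (\<lambda>a. complex_of_real (c a)) \<in> sing_coeffs {a \<in> A. expo_vec a \<in> Q}"
proof -
  have "\<exists>g u. (\<forall>a\<in>A. \<bar>g a - c a\<bar> < inverse (real (Suc k))) \<and> (\<forall>i. 0 < u i) \<and> (\<Sum>a\<in>A. g a * monom_eval a u) < 0" for k
  proof -
    obtain g where "\<forall>a\<in>A. \<bar>g a - c a\<bar> < inverse (real (Suc k))" "\<not> copositive A g"
      using c unfolding copositive_boundary_def by (metis inverse_positive_iff_positive of_nat_0_less_iff zero_less_Suc)
    then show ?thesis using not_copositive_interior_point[OF A] by blast
  qed
  then obtain g u where gu: "\<forall>k. (\<forall>a\<in>A. \<bar>g k a - c a\<bar> < inverse (real (Suc k))) \<and> (\<forall>i. 0 < u k i) \<and> (\<Sum>a\<in>A. g k a * monom_eval a (u k)) < 0"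
    by metis
  have lim: "(\<lambda>k. g k a) \<longlonglongrightarrow> c a" if "a \<in> A" for a
  proof (rule LIM_zero_cancel, rule Lim_null_comparison)
    show "eventually (\<lambda>k. norm (g k a - c a) \<le> inverse (real (Suc k))) sequentially"
      using gu that by (auto intro!: always_eventually less_imp_le)
    show "(\<lambda>k. inverse (real (Suc k))) \<longlonglongrightarrow> 0" by (rule LIMSEQ_inverse_real_of_nat)
  qed
  have nonneg: "0 \<le> (\<Sum>a\<in>A. c a * monom_eval a w)" if w: "\<And>i. 0 < w i" for w
  proof -
    have "\<exists>h. (\<forall>a\<in>A. \<bar>h a - c a\<bar> < inverse (real (Suc k))) \<and> copositive A h" for k
      using c unfolding copositive_boundary_def by (metis inverse_positive_iff_positive of_nat_0_less_iff zero_less_Suc)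
    then obtain h where h: "\<forall>k. (\<forall>a\<in>A. \<bar>h k a - c a\<bar> < inverse (real (Suc k))) \<and> copositive A (h k)" by metis
    have "(\<lambda>k. h k a) \<longlonglongrightarrow> c a" if "a \<in> A" for a
    proof (rule LIM_zero_cancel, rule Lim_null_comparison)
      show "eventually (\<lambda>k. norm (h k a - c a) \<le> inverse (real (Suc k))) sequentially"
        using h that by (auto intro!: always_eventually less_imp_le)
      show "(\<lambda>k. inverse (real (Suc k))) \<longlonglongrightarrow> 0" by (rule LIMSEQ_inverse_real_of_nat)
    qed
    then have L: "(\<lambda>k. \<Sum>a\<in>A. h k a * monom_eval a w) \<longlonglongrightarrow> (\<Sum>a\<in>A. c a * monom_eval a w)"
      by (intro tendsto_sum tendsto_mult_right)
    have "0 \<le> (\<Sum>a\<in>A. h k a * monom_eval a w)" for k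
      using h w unfolding copositive_def by (meson less_imp_le)
    then show ?thesis using LIMSEQ_le_const[OF L, of 0] by blast
  qed
  have "\<exists>Q\<in>poly_faces A. {a \<in> A. expo_vec a \<in> Q} \<noteq> {} \<and> (\<exists>w. (\<forall>i. 0 < w i) \<and>
    (\<Sum>a\<in>{a \<in> A. expo_vec a \<in> Q}. c a * monom_eval a w) = 0 \<and>
    (\<forall>w'. (\<forall>i. 0 < w' i) \<longrightarrow> 0 \<le> (\<Sum>a\<in>{a \<in> A. expo_vec a \<in> Q}. c a * monom_eval a w')))"
  proof (rule nonneg_limit_face_zero[where ck = g and u = u and c = c, OF A lim])
    show "0 < u k i" "(\<Sum>a\<in>A. g k a * monom_eval a (u k)) < 0" for k i using gu by blast+
  qed (auto intro: nonneg)
  then show ?thesis using minimum_zero_singular by blast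
qed

lemma peval_tendsto:
  assumes "\<And>v. (\<lambda>k. g k v) \<longlonglongrightarrow> c v"
  shows "(\<lambda>k. peval F (g k)) \<longlonglongrightarrow> peval F c"
  by (induction F rule: polyfun_induct) (simp_all add: assms tendsto_add tendsto_mult)

text \<open>
  On the line from \<open>f\<close> to a real point \<open>x\<close> where \<open>F\<close> is nonzero, \<open>F\<close> has finitely many zeros.
\<close>

lemma nonzero_near_real_point:
  fixes F :: "'v polyfun" and f :: "'v \<Rightarrow> real"
  assumes "F \<noteq> 0"
  shows "\<exists>x. \<forall>\<delta>>0. \<exists>t. 0 < t \<and> t < \<delta> \<and> peval F (\<lambda>v. of_real (f v + t * (x v - f v))) \<noteq> 0"
proof -
  obtain x :: "'v \<Rightarrow> real" where x: "peval F (\<lambda>v. of_real (x v)) \<noteq> 0" using nonzero_at_real_point[OF assms] by blast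
  let ?X = "\<lambda>v. [:complex_of_real (f v), of_real (x v - f v):]"
  obtain P where P: "\<forall>t. peval F (\<lambda>v. poly (?X v) t) = poly P t" using peval_along_curve[of F ?X] by blast
  have eval: "peval F (\<lambda>v. of_real (f v + t * (x v - f v))) = poly P (of_real t)" for t :: real
    using P[rule_format, of "of_real t"] by simp
  have "poly P (of_real 1) \<noteq> 0" using x eval[of 1] by simp
  then have "P \<noteq> 0" by auto
  then have fin: "finite {z. poly P z = 0}" by (rule poly_roots_finite)
  have "\<exists>t. 0 < t \<and> t < \<delta> \<and> poly P (of_real t) \<noteq> 0" if "0 < \<delta>" for \<delta> :: real
  proof (rule ccontr)
    assume "\<not> ?thesis"
    then have "complex_of_real ` {0<..<\<delta>} \<subseteq> {z. poly P z = 0}" by auto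
    then have "finite (complex_of_real ` {0<..<\<delta>})" using fin finite_subset by blast
    then have "finite {0<..<\<delta>}" by (rule finite_imageD) (simp add: inj_on_def)
    then show False using that infinite_Ioo by blast
  qed
  then have "\<forall>\<delta>>0. \<exists>t. 0 < t \<and> t < \<delta> \<and> peval F (\<lambda>v. of_real (f v + t * (x v - f v))) \<noteq> 0"
    unfolding eval by blast
  then show ?thesis by (intro exI[of _ x])
qed

text \<open>
  The faces in \<open>thin\<close> have a singular locus with small projection along the diagonal; \<open>F\<close> collects the
  equations of these projections.  Arbitrarily close to \<open>f\<close> there are points \<open>h\<close> with \<open>F \<noteq> 0\<close>, and the
  boundary points on the diagonal lines through them are singular on a face outside \<open>thin\<close>, whose
  discriminant therefore vanishes there.
\<close>

theorem theorem5p4: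
  fixes A :: "'n::finite expo set"
  assumes "finite A"
    and "\<exists>d. \<forall>a\<in>A. (\<Sum>i\<in>UNIV. Poly_Mapping.lookup a i) = d"
    and "aff_dim (newton_polytope A) = int CARD('n) - 1"
  shows "coeff_space_topology A frontier_of copositive_cone A
    \<subseteq> {f \<in> polys_on A.
         mpoly_eval (principal_determinant A) (\<lambda>a. complex_of_real (Poly_Mapping.lookup f a)) = 0}"
proof
  fix f assume "f \<in> coeff_space_topology A frontier_of copositive_cone A"
  note f = frontier_imp_boundary[OF assms(1) this]
  let ?f = "lookup f"
  let ?B = "\<lambda>Q. {a \<in> A. expo_vec a \<in> Q}"
  let ?E = "principal_determinant A"
  have "polytope (newton_polytope A)"
    using assms(1) by (auto simp: newton_polytope_def polytope_def)
  then have fin: "finite (poly_faces A)"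
    by (rule rev_finite_subset[OF finite_polytope_faces]) (auto simp: poly_faces_def)
  define thin where "thin = {Q \<in> poly_faces A. \<exists>F. F \<noteq> 0 \<and> F \<in> inv_along (\<lambda>_. 1) \<and> (\<forall>c\<in>sing_coeffs (?B Q). peval F c = 0)}"
  have pick: "\<forall>Q\<in>thin. \<exists>F. F \<noteq> 0 \<and> F \<in> inv_along (\<lambda>_. 1) \<and> (\<forall>c\<in>sing_coeffs (?B Q). peval F c = 0)"
    by (simp add: thin_def)
  obtain R where R: "\<forall>Q\<in>thin. R Q \<noteq> 0 \<and> R Q \<in> inv_along (\<lambda>_. 1) \<and> (\<forall>c\<in>sing_coeffs (?B Q). peval (R Q) c = 0)"
    using bchoice[OF pick] by (rule exE)
  have finthin: "finite thin" using fin by (simp add: thin_def)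
  define F where "F = (\<Prod>Q\<in>thin. R Q)"
  have "F \<noteq> 0" using R finthin by (simp add: F_def)
  from nonzero_near_real_point[OF this, of ?f]
  obtain x where x: "\<forall>\<delta>>0. \<exists>t. 0 < t \<and> t < \<delta> \<and> peval F (\<lambda>v. of_real (?f v + t * (x v - ?f v))) \<noteq> 0"
    by (rule exE)
  define K where "K = (\<Sum>a\<in>A. \<bar>x a - ?f a\<bar>) + 1"
  have K: "\<bar>x a - ?f a\<bar> < K" if "a \<in> A" for a
    using member_le_sum[of a A "\<lambda>a. \<bar>x a - ?f a\<bar>"] that assms(1) by (simp add: K_def)
  have K0: "0 < K" unfolding K_def by (intro add_nonneg_pos sum_nonneg) auto
  have "\<exists>g. mpoly_eval ?E (\<lambda>a. of_real (g a)) = 0 \<and>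
      (\<forall>a. \<bar>g a - ?f a\<bar> \<le> (\<bar>x a - ?f a\<bar> + K) * inverse (real (Suc k)))" for k
  proof -
    have "0 < inverse (real (Suc k))" by simp
    from x[rule_format, OF this] obtain t where t: "0 < t" "t < inverse (real (Suc k))"
      "peval F (\<lambda>v. of_real (?f v + t * (x v - ?f v))) \<noteq> 0" by blast
    let ?h = "\<lambda>a. ?f a + t * (x a - ?f a)"
    have "\<bar>?h a - ?f a\<bar> < t * K" if "a \<in> A" for a
      using K[OF that] t(1) by (simp add: abs_mult)
    then obtain s where s: "\<bar>s\<bar> \<le> t * K" "copositive_boundary A (\<lambda>a. ?h a + s)"
      using boundary_crossed_diagonally[OF assms(1) f(2), of ?h "t * K"] t(1) K0 by auto
    let ?g = "\<lambda>a. complex_of_real (?h a + s)"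
    obtain Q where Q: "Q \<in> poly_faces A" "?B Q \<noteq> {}" "?g \<in> sing_coeffs (?B Q)"
      using boundary_singular_on_face[OF assms(1) s(2)] by blast
    have "Q \<notin> thin"
    proof
      assume "Q \<in> thin"
      then have "peval (R Q) ?g = 0" using R Q(3) by blast
      then have "peval (R Q) (\<lambda>a. of_real (?h a)) = 0"
        using inv_alongD[of "R Q" "\<lambda>_. 1" "\<lambda>a. of_real (?h a)" "of_real s"] R \<open>Q \<in> thin\<close> by simp
      then have "peval F (\<lambda>a. of_real (?h a)) = 0"
        using finthin \<open>Q \<in> thin\<close> by (auto simp: F_def)
      then show False using t(3) by simp
    qed
    then have "mpoly_eval (discriminant (?B Q)) ?g = 0"
      using discriminant_or_projection[of "?B Q"] assms(1) Q by (auto simp: thin_def)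
    then have "mpoly_eval ?E ?g = 0"
      unfolding principal_determinant_def mpoly_eval_prod using fin Q(1) by auto
    moreover have "\<bar>?h a + s - ?f a\<bar> \<le> (\<bar>x a - ?f a\<bar> + K) * inverse (real (Suc k))" for a
    proof -
      have "\<bar>?h a + s - ?f a\<bar> \<le> t * \<bar>x a - ?f a\<bar> + t * K"
        using abs_triangle_ineq[of "t * (x a - ?f a)" s] s(1) t(1) by (simp add: abs_mult)
      also have "\<dots> = (\<bar>x a - ?f a\<bar> + K) * t" by (simp add: algebra_simps)
      also have "\<dots> \<le> (\<bar>x a - ?f a\<bar> + K) * inverse (real (Suc k))"
        using t(2) K0 by (intro mult_left_mono) auto
      finally show ?thesis .
    qed
    ultimately show ?thesis by (intro exI[of _ "\<lambda>a. ?h a + s"]) simp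
  qed
  then obtain g where g: "\<And>k. mpoly_eval ?E (\<lambda>a. of_real (g k a)) = 0"
    "\<And>k a. \<bar>g k a - ?f a\<bar> \<le> (\<bar>x a - ?f a\<bar> + K) * inverse (real (Suc k))" by metis
  have lim: "(\<lambda>k. g k a) \<longlonglongrightarrow> ?f a" for a
  proof (rule LIM_zero_cancel, rule Lim_null_comparison)
    show "(\<lambda>k. (\<bar>x a - ?f a\<bar> + K) * inverse (real (Suc k))) \<longlonglongrightarrow> 0"
      using tendsto_mult_left[OF LIMSEQ_inverse_real_of_nat, of "\<bar>x a - ?f a\<bar> + K"] by simp
    show "eventually (\<lambda>k. norm (g k a - ?f a) \<le> (\<bar>x a - ?f a\<bar> + K) * inverse (real (Suc k))) sequentially"
      unfolding real_norm_def by (intro always_eventually allI g(2))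
  qed
  have "(\<lambda>k. peval (polyfun_of ?E) (\<lambda>a. of_real (g k a))) \<longlonglongrightarrow> peval (polyfun_of ?E) (\<lambda>a. of_real (?f a))"
    by (intro peval_tendsto tendsto_of_real lim)
  then have "mpoly_eval ?E (\<lambda>a. of_real (?f a)) = 0"
    by (simp add: g(1) LIMSEQ_const_iff)
  then show "f \<in> {f \<in> polys_on A. mpoly_eval ?E (\<lambda>a. complex_of_real (lookup f a)) = 0}"
    using f(1) by simp
qed

end
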